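(* Suppose $u(x,t)$ is a solution of the free Schrödinger equation in the quarter plane such that $u(0,\cdot)-g_0^b\in\mathcal S([0,\infty))$, where $$g_0^b(t)=\sum_{n=-\infty}^\infty a_ne^{in\omega t},\qquad t>0,$$ is a smooth periodic function of period $\tau=\frac{2\pi}{\omega}>0$ and mean value zero, i.e. $a_0=0$. Then $$u_x(0,t)-g_1^b(t)=O(t^{-1/2}),\qquad t\to\infty,$$ where $g_1^b(t)$ is the periodic function given by $$g_1^b(t)=\sum_{n=-\infty}^\infty c_ne^{in\omega t},\qquad c_n=\begin{cases}-\sqrt{n\omega}\,a_n,&n>0,\\0,&n=0,\\ i\sqrt{-n\omega}\,a_n,&n<0.\end{cases}$$
   Context: $\mathcal S([0,\infty))=\{v\in C^\infty([0,\infty))\mid x^nv^{(m)}(x)\in L^\infty([0,\infty))\text{ for all }n,m\ge0\}$. A solution of the free Schrödinger equation in the quarter plane is a smooth function $u:[0,\infty)\times[0,\infty)\to\mathbb C$ such that $u(\cdot,t)\in\mathcal S([0,\infty))$ for each $t\ge0$ and $iu_t+u_{xx}=0$ for $x>0$ and $t>0$. *)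

theory Defs
  imports "HOL-Analysis.Analysis" "HOL-Library.Landau_Symbols"
begin

section \<open>Smooth and Schwartz functions of one real variable\<close>

text \<open>
  Functions on a subset \<open>S\<close> of the real line are modelled as total functions; derivatives are taken
  within \<open>S\<close> (so they are one-sided at a boundary point), and their values at points of \<open>S\<close>
  do not depend on the values of the function outside \<open>S\<close>.
\<close>

definition deriv_within :: "real set \<Rightarrow> (real \<Rightarrow> complex) \<Rightarrow> real \<Rightarrow> complex" where
  "deriv_within S v x = vector_derivative v (at x within S)"

definition smooth_within :: "real set \<Rightarrow> (real \<Rightarrow> complex) \<Rightarrow> bool" where
  "smooth_within S v \<longleftrightarrow>
     (\<forall>m. \<forall>x\<in>S. (deriv_within S ^^ m) v differentiable (at x within S))"

text \<open>
  For smooth \<open>v\<close> the functions below are continuous on the half-line, so being in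
  \<open>L\<^sup>\<infinity>\<close> is the same as being bounded.
\<close>

definition schwartz_half_line :: "(real \<Rightarrow> complex) set" where
  "schwartz_half_line =
     {v. smooth_within {0..} v \<and>
         (\<forall>n m. bounded ((\<lambda>x. of_real (x ^ n) * (deriv_within {0..} ^^ m) v x) ` {0..}))}"


section \<open>Solutions of the free Schroedinger equation in the quarter plane\<close>

definition partial_x :: "(real \<Rightarrow> real \<Rightarrow> complex) \<Rightarrow> real \<Rightarrow> real \<Rightarrow> complex" where
  "partial_x u x t = deriv_within {0..} (\<lambda>y. u y t) x"

definition partial_t :: "(real \<Rightarrow> real \<Rightarrow> complex) \<Rightarrow> real \<Rightarrow> real \<Rightarrow> complex" where
  "partial_t u x t = deriv_within {0..} (\<lambda>s. u x s) t"

text \<open>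
  Class \<open>C\<^sup>k\<close> on the closed quarter plane: all iterated partial derivatives of order at most
  \<open>k\<close>, in any order of differentiation, exist and are continuous up to the boundary.
\<close>

primrec Ck_quarter_plane :: "nat \<Rightarrow> (real \<Rightarrow> real \<Rightarrow> complex) \<Rightarrow> bool" where
  "Ck_quarter_plane 0 u \<longleftrightarrow> continuous_on ({0..} \<times> {0..}) (\<lambda>(x, t). u x t)"
| "Ck_quarter_plane (Suc k) u \<longleftrightarrow>
     continuous_on ({0..} \<times> {0..}) (\<lambda>(x, t). u x t) \<and>
     (\<forall>x\<ge>0. \<forall>t\<ge>0. (\<lambda>y. u y t) differentiable (at x within {0..}) \<and>
                   (\<lambda>s. u x s) differentiable (at t within {0..})) \<and>
     Ck_quarter_plane k (partial_x u) \<and> Ck_quarter_plane k (partial_t u)"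

definition smooth_quarter_plane :: "(real \<Rightarrow> real \<Rightarrow> complex) \<Rightarrow> bool" where
  "smooth_quarter_plane u \<longleftrightarrow> (\<forall>k. Ck_quarter_plane k u)"

definition schroedinger_quarter_plane_solution :: "(real \<Rightarrow> real \<Rightarrow> complex) \<Rightarrow> bool" where
  "schroedinger_quarter_plane_solution u \<longleftrightarrow>
     smooth_quarter_plane u \<and>
     (\<forall>t\<ge>0. (\<lambda>x. u x t) \<in> schwartz_half_line) \<and>
     (\<forall>x>0. \<forall>t>0. \<i> * partial_t u x t + partial_x (partial_x u) x t = 0)"


section \<open>Time-periodic boundary values\<close>

definition neumann_coeff :: "real \<Rightarrow> (int \<Rightarrow> complex) \<Rightarrow> int \<Rightarrow> complex" where
  "neumann_coeff \<omega> a n =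
     (if n > 0 then - of_real (sqrt (of_int n * \<omega>)) * a n
      else if n = 0 then 0
      else \<i> * of_real (sqrt (- of_int n * \<omega>)) * a n)"

definition neumann_periodic :: "real \<Rightarrow> (int \<Rightarrow> complex) \<Rightarrow> real \<Rightarrow> complex" where
  "neumann_periodic \<omega> a t =
     (\<Sum>\<^sub>\<infinity>n. neumann_coeff \<omega> a n * exp (\<i> * of_int n * of_real \<omega> * of_real t))"

end

(*
  The derivative p = u_x solves the same equation with Neumann datum p_x(0, t) = -i u_t(0, t).
  Pairing p with the backward Neumann kernel concentrated at the boundary point (0, T) gives, by
  Green's identity,
    sqrt pi p(0, T) + csqrt i (int_0^T p_x(0, s) (T - s)^(-1/2) ds) = O(T^(-1/2)),
  since the kernel at time 0 is of size T^(-1/2) and p(., 0) is integrable. Applied to the explicit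
  solutions exp (i mu t - sqrt mu x) the same estimate evaluates the Abel integral of each harmonic of
  the boundary value up to O(T^(-1/2)); the Schwartz part of the boundary value contributes
  O(T^(-1/2)) directly.

  Green's identity requires bounds that are locally uniform in time, whereas the solution is only
  assumed to be Schwartz at each fixed time. They are recovered from Baire's theorem and the fact
  that Green's identity itself propagates bounds in time.
*)

theory Submission
  imports Defs
begin

section \<open>Complex Gaussian kernels\<close>

text \<open>On the imaginary axis the kernel has constant modulus in y and its derivative grows, so
  with decay of \<open>p\<close> known only at each fixed time Green's identity cannot be integrated
  in time directly. Two regularisations repair this: the kernel time becomes
  \<open>Complex \<epsilon> (s0 - s)\<close> with \<epsilon> > 0, and a polynomial cut-off restricts
  y to [0, R]. The limits are taken in a fixed order: the cut-off error is at most D / R with D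
  depending on \<epsilon>, so R tends to infinity before \<epsilon> tends to 0.

  The cut-off error requires only a bound B for \<open>p\<close> on the time strip, and B disappears
  together with 1 / R. Hence plain boundedness on strips is what has to be extracted from Baire's
  theorem, and propagation returns a bound independent of the one it presupposes.

  Two sizes of the kernel are used. Its modulus, at most |z|^(-1/2), gives the rate in T but blows
  up when the two times are close. For propagation it is replaced by a bound on the integrals of the
  kernel over intervals, uniform up to the imaginary axis.\<close>

definition gauss_kernel :: "complex \<Rightarrow> real \<Rightarrow> complex" where
  "gauss_kernel z y = exp (- (of_real y)\<^sup>2 / (4 * z)) / csqrt z"

definition gauss_kernel' :: "complex \<Rightarrow> real \<Rightarrow> complex" where
  "gauss_kernel' z y = - (of_real y / (2 * z)) * gauss_kernel z y"

definition gauss_kernel'' :: "complex \<Rightarrow> real \<Rightarrow> complex" where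
  "gauss_kernel'' z y = ((of_real y)\<^sup>2 / (4 * z\<^sup>2) - 1 / (2 * z)) * gauss_kernel z y"

lemma Re_pos_imp_nonzero: "Re z > 0 \<Longrightarrow> z \<noteq> 0" "Re z > 0 \<Longrightarrow> z \<notin> \<real>\<^sub>\<le>\<^sub>0"
  by (auto simp: complex_nonpos_Reals_iff)

lemma gauss_kernel_has_vector_derivative:
  assumes "Re z > 0"
  shows "(gauss_kernel z has_vector_derivative gauss_kernel' z y) (at y within S)"
proof -
  have "((\<lambda>w. exp (- w\<^sup>2 / (4 * z)) / csqrt z) has_field_derivative gauss_kernel' z y) (at (of_real y))"
    using Re_pos_imp_nonzero[OF assms] unfolding gauss_kernel'_def gauss_kernel_def
    by (auto intro!: derivative_eq_intros simp: field_simps power2_eq_square)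
  then show ?thesis
    unfolding gauss_kernel_def [abs_def] by (rule has_vector_derivative_real_field)
qed

lemma gauss_kernel'_has_vector_derivative:
  assumes "Re z > 0"
  shows "(gauss_kernel' z has_vector_derivative gauss_kernel'' z y) (at y within S)"
proof -
  have *: "((\<lambda>y. - (of_real y / (2 * z))) has_vector_derivative - (1 / (2 * z))) (at y within S)"
    by (auto intro!: derivative_eq_intros)
  show ?thesis
    unfolding gauss_kernel'_def [abs_def] gauss_kernel''_def
    by (rule has_vector_derivative_eq_rhs
          [OF has_vector_derivative_mult [OF * gauss_kernel_has_vector_derivative [OF assms]]])
       (use Re_pos_imp_nonzero[OF assms] in
         \<open>simp add: gauss_kernel'_def field_simps power2_eq_square\<close>)
qed

text \<open>The heat equation in complex time, \<open>gauss_kernel''\<close> being the second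
  derivative in y. The factor (4 pi)^(-1/2) of the standard heat kernel is left out.\<close>

lemma gauss_kernel_has_field_derivative:
  assumes "Re z > 0"
  shows "((\<lambda>z. gauss_kernel z y) has_field_derivative gauss_kernel'' z y) (at z)"
proof -
  note nz = Re_pos_imp_nonzero[OF assms]
  have sq: "csqrt z * csqrt z = z"
    by (metis power2_csqrt power2_eq_square)
  have "((\<lambda>z. gauss_kernel z y) has_field_derivative
      exp (- (of_real y)\<^sup>2 / (4 * z)) * ((of_real y)\<^sup>2 / (4 * z\<^sup>2)) / csqrt z
      - exp (- (of_real y)\<^sup>2 / (4 * z)) * (1 / (2 * csqrt z)) / (csqrt z * csqrt z)) (at z)"
    unfolding gauss_kernel_def
    using nz by (auto intro!: derivative_eq_intros simp: power2_eq_square divide_simps)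
  also have "exp (- (of_real y)\<^sup>2 / (4 * z)) * ((of_real y)\<^sup>2 / (4 * z\<^sup>2)) / csqrt z
      - exp (- (of_real y)\<^sup>2 / (4 * z)) * (1 / (2 * csqrt z)) / (csqrt z * csqrt z)
      = gauss_kernel'' z y"
    unfolding gauss_kernel''_def gauss_kernel_def sq using nz by (simp add: field_simps)
  finally show ?thesis .
qed

text \<open>Since Re (1/z) = Re z / |z|^2, the modulus is a real Gaussian in y whose decay is lost
  as z approaches the imaginary axis. This is what a positive real part of z buys.\<close>

lemma norm_gauss_kernel:
  "norm (gauss_kernel z y) = exp (- y\<^sup>2 * Re z / (4 * (norm z)\<^sup>2)) / sqrt (norm z)"
proof -
  have "Re (- (of_real y)\<^sup>2 / (4 * z)) = - (y\<^sup>2 * Re z / (4 * (norm z)\<^sup>2))"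
  proof -
    have "- (of_real y)\<^sup>2 / (4 * z) = of_real (- y\<^sup>2 / 4) * inverse z"
      by (simp add: field_simps)
    moreover have "Re (inverse z) = Re z / (norm z)\<^sup>2"
      by (simp add: cmod_power2)
    ultimately show ?thesis
      by (simp only: Re_complex_of_real Im_complex_of_real times_complex.sel) simp
  qed
  then show ?thesis
    by (simp add: gauss_kernel_def norm_divide)
qed

lemma norm_gauss_kernel_le:
  assumes "Re z > 0"
  shows "norm (gauss_kernel z y) \<le> 1 / sqrt (norm z)"
  using assms unfolding norm_gauss_kernel
  by (intro divide_right_mono) auto

text \<open>With a = Re z / (4 |z|^2) this is t exp (-t) \<le> 1 at t = a y^2. The constant is kept
  explicit so that it can be bounded over a range of z.\<close>

lemma norm_gauss_kernel_decay:
  assumes "Re z > 0"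
  shows "y\<^sup>2 * norm (gauss_kernel z y) \<le> 4 * (norm z)\<^sup>2 / (Re z * sqrt (norm z))"
proof -
  define a where "a = Re z / (4 * (norm z)\<^sup>2)"
  have nz: "norm z > 0" using Re_pos_imp_nonzero[OF assms] by simp
  have a: "a > 0" using assms nz by (simp add: a_def)
  have "y\<^sup>2 * a \<le> exp (y\<^sup>2 * a)"
    using exp_ge_add_one_self[of "y\<^sup>2 * a"] by linarith
  then have "y\<^sup>2 * exp (- (y\<^sup>2 * a)) \<le> 1 / a"
    using a by (simp add: exp_minus field_simps)
  then have "y\<^sup>2 * exp (- (y\<^sup>2 * a)) / sqrt (norm z) \<le> 1 / a / sqrt (norm z)"
    by (intro divide_right_mono) auto
  then show ?thesis
    by (simp add: norm_gauss_kernel a_def)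
qed

text \<open>The derivative carries a factor y, and both |y| and y^2 are at most 1 + y^2, so the
  bounds on the kernel and on y^2 times the kernel suffice. The weight is what pairs with the factor
  y in the bound for \<open>cutoff'\<close>.\<close>

lemma norm_gauss_kernel'_decay:
  assumes "Re z > 0"
  shows "(1 + \<bar>y\<bar>) * norm (gauss_kernel' z y)
      \<le> 2 * (1 / (2 * norm z * sqrt (norm z)) + 2 * norm z / (Re z * sqrt (norm z)))" (is "_ \<le> 2 * ?Q")
proof -
  have nz: "norm z > 0" using Re_pos_imp_nonzero[OF assms] by simp
  have "(1 + y\<^sup>2) * norm (gauss_kernel z y) / (2 * norm z) =
      norm (gauss_kernel z y) / (2 * norm z) + y\<^sup>2 * norm (gauss_kernel z y) / (2 * norm z)"
    by (simp add: field_simps add_divide_distrib)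
  also have "\<dots> \<le> 1 / sqrt (norm z) / (2 * norm z)
      + 4 * (norm z)\<^sup>2 / (Re z * sqrt (norm z)) / (2 * norm z)"
    by (intro add_mono divide_right_mono norm_gauss_kernel_le norm_gauss_kernel_decay assms) auto
  also have "\<dots> = ?Q"
    using nz assms by (simp add: field_simps power2_eq_square)
  finally have *: "(1 + y\<^sup>2) * norm (gauss_kernel z y) / (2 * norm z) \<le> ?Q" .
  have eq: "norm (gauss_kernel' z y) = \<bar>y\<bar> * norm (gauss_kernel z y) / (2 * norm z)"
    by (simp add: gauss_kernel'_def norm_mult norm_divide)
  have "\<bar>y\<bar> \<le> 1 + y\<^sup>2"
    using zero_le_power2[of "\<bar>y\<bar> - 1"] by (simp add: power2_diff)
  then have "norm (gauss_kernel' z y) \<le> (1 + y\<^sup>2) * norm (gauss_kernel z y) / (2 * norm z)"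
    unfolding eq by (intro divide_right_mono mult_right_mono) auto
  with * have 1: "norm (gauss_kernel' z y) \<le> ?Q" by linarith
  have "\<bar>y\<bar> * norm (gauss_kernel' z y) = y\<^sup>2 * norm (gauss_kernel z y) / (2 * norm z)"
    unfolding eq by (simp add: power2_eq_square abs_mult_self_eq mult.assoc[symmetric])
  also have "\<dots> \<le> (1 + y\<^sup>2) * norm (gauss_kernel z y) / (2 * norm z)"
    by (intro divide_right_mono mult_right_mono) auto
  finally have "\<bar>y\<bar> * norm (gauss_kernel' z y) \<le> ?Q" using * by linarith
  with 1 show ?thesis unfolding distrib_right mult_1 mult_2 by (rule add_mono)
qed

lemma gauss_kernel'_minus [simp]: "gauss_kernel' z (- y) = - gauss_kernel' z y"
  by (simp add: gauss_kernel'_def gauss_kernel_def)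

lemma continuous_on_gauss_kernel [continuous_intros]:
  assumes "continuous_on S f" "continuous_on S g" "\<And>x. x \<in> S \<Longrightarrow> Re (f x) > 0"
  shows "continuous_on S (\<lambda>x. gauss_kernel (f x) (g x))"
    and "continuous_on S (\<lambda>x. gauss_kernel' (f x) (g x))"
    and "continuous_on S (\<lambda>x. gauss_kernel'' (f x) (g x))"
proof -
  have nz: "f x \<noteq> 0" "f x \<notin> \<real>\<^sub>\<le>\<^sub>0" if "x \<in> S" for x
    using assms(3)[OF that] Re_pos_imp_nonzero by blast+
  have "continuous_on S (\<lambda>x. csqrt (f x))"
    by (rule continuous_on_compose2 [OF continuous_on_csqrt assms(1)]) (use nz in auto)
  then show *: "continuous_on S (\<lambda>x. gauss_kernel (f x) (g x))"
    unfolding gauss_kernel_def using nz assms by (intro continuous_intros) auto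
  show "continuous_on S (\<lambda>x. gauss_kernel' (f x) (g x))"
    unfolding gauss_kernel'_def using nz assms by (intro continuous_intros *) auto
  show "continuous_on S (\<lambda>x. gauss_kernel'' (f x) (g x))"
    unfolding gauss_kernel''_def using nz assms by (intro continuous_intros *) auto
qed

text \<open>
  The bound is uniform in \<open>z\<close> up to the imaginary axis. Subtracting the derivative of
  \<open>- 2 z y k(y) / (y\<^sup>2 + \<bar>z\<bar>)\<close> from the kernel \<open>k\<close> leaves an absolutely integrable remainder.
\<close>

lemma norm_integral_gauss_kernel_le:
  assumes z: "Re z > 0" and ab: "a \<le> b"
  shows "norm (integral {a..b} (gauss_kernel z)) \<le> 12"
proof -
  define r where "r = norm z"
  have r: "r > 0" using Re_pos_imp_nonzero[OF z] by (simp add: r_def)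
  define h :: "real \<Rightarrow> complex" where "h y = - 2 * z * of_real (y / (y\<^sup>2 + r))" for y
  define G where "G y = h y * gauss_kernel z y" for y
  have pos: "y\<^sup>2 + r > 0" for y using r by (simp add: add_nonneg_pos)
  have dh: "(h has_vector_derivative (- 2 * z * of_real ((r - y\<^sup>2) / (y\<^sup>2 + r)\<^sup>2))) (at y within {a..b})" for y
  proof -
    have "((\<lambda>y. y / (y\<^sup>2 + r)) has_field_derivative (r - y\<^sup>2) / (y\<^sup>2 + r)\<^sup>2) (at y within {a..b})"
      using pos[of y] by (auto intro!: derivative_eq_intros simp: field_simps power2_eq_square)
    then show ?thesis unfolding h_def
      by (intro has_vector_derivative_mult_right has_vector_derivative_of_real)
  qed
  \<comment> \<open>The remainder: \<open>G' = k - e\<close>, because \<open>h\<close> times the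
    logarithmic derivative of the kernel is y^2 / (y^2 + r) = 1 - r / (y^2 + r).\<close>
  define e where "e y = of_real (r / (y\<^sup>2 + r)) * gauss_kernel z y
      + 2 * z * of_real ((r - y\<^sup>2) / (y\<^sup>2 + r)\<^sup>2) * gauss_kernel z y" for y
  have dG: "(G has_vector_derivative (gauss_kernel z y - e y)) (at y within {a..b})" for y
  proof (rule has_vector_derivative_eq_rhs)
    show "(G has_vector_derivative (h y * gauss_kernel' z y
        + (- 2 * z * of_real ((r - y\<^sup>2) / (y\<^sup>2 + r)\<^sup>2)) * gauss_kernel z y)) (at y within {a..b})"
      unfolding G_def by (rule has_vector_derivative_mult [OF dh gauss_kernel_has_vector_derivative [OF z]])
    have "h y * gauss_kernel' z y = of_real (1 - r / (y\<^sup>2 + r)) * gauss_kernel z y"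
    proof -
      have "h y * gauss_kernel' z y = of_real (y / (y\<^sup>2 + r) * y) * gauss_kernel z y"
        using Re_pos_imp_nonzero[OF z] by (simp add: h_def gauss_kernel'_def)
      also have "y / (y\<^sup>2 + r) * y = 1 - r / (y\<^sup>2 + r)"
        using pos[of y] by (simp add: field_simps power2_eq_square)
      finally show ?thesis .
    qed
    then show "h y * gauss_kernel' z y
        + (- 2 * z * of_real ((r - y\<^sup>2) / (y\<^sup>2 + r)\<^sup>2)) * gauss_kernel z y = gauss_kernel z y - e y"
      unfolding e_def of_real_diff of_real_1 by (simp only: ring_distribs) simp
  qed
  have "((\<lambda>y. gauss_kernel z y - e y) has_integral (G b - G a)) {a..b}"
    using dG ab by (intro fundamental_theorem_of_calculus) auto
  moreover have ie: "e integrable_on {a..b}"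
    unfolding e_def using pos z
    by (intro integrable_continuous_interval continuous_intros) (auto simp: less_imp_neq[symmetric])
  ultimately have "((\<lambda>y. (gauss_kernel z y - e y) + e y) has_integral (G b - G a + integral {a..b} e)) {a..b}"
    by (intro has_integral_add) auto
  then have int: "integral {a..b} (gauss_kernel z) = G b - G a + integral {a..b} e"
    by (simp add: integral_unique)
  have k: "norm (gauss_kernel z y) \<le> 1 / sqrt r" for y
    unfolding r_def by (rule norm_gauss_kernel_le [OF z])
  \<comment> \<open>The uniformity in z comes from here: the kernel is at most r^(-1/2), so both
    terms of \<open>e\<close> are multiples of sqrt r / (y^2 + r), whose integral over the line is
    pi for every r.\<close>
  have ne: "norm (e y) \<le> 3 * (sqrt r / (y\<^sup>2 + r))" for y
  proof -
    have 1: "norm (of_real (r / (y\<^sup>2 + r)) * gauss_kernel z y) \<le> r / (y\<^sup>2 + r) * (1 / sqrt r)"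
      unfolding norm_mult norm_of_real abs_divide using r pos[of y] by (intro mult_mono k) auto
    have "\<bar>(r - y\<^sup>2) / (y\<^sup>2 + r)\<^sup>2\<bar> \<le> 1 / (y\<^sup>2 + r)"
    proof -
      have "\<bar>r - y\<^sup>2\<bar> \<le> y\<^sup>2 + r" using r zero_le_power2[of y] by (simp add: abs_le_iff)
      then have "\<bar>r - y\<^sup>2\<bar> / (y\<^sup>2 + r)\<^sup>2 \<le> (y\<^sup>2 + r) / (y\<^sup>2 + r)\<^sup>2" by (rule divide_right_mono) auto
      then show ?thesis using pos[of y] by (simp add: power2_eq_square)
    qed
    then have 2: "norm (2 * z * of_real ((r - y\<^sup>2) / (y\<^sup>2 + r)\<^sup>2) * gauss_kernel z y)
        \<le> 2 * r * (1 / (y\<^sup>2 + r)) * (1 / sqrt r)"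
      unfolding norm_mult norm_of_real r_def[symmetric] using r pos[of y]
      by (intro mult_mono k) (auto simp: norm_mult)
    have "r / (y\<^sup>2 + r) * (1 / sqrt r) = r / sqrt r / (y\<^sup>2 + r)"
      by simp
    also have "r / sqrt r = sqrt r"
      using r by (simp add: real_div_sqrt)
    finally have "r / (y\<^sup>2 + r) * (1 / sqrt r) = sqrt r / (y\<^sup>2 + r)" .
    moreover have "2 * r * (1 / (y\<^sup>2 + r)) * (1 / sqrt r) = 2 * (r / (y\<^sup>2 + r) * (1 / sqrt r))"
      by simp
    ultimately have "norm (of_real (r / (y\<^sup>2 + r)) * gauss_kernel z y) \<le> sqrt r / (y\<^sup>2 + r)"
       "norm (2 * z * of_real ((r - y\<^sup>2) / (y\<^sup>2 + r)\<^sup>2) * gauss_kernel z y) \<le> 2 * (sqrt r / (y\<^sup>2 + r))"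
      using 1 2 by simp_all
    then show ?thesis unfolding e_def using norm_triangle_ineq order_trans by smt
  qed
  have at: "((\<lambda>y. 3 * (sqrt r / (y\<^sup>2 + r))) has_integral
      (3 * arctan (b / sqrt r) - 3 * arctan (a / sqrt r))) {a..b}"
  proof (intro fundamental_theorem_of_calculus ab)
    fix y
    have "((\<lambda>y. 3 * arctan (y / sqrt r)) has_field_derivative 3 * (sqrt r / (y\<^sup>2 + r))) (at y within {a..b})"
    proof (rule DERIV_cong)
      show "((\<lambda>y. 3 * arctan (y / sqrt r)) has_field_derivative
           3 * ((1 / sqrt r) * inverse (1 + (y / sqrt r)\<^sup>2))) (at y within {a..b})"
        by (intro DERIV_cmult) (rule DERIV_cong, rule DERIV_chain2 [OF DERIV_arctan],
            rule DERIV_cdivide, rule DERIV_ident, simp)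
      have "inverse (1 + (y / sqrt r)\<^sup>2) = r / (y\<^sup>2 + r)"
        using r pos[of y] by (simp add: power_divide field_simps)
      moreover have "1 / sqrt r * r = sqrt r"
        using r by (simp add: real_div_sqrt)
      ultimately show "3 * ((1 / sqrt r) * inverse (1 + (y / sqrt r)\<^sup>2)) = 3 * (sqrt r / (y\<^sup>2 + r))"
        by (metis times_divide_eq_right)
    qed
    then show "((\<lambda>y. 3 * arctan (y / sqrt r)) has_vector_derivative 3 * (sqrt r / (y\<^sup>2 + r))) (at y within {a..b})"
      by (simp add: has_real_derivative_iff_has_vector_derivative)
  qed
  have "norm (integral {a..b} e) \<le> integral {a..b} (\<lambda>y. 3 * (sqrt r / (y\<^sup>2 + r)))"
    using ie at ne by (intro integral_norm_bound_integral) auto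
  also have "\<dots> = 3 * arctan (b / sqrt r) - 3 * arctan (a / sqrt r)"
    using at by (rule integral_unique)
  also have "\<dots> \<le> 3 * (pi / 2) + 3 * (pi / 2)"
    using arctan_bounded[of "b / sqrt r"] arctan_bounded[of "a / sqrt r"] by linarith
  also have "\<dots> \<le> 10"
    using pi_less_4 pi_approx by simp
  finally have e: "norm (integral {a..b} e) \<le> 10" .
  have G: "norm (G y) \<le> 1" for y
  proof -
    have "norm (G y) \<le> 2 * r * (\<bar>y\<bar> / (y\<^sup>2 + r)) * (1 / sqrt r)"
      unfolding G_def h_def norm_mult norm_of_real abs_divide r_def[symmetric] using r pos[of y] 
      by (intro mult_mono k) (auto simp: norm_mult)
    also have "\<dots> = 2 * (r / sqrt r) * \<bar>y\<bar> / (y\<^sup>2 + r)"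
      by simp
    also have "\<dots> = 2 * sqrt r * \<bar>y\<bar> / (y\<^sup>2 + r)"
      using r by (simp add: real_div_sqrt)
    also have "\<dots> \<le> 1"
      using zero_le_power2[of "\<bar>y\<bar> - sqrt r"] pos[of y] r by (simp add: power2_diff field_simps)
    finally show ?thesis .
  qed
  \<comment> \<open>The remainder contributes at most 3 pi \<le> 10 and each of the two end values
    of \<open>G\<close> at most 1, whence 12.\<close>
  have "norm (integral {a..b} (gauss_kernel z)) \<le> norm (G b) + norm (G a) + norm (integral {a..b} e)"
    unfolding int using norm_triangle_ineq[of "G b - G a" "integral {a..b} e"] norm_triangle_ineq4[of "G b" "G a"]
    by linarith
  also have "\<dots> \<le> 12" using e G[of a] G[of b] by linarith
  finally show ?thesis .
qed

section \<open>Green's identity with a cut-off kernel\<close>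

text \<open>A polynomial is enough on [0, R]. The double zero at R removes the boundary terms there,
  and evenness in y makes the derivative vanish at 0, so that the boundary term at 0 is that of the
  uncut functions.\<close>

definition cutoff :: "real \<Rightarrow> real \<Rightarrow> real" where
  "cutoff R y = (1 - y\<^sup>2 / R\<^sup>2)\<^sup>2"

definition cutoff' :: "real \<Rightarrow> real \<Rightarrow> real" where
  "cutoff' R y = - 4 * y / R\<^sup>2 * (1 - y\<^sup>2 / R\<^sup>2)"

definition cutoff'' :: "real \<Rightarrow> real \<Rightarrow> real" where
  "cutoff'' R y = - 4 / R\<^sup>2 + 12 * y\<^sup>2 / R\<^sup>2 / R\<^sup>2"

lemma cutoff_has_derivative:
  "(cutoff R has_field_derivative cutoff' R y) (at y within S)"
  "(cutoff' R has_field_derivative cutoff'' R y) (at y within S)"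
  unfolding cutoff_def [abs_def] cutoff'_def [abs_def] cutoff''_def
  unfolding divide_inverse
  by (rule derivative_eq_intros refl | simp add: algebra_simps power2_eq_square)+

lemma cutoff_has_vector_derivative:
  "((\<lambda>y. complex_of_real (cutoff R y)) has_vector_derivative complex_of_real (cutoff' R y)) (at y within S)"
  "((\<lambda>y. complex_of_real (cutoff' R y)) has_vector_derivative complex_of_real (cutoff'' R y)) (at y within S)"
  by (intro has_vector_derivative_of_real cutoff_has_derivative)+

text \<open>The factor y is kept in the bound for \<open>cutoff'\<close>, since it is absorbed by
  the decay of the kernel derivative and leaves a full R^(-2). The sign of \<open>cutoff'\<close>
  makes the integral of its modulus equal to 1.\<close>

lemma cutoff_bounds:
  assumes "0 \<le> y" "y \<le> R" "R > 0"
  shows "0 \<le> cutoff R y" "cutoff R y \<le> 1" "\<bar>cutoff' R y\<bar> \<le> 4 * y / R\<^sup>2" "cutoff' R y \<le> 0"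
    "\<bar>cutoff'' R y\<bar> \<le> 8 / R\<^sup>2"
proof -
  have q: "0 \<le> y\<^sup>2 / R\<^sup>2" "y\<^sup>2 / R\<^sup>2 \<le> 1"
    using assms by (auto simp: field_simps power_mono)
  show "0 \<le> cutoff R y" "cutoff R y \<le> 1"
    using q by (auto simp: cutoff_def power_le_one)
  have "\<bar>1 - y\<^sup>2 / R\<^sup>2\<bar> \<le> 1" using q by linarith
  then have "4 * y / R\<^sup>2 * \<bar>1 - y\<^sup>2 / R\<^sup>2\<bar> \<le> 4 * y / R\<^sup>2 * 1"
    using assms by (intro mult_left_mono) auto
  then show "\<bar>cutoff' R y\<bar> \<le> 4 * y / R\<^sup>2"
    using assms by (simp add: cutoff'_def abs_mult)
  show "cutoff' R y \<le> 0"
    using assms q unfolding cutoff'_def by (intro mult_nonpos_nonneg) auto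
  have "cutoff'' R y = (12 * (y\<^sup>2 / R\<^sup>2) - 4) / R\<^sup>2"
    using assms by (simp add: cutoff''_def field_simps)
  then have "\<bar>cutoff'' R y\<bar> = \<bar>12 * (y\<^sup>2 / R\<^sup>2) - 4\<bar> / R\<^sup>2"
    by simp
  also have "\<dots> \<le> 8 / R\<^sup>2"
    using abs_le_iff[of "12 * (y\<^sup>2 / R\<^sup>2) - 4" 8] q
    by (intro divide_right_mono zero_le_power2) linarith
  finally show "\<bar>cutoff'' R y\<bar> \<le> 8 / R\<^sup>2" .
qed

lemma cutoff_boundary:
  "cutoff R 0 = 1" "cutoff' R 0 = 0" "R > 0 \<Longrightarrow> cutoff R R = 0" "R > 0 \<Longrightarrow> cutoff' R R = 0"
  by (auto simp: cutoff_def cutoff'_def)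

lemma continuous_on_cutoff [continuous_intros]:
  "continuous_on S f \<Longrightarrow> continuous_on S (\<lambda>x. cutoff R (f x))"
  "continuous_on S f \<Longrightarrow> continuous_on S (\<lambda>x. cutoff' R (f x))"
  "continuous_on S f \<Longrightarrow> continuous_on S (\<lambda>x. cutoff'' R (f x))"
  unfolding cutoff_def cutoff'_def cutoff''_def by (cases "R = 0"; auto intro!: continuous_intros)+

text \<open>The method of images for the Neumann condition: for even k the sum is even in y, so its
  derivative vanishes at y = 0 and the boundary value of \<open>p\<close> drops out of Green's
  identity. The pole x is arbitrary because interior values must be bounded as well; the final
  estimate takes x = 0.\<close>

definition mirrored :: "(real \<Rightarrow> complex) \<Rightarrow> real \<Rightarrow> real \<Rightarrow> complex" where
  "mirrored k x y = k (y - x) + k (y + x)"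

lemma mirrored_has_vector_derivative:
  assumes "\<And>y. (k has_vector_derivative k' y) (at y)"
  shows "(mirrored k x has_vector_derivative mirrored k' x y) (at y within S)"
proof -
  have "((\<lambda>y. k (y + c)) has_vector_derivative k' (y + c)) (at y within S)" for c
  proof -
    have "((\<lambda>y. y + c) has_vector_derivative 1) (at y within S)"
      by (rule has_vector_derivative_eq_rhs, rule derivative_intros | simp)+
    from vector_diff_chain_within [OF this has_vector_derivative_at_within [OF assms]]
    show ?thesis by (simp add: o_def)
  qed
  from has_vector_derivative_add [OF this [of "- x"] this [of x]] show ?thesis
    by (simp add: mirrored_def [abs_def])
qed

lemma mirrored_gauss_kernel'_0 [simp]: "mirrored (gauss_kernel' z) x 0 = 0"
  by (simp add: mirrored_def)

lemma continuous_on_mirrored_gauss_kernel [continuous_intros]: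
  assumes "continuous_on S f" "continuous_on S g" "\<And>x. x \<in> S \<Longrightarrow> Re (f x) > 0"
  shows "continuous_on S (\<lambda>y. mirrored (gauss_kernel (f y)) x (g y))"
    and "continuous_on S (\<lambda>y. mirrored (gauss_kernel' (f y)) x (g y))"
    and "continuous_on S (\<lambda>y. mirrored (gauss_kernel'' (f y)) x (g y))"
  unfolding mirrored_def by (intro continuous_intros assms; simp)+

text \<open>The kernel time \<open>Complex \<epsilon> (s0 - s)\<close> moves with velocity -i, so
  the heat equation in z becomes v_s = -i v_yy, the equation adjoint to p_t = i p_yy. At s = s0 the
  kernel is a real heat kernel of width sqrt \<epsilon>.\<close>

lemma backward_gauss_kernel_has_vector_derivative:
  assumes "\<epsilon> > 0"
  shows "((\<lambda>s. mirrored (gauss_kernel (Complex \<epsilon> (s0 - s))) x y) has_vector_derivative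
      - \<i> * mirrored (gauss_kernel'' (Complex \<epsilon> (s0 - s))) x y) (at s within S)"
proof -
  have z: "(Complex \<epsilon> \<circ> (\<lambda>s. s0 - s) has_vector_derivative - \<i>) (at s within S)" for s
  proof -
    have "((\<lambda>s. of_real \<epsilon> + \<i> * (of_real s0 - of_real s)) has_vector_derivative - \<i>) (at s within S)"
      by (auto intro!: derivative_eq_intros)
    then show ?thesis by (simp add: o_def complex_eq_iff Complex_eq)
  qed
  have "((\<lambda>z. gauss_kernel z w) \<circ> (Complex \<epsilon> \<circ> (\<lambda>s. s0 - s)) has_vector_derivative
      - \<i> * gauss_kernel'' (Complex \<epsilon> (s0 - s)) w) (at s within S)" for w
    by (rule field_vector_diff_chain_within [OF z])
       (use assms in \<open>auto intro!: has_field_derivative_at_within gauss_kernel_has_field_derivative\<close>)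
  from has_vector_derivative_add [OF this [of "y - x"] this [of "y + x"]] show ?thesis
    by (simp add: mirrored_def o_def algebra_simps)
qed

lemma continuous_on_quarter_plane_compose:
  fixes v :: "real \<Rightarrow> real \<Rightarrow> complex"
  assumes "continuous_on ({0..} \<times> {0..}) (\<lambda>(x, t). v x t)"
    and "continuous_on S f" "continuous_on S g"
    and "\<And>x. x \<in> S \<Longrightarrow> f x \<ge> 0" "\<And>x. x \<in> S \<Longrightarrow> g x \<ge> 0"
  shows "continuous_on S (\<lambda>x. v (f x) (g x))"
  using continuous_on_compose2 [OF assms(1) continuous_on_Pair [OF assms(2,3)]] assms(4,5)
  by auto

text \<open>Collects what Green's identity uses of the x-derivative of a solution, so that the same
  estimates apply to \<open>partial_x u\<close> and to the explicit exponential modes. The constant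
  in \<open>decay\<close> may depend on t in an arbitrary way. The weight (1 + y)^2 is chosen to
  give integrability in y.\<close>

locale neumann_evolution =
  fixes p p1 p2 :: "real \<Rightarrow> real \<Rightarrow> complex"
  assumes p_x: "\<And>y t. y \<ge> 0 \<Longrightarrow> t \<ge> 0 \<Longrightarrow>
      ((\<lambda>y. p y t) has_vector_derivative p1 y t) (at y within {0..})"
    and p1_x: "\<And>y t. y \<ge> 0 \<Longrightarrow> t \<ge> 0 \<Longrightarrow>
      ((\<lambda>y. p1 y t) has_vector_derivative p2 y t) (at y within {0..})"
    and p_t: "\<And>y t. y \<ge> 0 \<Longrightarrow> t \<ge> 0 \<Longrightarrow>
      ((\<lambda>s. p y s) has_vector_derivative \<i> * p2 y t) (at t within {0..})"
    and cont_p: "continuous_on ({0..} \<times> {0..}) (\<lambda>(y, t). p y t)"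
    and cont_p1: "continuous_on ({0..} \<times> {0..}) (\<lambda>(y, t). p1 y t)"
    and cont_p2: "continuous_on ({0..} \<times> {0..}) (\<lambda>(y, t). p2 y t)"
    and decay: "\<And>t. t \<ge> 0 \<Longrightarrow>
      \<exists>M. \<forall>y\<ge>0. (1 + y)\<^sup>2 * norm (p y t) \<le> M \<and> (1 + y)\<^sup>2 * norm (p1 y t) \<le> M"
begin

lemma continuous_on_p [continuous_intros]:
  assumes "continuous_on S f" "continuous_on S g"
    and "\<And>x. x \<in> S \<Longrightarrow> f x \<ge> 0" "\<And>x. x \<in> S \<Longrightarrow> g x \<ge> 0"
  shows "continuous_on S (\<lambda>x. p (f x) (g x))"
    and "continuous_on S (\<lambda>x. p1 (f x) (g x))"
    and "continuous_on S (\<lambda>x. p2 (f x) (g x))"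
  by (intro continuous_on_quarter_plane_compose cont_p cont_p1 cont_p2 assms; simp)+

definition pairing :: "complex \<Rightarrow> real \<Rightarrow> real \<Rightarrow> real \<Rightarrow> complex" where
  "pairing z x R t =
     integral {0..R} (\<lambda>y. of_real (cutoff R y) * (mirrored (gauss_kernel z) x y * p y t))"

text \<open>The terms of Green's identity in which a derivative falls on the cut-off.\<close>

definition cutoff_error :: "complex \<Rightarrow> real \<Rightarrow> real \<Rightarrow> real \<Rightarrow> complex" where
  "cutoff_error z x R t = integral {0..R} (\<lambda>y.
     p y t * (2 * mirrored (gauss_kernel' z) x y * of_real (cutoff' R y)
            + mirrored (gauss_kernel z) x y * of_real (cutoff'' R y)))"

lemma green_identity:
  assumes z: "Re z > 0" and t: "t \<ge> 0" and R: "R > 0"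
  shows "integral {0..R} (\<lambda>y. of_real (cutoff R y) *
           (mirrored (gauss_kernel z) x y * p2 y t - mirrored (gauss_kernel'' z) x y * p y t))
       = cutoff_error z x R t - mirrored (gauss_kernel z) x 0 * p1 0 t"
proof -
  let ?v = "mirrored (gauss_kernel z) x" and ?v' = "mirrored (gauss_kernel' z) x"
    and ?v'' = "mirrored (gauss_kernel'' z) x"
  let ?c = "\<lambda>y. complex_of_real (cutoff R y)" and ?c' = "\<lambda>y. complex_of_real (cutoff' R y)"
    and ?c'' = "\<lambda>y. complex_of_real (cutoff'' R y)"
  \<comment> \<open>The last term trades the contribution of \<open>p1\<close> times
    \<open>cutoff'\<close> for one of \<open>p\<close>. Therefore the cut-off error contains
    \<open>p\<close> alone and needs no bound on the derivative of \<open>p\<close> that is uniform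
    in time.\<close>
  define H where "H y = (?v y * p1 y t - ?v' y * p y t) * ?c y - ?v y * p y t * ?c' y" for y
  let ?e = "\<lambda>y. p y t * (2 * ?v' y * ?c' y + ?v y * ?c'' y)"
  have dv: "(?v has_vector_derivative ?v' y) (at y within S)"
    "(?v' has_vector_derivative ?v'' y) (at y within S)" for y S
    by (intro mirrored_has_vector_derivative gauss_kernel_has_vector_derivative
        gauss_kernel'_has_vector_derivative z)+
  have "(H has_vector_derivative
      ?c y * (?v y * p2 y t - ?v'' y * p y t) - ?e y) (at y within {0..R})" if "y \<in> {0..R}" for y
  proof -
    have dp: "((\<lambda>y. p y t) has_vector_derivative p1 y t) (at y within {0..R})"
      "((\<lambda>y. p1 y t) has_vector_derivative p2 y t) (at y within {0..R})"
      using p_x[of y t] p1_x[of y t] that t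
      by (auto intro: has_vector_derivative_within_subset)
    show ?thesis
      unfolding H_def
      by (rule has_vector_derivative_eq_rhs)
         (rule derivative_intros dv dp cutoff_has_vector_derivative | simp add: algebra_simps)+
  qed
  then have "((\<lambda>y. ?c y * (?v y * p2 y t - ?v'' y * p y t) - ?e y) has_integral (H R - H 0)) {0..R}"
    using R by (intro fundamental_theorem_of_calculus) auto
  moreover have "(?e has_integral cutoff_error z x R t) {0..R}"
    unfolding cutoff_error_def
    by (intro integrable_integral integrable_continuous_interval continuous_intros)
       (use z t in auto)
  ultimately have "((\<lambda>y. (?c y * (?v y * p2 y t - ?v'' y * p y t) - ?e y) + ?e y)
      has_integral (H R - H 0 + cutoff_error z x R t)) {0..R}"
    by (rule has_integral_add)
  then have "integral {0..R} (\<lambda>y. ?c y * (?v y * p2 y t - ?v'' y * p y t))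
      = H R - H 0 + cutoff_error z x R t"
    by (simp add: integral_unique)
  moreover have "H R = 0" "H 0 = ?v 0 * p1 0 t"
    using R by (simp_all add: H_def cutoff_boundary)
  ultimately show ?thesis by simp
qed

text \<open>The equations v_s = -i v_yy and p_s = i p_yy make the s-derivative of the integrand i
  times the Green integrand, so the whole change of the pairing comes from the boundary y = 0 and
  from the cut-off.\<close>

lemma pairing_has_vector_derivative:
  assumes \<epsilon>: "\<epsilon> > 0" and R: "R > 0" and c: "0 \<le> c" and s: "s \<in> {c..d}"
  shows "((\<lambda>s. pairing (Complex \<epsilon> (s0 - s)) x R s) has_vector_derivative
     \<i> * (cutoff_error (Complex \<epsilon> (s0 - s)) x R s
        - mirrored (gauss_kernel (Complex \<epsilon> (s0 - s))) x 0 * p1 0 s)) (at s within {c..d})"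
proof -
  let ?z = "\<lambda>s. Complex \<epsilon> (s0 - s)"
  let ?f = "\<lambda>s y. complex_of_real (cutoff R y) * (mirrored (gauss_kernel (?z s)) x y * p y s)"
  let ?g = "\<lambda>s y. \<i> * (complex_of_real (cutoff R y) *
     (mirrored (gauss_kernel (?z s)) x y * p2 y s - mirrored (gauss_kernel'' (?z s)) x y * p y s))"
  have cz: "continuous_on S (\<lambda>x. ?z (f x))" if "continuous_on S f" for f and S :: "'x::topological_space set"
    unfolding Complex_eq using that by (intro continuous_intros)
  have "((\<lambda>s. integral (cbox 0 R) (?f s)) has_vector_derivative integral (cbox 0 R) (?g s)) (at s within {c..d})"
  proof (rule leibniz_rule_vector_derivative)
    fix r y assume r: "r \<in> {c..d}" and y: "y \<in> cbox 0 R"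
    have p: "((\<lambda>s. p y s) has_vector_derivative \<i> * p2 y r) (at r within {c..d})"
      using p_t[of y r] r y c by (auto intro: has_vector_derivative_within_subset)
    show "((\<lambda>s. ?f s y) has_vector_derivative ?g r y) (at r within {c..d})"
      by (rule has_vector_derivative_eq_rhs)
         (rule has_vector_derivative_mult_right has_vector_derivative_mult
            backward_gauss_kernel_has_vector_derivative [OF \<epsilon>] p | simp add: algebra_simps)+
  next
    fix r assume "r \<in> {c..d}"
    then show "?f r integrable_on cbox 0 R"
      unfolding cbox_interval
      by (intro integrable_continuous_interval continuous_intros) (use \<epsilon> c in auto)
  next
    show "continuous_on ({c..d} \<times> cbox 0 R) (\<lambda>(s, y). ?g s y)"
      unfolding split_beta by (intro continuous_intros cz) (use \<epsilon> c in auto)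
  qed (use s in auto)
  then show ?thesis
    using green_identity[of "?z s" s R x] \<epsilon> R s c
    by (simp add: pairing_def cbox_interval)
qed

end

section \<open>Estimates for the kernel, the cut-off error and the pairing\<close>

lemma gauss_kernel_primitive:
  assumes "Re z > 0"
  obtains F where "\<And>y. (F has_vector_derivative gauss_kernel z y) (at y)"
    and "\<And>a b. norm (F b - F a) \<le> 12"
proof -
  have "continuous_on UNIV (gauss_kernel z)"
    using continuous_on_gauss_kernel(1) [of UNIV "\<lambda>_. z" "\<lambda>y. y"] assms by simp
  then have "\<exists>F. \<forall>y. - \<infinity> < ereal y \<longrightarrow> ereal y < \<infinity> \<longrightarrow> (F has_vector_derivative gauss_kernel z y) (at y)"
    by (intro einterval_antiderivative) (auto simp: continuous_on_eq_continuous_at)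
  then obtain F where F': "\<forall>y. - \<infinity> < ereal y \<longrightarrow> ereal y < \<infinity> \<longrightarrow> (F has_vector_derivative gauss_kernel z y) (at y)"
    by (rule exE)
  have F: "(F has_vector_derivative gauss_kernel z y) (at y)" for y
    using F'[rule_format, of y] by simp
  have le: "norm (F b - F a) \<le> 12" if "a \<le> b" for a b
  proof -
    have "(gauss_kernel z has_integral (F b - F a)) {a..b}"
      by (rule fundamental_theorem_of_calculus [OF that has_vector_derivative_at_within [OF F]])
    then show ?thesis
      using norm_integral_gauss_kernel_le [OF assms that] by (simp add: integral_unique)
  qed
  have "norm (F b - F a) \<le> 12" for a b
    using le[of a b] le[of b a] by (cases "a \<le> b") (auto simp: norm_minus_commute)
  with F show ?thesis by (rule that)
qed

lemma norm_mirrored_gauss_kernel_le: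
  assumes "Re z > 0"
  shows "norm (mirrored (gauss_kernel z) x y) \<le> 2 / sqrt (norm z)"
  using norm_triangle_ineq [of "gauss_kernel z (y - x)" "gauss_kernel z (y + x)"]
    norm_gauss_kernel_le [OF assms, of "y - x"] norm_gauss_kernel_le [OF assms, of "y + x"]
  unfolding mirrored_def by simp

text \<open>For w = y - x and w = y + x the weight y is at most (1 + |x|) (1 + |w|). The growth in x
  is harmless: the bound is used at fixed x and is divided by R.\<close>

lemma norm_mirrored_gauss_kernel'_le:
  assumes z: "Re z > 0" and y: "y \<ge> 0"
  shows "y * norm (mirrored (gauss_kernel' z) x y)
      \<le> 4 * (1 + \<bar>x\<bar>) * (1 / (2 * norm z * sqrt (norm z)) + 2 * norm z / (Re z * sqrt (norm z)))"
    (is "_ \<le> 4 * _ * ?Q")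
proof -
  have *: "y * norm (gauss_kernel' z w) \<le> (1 + \<bar>x\<bar>) * (2 * ?Q)" if w: "y \<le> \<bar>w\<bar> + \<bar>x\<bar>" for w
  proof -
    have "0 \<le> \<bar>x * w\<bar>" by (rule abs_ge_zero)
    moreover have "(1 + \<bar>x\<bar>) * (1 + \<bar>w\<bar>) = 1 + \<bar>x\<bar> + \<bar>w\<bar> + \<bar>x * w\<bar>"
      by (simp add: algebra_simps abs_mult)
    ultimately have "y \<le> (1 + \<bar>x\<bar>) * (1 + \<bar>w\<bar>)"
      using w by linarith
    then have "y * norm (gauss_kernel' z w) \<le> (1 + \<bar>x\<bar>) * (1 + \<bar>w\<bar>) * norm (gauss_kernel' z w)"
      by (rule mult_right_mono) auto
    also have "\<dots> \<le> (1 + \<bar>x\<bar>) * (2 * ?Q)"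
      unfolding mult.assoc [of "1 + \<bar>x\<bar>"] by (intro mult_left_mono norm_gauss_kernel'_decay [OF z]) auto
    finally show ?thesis .
  qed
  have "y * norm (mirrored (gauss_kernel' z) x y)
      \<le> y * (norm (gauss_kernel' z (y - x)) + norm (gauss_kernel' z (y + x)))"
    unfolding mirrored_def using y by (intro mult_left_mono norm_triangle_ineq)
  also have "\<dots> \<le> (1 + \<bar>x\<bar>) * (2 * ?Q) + (1 + \<bar>x\<bar>) * (2 * ?Q)"
    unfolding distrib_left[of y] by (intro add_mono *) auto
  also have "A * (2 * Q) + A * (2 * Q) = 4 * A * Q" for A Q :: real
    by simp
  finally show ?thesis .
qed

lemma has_integral_inverse_square:
  fixes R :: real
  assumes "R \<ge> 0"
  shows "((\<lambda>y. 1 / (1 + y)\<^sup>2) has_integral (1 - 1 / (1 + R))) {0..R}"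
proof -
  have "((\<lambda>y. 1 / (1 + y)\<^sup>2) has_integral (- 1 / (1 + R) - (- 1 / (1 + 0)))) {0..R}"
  proof (rule fundamental_theorem_of_calculus [where f = "\<lambda>y. - 1 / (1 + y)", OF assms])
    fix y assume "y \<in> {0..R}"
    then show "((\<lambda>y. - 1 / (1 + y)) has_vector_derivative 1 / (1 + y)\<^sup>2) (at y within {0..R})"
      unfolding has_real_derivative_iff_has_vector_derivative [symmetric]
      by (auto intro!: derivative_eq_intros simp: power2_eq_square)
  qed
  then show ?thesis by simp
qed

text \<open>A rational majorant is chosen for its explicit primitive, an arctangent. By scaling, its
  integral is of order sqrt \<epsilon>.\<close>

lemma heat_kernel_first_moment_le:
  assumes "\<epsilon> > 0"
  shows "\<bar>w\<bar> * norm (gauss_kernel (Complex \<epsilon> 0) w) \<le> 16 * \<epsilon> / (\<epsilon> + w\<^sup>2)"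
proof -
  define q where "q = \<bar>w\<bar> / sqrt \<epsilon>"
  have q: "q \<ge> 0" "w\<^sup>2 = q\<^sup>2 * \<epsilon>" "\<bar>w\<bar> = q * sqrt \<epsilon>"
    using assms by (auto simp: q_def power_divide)
  have n: "norm (Complex \<epsilon> 0) = \<epsilon>" using assms by (simp add: cmod_def)
  have e: "norm (gauss_kernel (Complex \<epsilon> 0) w) = exp (- (q\<^sup>2 / 4)) / sqrt \<epsilon>"
    unfolding norm_gauss_kernel n q(2) using assms by (simp add: power2_eq_square)
  \<comment> \<open>The factor 16 matches the quartic coefficients: the quadratic Taylor polynomial
    of exp at q^2 / 4 ends in q^4 / 32, and the left side is at most (1 + q^2)^2 / 2.\<close>
  have p: "q * (1 + q\<^sup>2) \<le> 16 * (1 + q\<^sup>2 / 4 + (q\<^sup>2 / 4)\<^sup>2 / 2)"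
  proof -
    have "2 * q \<le> 1 + q\<^sup>2" using zero_le_power2[of "q - 1"] by (simp add: power2_diff)
    then have "2 * q * (1 + q\<^sup>2) \<le> (1 + q\<^sup>2) * (1 + q\<^sup>2)" by (rule mult_right_mono) auto
    also have "(1 + q\<^sup>2) * (1 + q\<^sup>2) \<le> 2 * (16 * (1 + q\<^sup>2 / 4 + (q\<^sup>2 / 4)\<^sup>2 / 2))"
      using zero_le_power2[of q] by (simp add: power2_eq_square[of "_ / 4"] algebra_simps)
    finally show ?thesis by simp
  qed
  also have "\<dots> \<le> 16 * exp (q\<^sup>2 / 4)"
    using exp_lower_Taylor_quadratic[of "q\<^sup>2 / 4"] by simp
  finally have "q * exp (- (q\<^sup>2 / 4)) \<le> 16 / (1 + q\<^sup>2)"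
    by (simp add: exp_minus field_simps add_pos_nonneg)
  moreover have "\<bar>w\<bar> * norm (gauss_kernel (Complex \<epsilon> 0) w) = q * exp (- (q\<^sup>2 / 4))"
    unfolding e q(3) using assms by simp
  moreover have "\<epsilon> + w\<^sup>2 = (1 + q\<^sup>2) * \<epsilon>"
    unfolding q(2) by (simp add: algebra_simps)
  then have "16 * \<epsilon> / (\<epsilon> + w\<^sup>2) = 16 / (1 + q\<^sup>2)"
    using assms by simp
  ultimately show ?thesis by simp
qed

context neumann_evolution
begin

text \<open>Both terms of the integrand are O(R^(-2)) on an interval of length R. The constant is
  uniform over the kernel times with real part \<epsilon> and modulus at most L, but contains
  negative powers of \<epsilon>.\<close>

lemma norm_cutoff_error_le:
  assumes \<epsilon>: "\<epsilon> > 0" and L: "L \<ge> \<epsilon>" and B: "B \<ge> 0"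
  obtains D where "D \<ge> 0" and "\<forall>z R t. Re z = \<epsilon> \<longrightarrow> norm z \<le> L \<longrightarrow> R > 0 \<longrightarrow> t \<ge> 0 \<longrightarrow>
      (\<forall>y\<ge>0. norm (p y t) \<le> B) \<longrightarrow> norm (cutoff_error z x R t) \<le> D / R"
proof -
  define V where "V = 2 / sqrt \<epsilon>"
  define V' where "V' = 4 * (1 + \<bar>x\<bar>) * (1 / (2 * \<epsilon> * sqrt \<epsilon>) + 2 * L / (\<epsilon> * sqrt \<epsilon>))"
  define D where "D = 8 * B * (V' + V)"
  have pos: "V \<ge> 0" "V' \<ge> 0" "D \<ge> 0"
    using \<epsilon> L B by (auto simp: V_def V'_def D_def)
  show ?thesis
  proof (rule that [OF pos(3)], intro allI impI)
    fix z :: complex and R t :: real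
    assume z: "Re z = \<epsilon>" "norm z \<le> L" and R: "R > 0" and t: "t \<ge> 0"
      and p: "\<forall>y\<ge>0. norm (p y t) \<le> B"
     have nz: "norm z \<ge> \<epsilon>" using complex_Re_le_cmod[of z] z by simp
    then have nz0: "norm z > 0" "norm z \<noteq> 0" using \<epsilon> by auto
    have zpos: "Re z > 0" using z \<epsilon> by simp
    have v: "norm (mirrored (gauss_kernel z) x y) \<le> V" for y
      using norm_mirrored_gauss_kernel_le [OF zpos, of x y] nz nz0 \<epsilon> unfolding V_def
      by (elim order_trans) (intro divide_left_mono, auto)
    have v': "y * norm (mirrored (gauss_kernel' z) x y) \<le> V'" if "y \<ge> 0" for y
      using norm_mirrored_gauss_kernel'_le [OF zpos that, of x] unfolding V'_def
    proof (rule order_trans)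
      show "4 * (1 + \<bar>x\<bar>) * (1 / (2 * norm z * sqrt (norm z)) + 2 * norm z / (Re z * sqrt (norm z)))
          \<le> 4 * (1 + \<bar>x\<bar>) * (1 / (2 * \<epsilon> * sqrt \<epsilon>) + 2 * L / (\<epsilon> * sqrt \<epsilon>))"
        using nz nz0 \<epsilon> z by (intro mult_left_mono add_mono frac_le mult_mono) auto
    qed
    have "norm (cutoff_error z x R t) \<le> (D / R\<^sup>2) * (R - 0)"
      unfolding cutoff_error_def
    proof (rule integral_bound)
      show "continuous_on {0..R} (\<lambda>y. p y t * (2 * mirrored (gauss_kernel' z) x y * of_real (cutoff' R y)
            + mirrored (gauss_kernel z) x y * of_real (cutoff'' R y)))"
        using zpos t by (intro continuous_intros) auto
    next
      fix y assume y: "y \<in> {0..R}"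
      then have y0: "0 \<le> y" "y \<le> R" by auto
      note cb = cutoff_bounds [OF y0 R]
      have "norm (2 * mirrored (gauss_kernel' z) x y * of_real (cutoff' R y)
            + mirrored (gauss_kernel z) x y * of_real (cutoff'' R y))
         \<le> 2 * norm (mirrored (gauss_kernel' z) x y) * \<bar>cutoff' R y\<bar>
            + norm (mirrored (gauss_kernel z) x y) * \<bar>cutoff'' R y\<bar>"
        by (intro norm_triangle_le) (simp add: norm_mult)
      also have "\<dots> \<le> 2 * norm (mirrored (gauss_kernel' z) x y) * (4 * y / R\<^sup>2) + V * (8 / R\<^sup>2)"
        by (intro add_mono mult_mono cb v) (use pos in auto)
      also have "\<dots> = 8 * (y * norm (mirrored (gauss_kernel' z) x y) + V) / R\<^sup>2"
        by (simp add: algebra_simps add_divide_distrib)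
      also have "\<dots> \<le> 8 * (V' + V) / R\<^sup>2"
        by (intro divide_right_mono mult_left_mono add_mono v' y0) auto
      finally have *: "norm (2 * mirrored (gauss_kernel' z) x y * of_real (cutoff' R y)
            + mirrored (gauss_kernel z) x y * of_real (cutoff'' R y)) \<le> 8 * (V' + V) / R\<^sup>2" .
      have "norm (p y t * (2 * mirrored (gauss_kernel' z) x y * of_real (cutoff' R y)
            + mirrored (gauss_kernel z) x y * of_real (cutoff'' R y))) \<le> B * (8 * (V' + V) / R\<^sup>2)"
        unfolding norm_mult[of "p y t"] using p y0 B by (intro mult_mono *) auto
      then show "norm (p y t * (2 * mirrored (gauss_kernel' z) x y * of_real (cutoff' R y)
            + mirrored (gauss_kernel z) x y * of_real (cutoff'' R y))) \<le> D / R\<^sup>2"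
        by (simp add: D_def mult_ac)
    qed (use R in auto)
    then show "norm (cutoff_error z x R t) \<le> D / R" using R by (simp add: power2_eq_square)
  qed
qed

text \<open>Integration of the pairing derivative over [c, d]. The strip bound B enters only through
  D, hence is multiplied by 1 / R.\<close>

lemma pairing_increment:
  assumes \<epsilon>: "\<epsilon> > 0" and c: "0 \<le> c" "c \<le> d"
    and B: "\<And>y s. y \<ge> 0 \<Longrightarrow> s \<in> {c..d} \<Longrightarrow> norm (p y s) \<le> B"
  shows "\<exists>D. \<forall>R>0. norm (pairing (Complex \<epsilon> (s0 - d)) x R d - pairing (Complex \<epsilon> (s0 - c)) x R c
     + \<i> * integral {c..d} (\<lambda>s. mirrored (gauss_kernel (Complex \<epsilon> (s0 - s))) x 0 * p1 0 s)) \<le> D / R"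
proof -
  have B0: "B \<ge> 0" using order_trans [OF norm_ge_zero B [of 0 c]] c by simp
  \<comment> \<open>Dominates the modulus of \<open>Complex \<epsilon> (s0 - s)\<close> for all s
    between c and d, wherever s0 lies.\<close>
  define L where "L = \<epsilon> + \<bar>s0 - c\<bar> + \<bar>s0 - d\<bar>"
  have "L \<ge> \<epsilon>" by (simp add: L_def)
  obtain D where D: "D \<ge> 0" "\<forall>z R t. Re z = \<epsilon> \<longrightarrow> norm z \<le> L \<longrightarrow> R > 0 \<longrightarrow> t \<ge> 0 \<longrightarrow>
      (\<forall>y\<ge>0. norm (p y t) \<le> B) \<longrightarrow> norm (cutoff_error z x R t) \<le> D / R"
    by (rule norm_cutoff_error_le [OF \<epsilon> \<open>L \<ge> \<epsilon>\<close> B0, of x])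
  have "norm (pairing (Complex \<epsilon> (s0 - d)) x R d - pairing (Complex \<epsilon> (s0 - c)) x R c
     + \<i> * integral {c..d} (\<lambda>s. mirrored (gauss_kernel (Complex \<epsilon> (s0 - s))) x 0 * p1 0 s))
     \<le> D * (d - c) / R" if R: "R > 0" for R
  proof -
    let ?z = "\<lambda>s. Complex \<epsilon> (s0 - s)"
    let ?b = "\<lambda>s. mirrored (gauss_kernel (?z s)) x 0 * p1 0 s"
    have "((\<lambda>s. \<i> * (cutoff_error (?z s) x R s - ?b s)) has_integral
        pairing (?z d) x R d - pairing (?z c) x R c) {c..d}"
      by (rule fundamental_theorem_of_calculus [where f = "\<lambda>s. pairing (?z s) x R s",
            OF c(2) pairing_has_vector_derivative [OF \<epsilon> R c(1)]])
    moreover have "continuous_on {c..d} ?z"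
      unfolding Complex_eq by (intro continuous_intros)
    then have "continuous_on {c..d} ?b"
      using \<epsilon> c by (intro continuous_intros) auto
    then have "(?b has_integral integral {c..d} ?b) {c..d}"
      by (intro integrable_integral integrable_continuous_interval)
    from has_integral_mult_right [OF this, of \<i>]
    have "((\<lambda>s. \<i> * ?b s) has_integral \<i> * integral {c..d} ?b) {c..d}" .
    ultimately have "((\<lambda>s. \<i> * (cutoff_error (?z s) x R s - ?b s) + \<i> * ?b s) has_integral
        pairing (?z d) x R d - pairing (?z c) x R c + \<i> * integral {c..d} ?b) {c..d}"
      by (rule has_integral_add)
    then have *: "((\<lambda>s. \<i> * cutoff_error (?z s) x R s) has_integral
        pairing (?z d) x R d - pairing (?z c) x R c + \<i> * integral {c..d} ?b) {c..d}"
      by (simp add: algebra_simps)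
    have "norm (pairing (?z d) x R d - pairing (?z c) x R c + \<i> * integral {c..d} ?b)
        \<le> D / R * Henstock_Kurzweil_Integration.content {c..d}"
    proof (rule has_integral_bound_real [OF _ finite.emptyI *])
        fix s assume "s \<in> {c..d} - {}"
        then have s: "s \<in> {c..d}" by simp
        have "norm (?z s) \<le> \<bar>Re (?z s)\<bar> + \<bar>Im (?z s)\<bar>" by (rule cmod_le)
        then have "norm (?z s) \<le> L"
          using s \<epsilon> by (auto simp: L_def)
        then show "norm (\<i> * cutoff_error (?z s) x R s) \<le> D / R"
          unfolding norm_mult norm_ii mult_1 by (intro D(2)[rule_format]) (use R s c B in auto)
    qed (use D R in auto)
    then show ?thesis using c by simp
  qed
  then show ?thesis by blast
qed

text \<open>The kernel is at most 2 |z|^(-1/2) and the weight (1 + y)^(-2) has integral at most 1.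
  Applied at time 0, where |z| is at least T, this produces the rate T^(-1/2).\<close>

lemma norm_pairing_le:
  assumes z: "Re z > 0" and t: "t \<ge> 0" and R: "R > 0"
    and M: "\<And>y. y \<ge> 0 \<Longrightarrow> (1 + y)\<^sup>2 * norm (p y t) \<le> M"
  shows "norm (pairing z x R t) \<le> 2 * M / sqrt (norm z)"
proof -
  have n: "norm z > 0" using Re_pos_imp_nonzero [OF z] by simp
  have M0: "M \<ge> 0" using order_trans [OF norm_ge_zero [of "p 0 t"], of M] M[of 0] by simp
  have "norm (pairing z x R t) \<le> integral {0..R} (\<lambda>y. 2 * M / sqrt (norm z) * (1 / (1 + y)\<^sup>2))"
    unfolding pairing_def
  proof (rule integral_norm_bound_integral)
    show "(\<lambda>y. of_real (cutoff R y) * (mirrored (gauss_kernel z) x y * p y t)) integrable_on {0..R}"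
      using z t by (intro integrable_continuous_interval continuous_intros) auto
    show "(\<lambda>y. 2 * M / sqrt (norm z) * (1 / (1 + y)\<^sup>2)) integrable_on {0..R}"
      using has_integral_inverse_square[of R] R by (intro integrable_on_mult_right) auto
  next
    fix y assume y: "y \<in> {0..R}"
    have "norm (p y t) \<le> M * (1 / (1 + y)\<^sup>2)"
      using M[of y] y by (simp add: field_simps)
    then have "\<bar>cutoff R y\<bar> * (norm (mirrored (gauss_kernel z) x y) * norm (p y t))
        \<le> 1 * (2 / sqrt (norm z) * (M * (1 / (1 + y)\<^sup>2)))"
      using cutoff_bounds[of y R] y R M0
      by (intro mult_mono norm_mirrored_gauss_kernel_le z) auto
    then show "norm (of_real (cutoff R y) * (mirrored (gauss_kernel z) x y * p y t))
        \<le> 2 * M / sqrt (norm z) * (1 / (1 + y)\<^sup>2)"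
      by (simp add: norm_mult mult_ac)
  qed
  also have "\<dots> = 2 * M / sqrt (norm z) * (1 - 1 / (1 + R))"
    using R by (intro integral_unique has_integral_mult_right has_integral_inverse_square) auto
  also have "\<dots> \<le> 2 * M / sqrt (norm z) * 1"
    using M0 R n by (intro mult_left_mono) auto
  finally show ?thesis by simp
qed

text \<open>Integration by parts against a primitive of the kernel. Since the primitive is bounded
  independently of z, no negative power of |z| appears, at the price of using the decay of
  \<open>p1\<close>.\<close>

lemma norm_pairing_le_uniform:
  assumes z: "Re z > 0" and t: "t \<ge> 0" and R: "R > 0"
    and M: "\<And>y. y \<ge> 0 \<Longrightarrow> norm (p y t) \<le> M" "\<And>y. y \<ge> 0 \<Longrightarrow> (1 + y)\<^sup>2 * norm (p1 y t) \<le> M"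
  shows "norm (pairing z x R t) \<le> 48 * M"
proof -
  obtain F where F: "\<And>y. (F has_vector_derivative gauss_kernel z y) (at y)"
    and F12: "\<And>a b. norm (F b - F a) \<le> 12"
    using gauss_kernel_primitive [OF z] by blast
  have M0: "M \<ge> 0" using order_trans [OF norm_ge_zero M(1)] by blast
  \<comment> \<open>The primitive is normalised to vanish at y = 0; at y = R the cut-off vanishes,
    so no boundary term remains. Each of the two images contributes 12 to the bound 24.\<close>
  define W where "W y = mirrored F x y - mirrored F x 0" for y
  have W: "norm (W y) \<le> 24" for y
    using norm_triangle_ineq [of "F (y - x) - F (- x)" "F (y + x) - F x"] F12[of "y - x" "- x"] F12[of "y + x" x]
    unfolding W_def mirrored_def by (simp add: algebra_simps)
  let ?c = "\<lambda>y. complex_of_real (cutoff R y)" and ?c' = "\<lambda>y. complex_of_real (cutoff' R y)"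
  let ?v = "mirrored (gauss_kernel z) x"
  let ?e = "\<lambda>y. W y * (?c' y * p y t + ?c y * p1 y t)"
  have dW: "(W has_vector_derivative ?v y) (at y within S)" for y S
    using has_vector_derivative_diff [OF mirrored_has_vector_derivative [OF F] has_vector_derivative_const]
    by (simp add: W_def [abs_def])
  have "((\<lambda>y. ?c y * (?v y * p y t) + ?e y) has_integral
      (W R * (?c R * p R t) - W 0 * (?c 0 * p 0 t))) {0..R}"
  proof (rule fundamental_theorem_of_calculus [where f = "\<lambda>y. W y * (?c y * p y t)"])
    fix y assume y: "y \<in> {0..R}"
    have dp: "((\<lambda>y. p y t) has_vector_derivative p1 y t) (at y within {0..R})"
      using p_x[of y t] y t by (auto intro: has_vector_derivative_within_subset)
    show "((\<lambda>y. W y * (?c y * p y t)) has_vector_derivative ?c y * (?v y * p y t) + ?e y) (at y within {0..R})"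
      by (rule has_vector_derivative_eq_rhs)
         (rule has_vector_derivative_mult dW dp cutoff_has_vector_derivative | simp add: algebra_simps)+
  qed (use R in auto)
  moreover have "W 0 = 0" "?c R = 0"
    using R by (simp_all add: W_def cutoff_boundary)
  moreover have cW: "continuous_on {0..R} W"
    using dW by (intro continuous_on_vector_derivative)
  have ie: "?e integrable_on {0..R}"
    using t by (intro integrable_continuous_interval continuous_intros cW) auto
  ultimately have "((\<lambda>y. (?c y * (?v y * p y t) + ?e y) - ?e y) has_integral
      (0 - integral {0..R} ?e)) {0..R}"
    by (intro has_integral_diff) auto
  then have "pairing z x R t = - integral {0..R} ?e"
    by (simp add: pairing_def integral_unique)
  then have "norm (pairing z x R t) = norm (integral {0..R} ?e)" by simp
  \<comment> \<open>The modulus of \<open>cutoff'\<close> is its negative, with integral 1, and the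
    integral of (1 + y)^(-2) is at most 1; together they give the factor 2 in 24 * 2 = 48.\<close>
  also have "\<dots> \<le> integral {0..R} (\<lambda>y. 24 * M * (- cutoff' R y + 1 / (1 + y)\<^sup>2))"
  proof (rule integral_norm_bound_integral [OF ie])
    show "(\<lambda>y. 24 * M * (- cutoff' R y + 1 / (1 + y)\<^sup>2)) integrable_on {0..R}"
      by (intro integrable_continuous_interval continuous_intros) auto
  next
    fix y assume y: "y \<in> {0..R}"
    have "norm (p1 y t) \<le> M * (1 / (1 + y)\<^sup>2)"
      using M(2)[of y] y by (simp add: field_simps)
    moreover note cb = cutoff_bounds[of y R]
    ultimately have "\<bar>cutoff' R y\<bar> * norm (p y t) + \<bar>cutoff R y\<bar> * norm (p1 y t)
       \<le> - cutoff' R y * M + 1 * (M * (1 / (1 + y)\<^sup>2))"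
      using y R M M0 by (intro add_mono mult_mono) auto
    then have "norm (?c' y * p y t + ?c y * p1 y t) \<le> M * (- cutoff' R y + 1 / (1 + y)\<^sup>2)"
      by (intro norm_triangle_le) (simp add: norm_mult algebra_simps)
    then have "norm (W y) * norm (?c' y * p y t + ?c y * p1 y t) \<le> 24 * (M * (- cutoff' R y + 1 / (1 + y)\<^sup>2))"
      by (intro mult_mono W) auto
    then show "norm (?e y) \<le> 24 * M * (- cutoff' R y + 1 / (1 + y)\<^sup>2)"
      by (simp only: norm_mult mult.assoc)
  qed
  also have "\<dots> = 24 * M * (1 + (1 - 1 / (1 + R)))"
  proof (rule integral_unique)
    have "(cutoff' R has_integral (cutoff R R - cutoff R 0)) {0..R}"
      using R cutoff_has_derivative(1)[of R]
      by (intro fundamental_theorem_of_calculus) (auto simp: has_real_derivative_iff_has_vector_derivative)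
    from has_integral_neg [OF this] have "((\<lambda>y. - cutoff' R y) has_integral 1) {0..R}"
      using R by (simp add: cutoff_boundary)
    then show "((\<lambda>y. 24 * M * (- cutoff' R y + 1 / (1 + y)\<^sup>2)) has_integral 24 * M * (1 + (1 - 1 / (1 + R)))) {0..R}"
      using R by (intro has_integral_mult_right has_integral_add has_integral_inverse_square) auto
  qed
  also have "\<dots> \<le> 24 * M * 2"
    using M0 R by (intro mult_left_mono) auto
  finally show ?thesis by simp
qed

end

section \<open>Uniform bounds on time strips\<close>

lemma gauss_kernel_of_real:
  assumes "\<epsilon> > 0"
  shows "gauss_kernel (Complex \<epsilon> 0) y = of_real (exp (- y\<^sup>2 / (4 * \<epsilon>)) / sqrt \<epsilon>)"
proof -
  have "Complex \<epsilon> 0 = of_real \<epsilon>" by (simp add: complex_of_real_def)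
  then show ?thesis
    using assms by (simp add: gauss_kernel_def flip: exp_of_real)
qed

lemma has_integral_Cauchy_kernel:
  assumes "\<epsilon> > 0" "R \<ge> 0"
  shows "((\<lambda>y. 16 * \<epsilon> / (\<epsilon> + (y + c)\<^sup>2)) has_integral
     16 * sqrt \<epsilon> * (arctan ((R + c) / sqrt \<epsilon>) - arctan (c / sqrt \<epsilon>))) {0..R}"
proof -
  have "((\<lambda>y. 16 * \<epsilon> / (\<epsilon> + (y + c)\<^sup>2)) has_integral
     16 * sqrt \<epsilon> * arctan ((R + c) / sqrt \<epsilon>) - 16 * sqrt \<epsilon> * arctan ((0 + c) / sqrt \<epsilon>)) {0..R}"
  proof (rule fundamental_theorem_of_calculus [where f = "\<lambda>y. 16 * sqrt \<epsilon> * arctan ((y + c) / sqrt \<epsilon>)", OF assms(2)])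
    fix y
    have "((\<lambda>y. arctan ((y + c) / sqrt \<epsilon>)) has_field_derivative
        inverse (1 + ((y + c) / sqrt \<epsilon>)\<^sup>2) * ((1 + 0) / sqrt \<epsilon>)) (at y within {0..R})"
      by (rule DERIV_chain2 [OF DERIV_arctan]) (intro DERIV_cdivide DERIV_add DERIV_ident DERIV_const)
    from DERIV_cmult [OF this, of "16 * sqrt \<epsilon>"]
    have "((\<lambda>y. 16 * sqrt \<epsilon> * arctan ((y + c) / sqrt \<epsilon>)) has_field_derivative
        16 * inverse (1 + ((y + c) / sqrt \<epsilon>)\<^sup>2)) (at y within {0..R})"
      using assms by simp
    moreover have "inverse (1 + ((y + c) / sqrt \<epsilon>)\<^sup>2) = \<epsilon> / (\<epsilon> + (y + c)\<^sup>2)"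
    proof -
      have "1 + ((y + c) / sqrt \<epsilon>)\<^sup>2 = (\<epsilon> + (y + c)\<^sup>2) / \<epsilon>"
        using assms by (simp add: power_divide add_divide_distrib [of \<epsilon>])
      then show ?thesis by simp
    qed
    ultimately show "((\<lambda>y. 16 * sqrt \<epsilon> * arctan ((y + c) / sqrt \<epsilon>)) has_vector_derivative
        16 * \<epsilon> / (\<epsilon> + (y + c)\<^sup>2)) (at y within {0..R})"
      unfolding has_real_derivative_iff_has_vector_derivative [symmetric] by simp
  qed
  then show ?thesis by (simp add: right_diff_distrib)
qed

lemma integral_Cauchy_kernel_le:
  assumes "\<epsilon> > 0" "R \<ge> 0"
  shows "integral {0..R} (\<lambda>y. 16 * \<epsilon> / (\<epsilon> + (y + c)\<^sup>2)) \<le> 64 * sqrt \<epsilon>"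
proof -
  have "arctan ((R + c) / sqrt \<epsilon>) - arctan (c / sqrt \<epsilon>) \<le> 4"
    using arctan_bounded[of "(R + c) / sqrt \<epsilon>"] arctan_bounded[of "c / sqrt \<epsilon>"] pi_less_4 by linarith
  then have "16 * sqrt \<epsilon> * (arctan ((R + c) / sqrt \<epsilon>) - arctan (c / sqrt \<epsilon>)) \<le> 16 * sqrt \<epsilon> * 4"
    using assms by (intro mult_left_mono) auto
  then show ?thesis
    using integral_unique [OF has_integral_Cauchy_kernel [OF assms, of c]] by simp
qed

text \<open>On an interval of length sqrt \<epsilon> to the right of x the direct term is at least
  exp (-1/4) / sqrt \<epsilon>, which alone gives mass 3/4; the image term is nonnegative. The bound
  allows a value of \<open>p\<close> to be recovered from its pairing at any x, near the boundary or
  far from it.\<close>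

lemma heat_kernel_mass_ge:
  assumes \<epsilon>: "\<epsilon> > 0" and x: "x \<ge> 0" "x + sqrt \<epsilon> \<le> R"
  shows "norm (integral {0..R} (mirrored (gauss_kernel (Complex \<epsilon> 0)) x)) \<ge> 1 / 2"
proof -
  let ?G = "\<lambda>y. exp (- y\<^sup>2 / (4 * \<epsilon>)) / sqrt \<epsilon>"
  let ?g = "\<lambda>y. ?G (y - x) + ?G (y + x)"
  have int: "?g integrable_on {a..b}" for a b
    by (intro integrable_continuous_interval continuous_intros) (use \<epsilon> in auto)
  have "((\<lambda>y. of_real (?g y)) has_integral complex_of_real (integral {0..R} ?g)) {0..R}"
    using has_integral_linear [OF integrable_integral [OF int] bounded_linear_of_real]
    unfolding o_def .
  moreover have "mirrored (gauss_kernel (Complex \<epsilon> 0)) x = (\<lambda>y. complex_of_real (?g y))"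
    by (simp add: fun_eq_iff mirrored_def gauss_kernel_of_real [OF \<epsilon>])
  ultimately have eq: "integral {0..R} (mirrored (gauss_kernel (Complex \<epsilon> 0)) x) = of_real (integral {0..R} ?g)"
    by (simp only: integral_unique)
  have "integral {x..x + sqrt \<epsilon>} (\<lambda>_. 3 / 4 / sqrt \<epsilon>) \<le> integral {x..x + sqrt \<epsilon>} ?g"
  proof (rule integral_le [OF _ int])
    fix y assume y: "y \<in> {x..x + sqrt \<epsilon>}"
    then have "(y - x)\<^sup>2 \<le> (sqrt \<epsilon>)\<^sup>2"
      by (intro power_mono) auto
    then have "- 1 / 4 \<le> - (y - x)\<^sup>2 / (4 * \<epsilon>)"
      using \<epsilon> by (simp add: field_simps)
    then have e: "exp (- 1 / 4) \<le> exp (- (y - x)\<^sup>2 / (4 * \<epsilon>))"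
      by (subst exp_le_cancel_iff)
    have "3 / 4 \<le> exp (- 1 / 4 :: real)"
      using exp_ge_add_one_self[of "- 1 / 4 :: real"] by simp
    from divide_right_mono [OF order_trans [OF this e]]
    have "3 / 4 / sqrt \<epsilon> \<le> ?G (y - x)"
      using \<epsilon> by simp
    moreover have "0 \<le> ?G (y + x)"
      using \<epsilon> by simp
    ultimately show "3 / 4 / sqrt \<epsilon> \<le> ?g y" by linarith
  qed auto
  also have "integral {x..x + sqrt \<epsilon>} ?g \<le> integral {0..R} ?g"
    using x \<epsilon> by (intro integral_subset_le int) auto
  finally have "3 / 4 \<le> integral {0..R} ?g"
    using \<epsilon> by simp
  then show ?thesis unfolding eq by simp
qed

context neumann_evolution
begin

text \<open>The function \<open>cutoff * p\<close> is Lipschitz with constant 5 M, of which 4 M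
  comes from the cut-off with R \<ge> 1. Each image has first moment at most 64 sqrt \<epsilon>,
  hence 5 * 128 = 640.\<close>

lemma pairing_approximates_value:
  assumes \<epsilon>: "\<epsilon> > 0" and t: "t \<ge> 0" and x: "0 \<le> x" "x \<le> R" and R: "R \<ge> 1"
    and M: "\<And>y. y \<ge> 0 \<Longrightarrow> norm (p y t) \<le> M" "\<And>y. y \<ge> 0 \<Longrightarrow> norm (p1 y t) \<le> M"
  shows "norm (pairing (Complex \<epsilon> 0) x R t -
      of_real (cutoff R x) * p x t * integral {0..R} (mirrored (gauss_kernel (Complex \<epsilon> 0)) x))
    \<le> 640 * M * sqrt \<epsilon>"
proof -
  let ?k = "gauss_kernel (Complex \<epsilon> 0)"
  define f where "f y = complex_of_real (cutoff R y) * p y t" for y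
  have M0: "M \<ge> 0" using order_trans [OF norm_ge_zero M(1)] by blast
  have R0: "R > 0" using R by simp
  have cv: "continuous_on {0..R} (mirrored ?k x)"
    using continuous_on_mirrored_gauss_kernel(1) [of "{0..R}" "\<lambda>_. Complex \<epsilon> 0" "\<lambda>y. y"] \<epsilon> by simp
  have df: "(f has_vector_derivative (of_real (cutoff R y) * p1 y t + of_real (cutoff' R y) * p y t))
      (at y within {0..R})" if y: "y \<in> {0..R}" for y
  proof -
    have dp: "((\<lambda>y. p y t) has_vector_derivative p1 y t) (at y within {0..R})"
      using p_x[of y t] y t by (auto intro: has_vector_derivative_within_subset)
    show ?thesis unfolding f_def
      by (rule has_vector_derivative_mult [OF cutoff_has_vector_derivative(1) dp])
  qed
  have lip: "norm (f y - f x) \<le> 5 * M * norm (y - x)" if y: "y \<in> {0..R}" for y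
  proof (rule differentiable_bound [where f' = "\<lambda>w h. h *\<^sub>R (of_real (cutoff R w) * p1 w t + of_real (cutoff' R w) * p w t)"])
    fix w assume w: "w \<in> {0..R}"
    note cb = cutoff_bounds[of w R]
    have "\<bar>cutoff' R w\<bar> \<le> 4 * w / R\<^sup>2" using cb w R by auto
    also have "\<dots> \<le> 4"
    proof -
      have "w * 1 \<le> R * R" using w R by (intro mult_mono) auto
      then show ?thesis using R by (simp add: field_simps power2_eq_square)
    qed
    finally have "\<bar>cutoff R w\<bar> * norm (p1 w t) + \<bar>cutoff' R w\<bar> * norm (p w t) \<le> 1 * M + 4 * M"
      using cb w R M0 M[of w] by (intro add_mono mult_mono) auto
    then have "norm (of_real (cutoff R w) * p1 w t + of_real (cutoff' R w) * p w t) \<le> 5 * M"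
      by (intro norm_triangle_le) (simp add: norm_mult)
    then show "onorm (\<lambda>h. h *\<^sub>R (of_real (cutoff R w) * p1 w t + of_real (cutoff' R w) * p w t)) \<le> 5 * M"
      using M0 by (intro onorm_bound) (auto simp: mult.commute [of "\<bar>_\<bar>"] intro!: mult_right_mono)
  qed (use df y x in \<open>auto simp: has_vector_derivative_def\<close>)
  have cf: "continuous_on {0..R} f"
    using df by (rule continuous_on_vector_derivative)
  have "((\<lambda>y. mirrored ?k x y * (f y - f x)) has_integral
      (pairing (Complex \<epsilon> 0) x R t - integral {0..R} (mirrored ?k x) * f x)) {0..R}"
  proof -
    have "((\<lambda>y. mirrored ?k x y * f y) has_integral pairing (Complex \<epsilon> 0) x R t) {0..R}"
    proof -
      have "(\<lambda>y. mirrored ?k x y * f y) integrable_on {0..R}"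
        by (intro integrable_continuous_interval continuous_intros cv cf)
      moreover have "pairing (Complex \<epsilon> 0) x R t = integral {0..R} (\<lambda>y. mirrored ?k x y * f y)"
        by (simp add: pairing_def f_def mult_ac)
      ultimately show ?thesis by (simp add: integrable_integral)
    qed
    moreover have "((\<lambda>y. mirrored ?k x y * f x) has_integral integral {0..R} (mirrored ?k x) * f x) {0..R}"
      by (intro has_integral_mult_left integrable_integral integrable_continuous_interval cv)
    ultimately show ?thesis
      unfolding right_diff_distrib by (rule has_integral_diff)
  qed
  then have "norm (pairing (Complex \<epsilon> 0) x R t - of_real (cutoff R x) * p x t * integral {0..R} (mirrored ?k x))
      = norm (integral {0..R} (\<lambda>y. mirrored ?k x y * (f y - f x)))"
    by (simp add: integral_unique f_def mult_ac)
  also have "\<dots> \<le> integral {0..R} (\<lambda>y. 5 * M * (16 * \<epsilon> / (\<epsilon> + (y + - x)\<^sup>2) + 16 * \<epsilon> / (\<epsilon> + (y + x)\<^sup>2)))"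
  proof (rule integral_norm_bound_integral)
    show "(\<lambda>y. mirrored ?k x y * (f y - f x)) integrable_on {0..R}"
      by (intro integrable_continuous_interval continuous_intros cv cf)
    show "(\<lambda>y. 5 * M * (16 * \<epsilon> / (\<epsilon> + (y + - x)\<^sup>2) + 16 * \<epsilon> / (\<epsilon> + (y + x)\<^sup>2))) integrable_on {0..R}"
      using \<epsilon> by (intro integrable_continuous_interval continuous_intros) (auto simp: add_pos_nonneg less_imp_neq [symmetric])
  next
    fix y assume y: "y \<in> {0..R}"
    have "norm (mirrored ?k x y) * \<bar>y - x\<bar> \<le> (norm (?k (y - x)) + norm (?k (y + x))) * \<bar>y - x\<bar>"
      unfolding mirrored_def by (intro mult_right_mono norm_triangle_ineq) auto
    \<comment> \<open>For nonnegative x and y the distance to x is at most the distance to the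
      mirror point, so the first moment of the image term also suffices.\<close>
    also have "\<dots> \<le> \<bar>y - x\<bar> * norm (?k (y - x)) + \<bar>y + x\<bar> * norm (?k (y + x))"
    proof -
      have "\<bar>y - x\<bar> \<le> \<bar>y + x\<bar>" using y x by auto
      then have "\<bar>y - x\<bar> * norm (?k (y + x)) \<le> \<bar>y + x\<bar> * norm (?k (y + x))"
        by (rule mult_right_mono) auto
      then show ?thesis by (simp add: algebra_simps)
    qed
    also have "\<dots> \<le> 16 * \<epsilon> / (\<epsilon> + (y - x)\<^sup>2) + 16 * \<epsilon> / (\<epsilon> + (y + x)\<^sup>2)"
      by (intro add_mono heat_kernel_first_moment_le \<epsilon>)
    finally have "5 * M * (norm (mirrored ?k x y) * \<bar>y - x\<bar>)
       \<le> 5 * M * (16 * \<epsilon> / (\<epsilon> + (y - x)\<^sup>2) + 16 * \<epsilon> / (\<epsilon> + (y + x)\<^sup>2))"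
      using M0 by (intro mult_left_mono) auto
    moreover have "norm (mirrored ?k x y * (f y - f x)) \<le> norm (mirrored ?k x y) * (5 * M * \<bar>y - x\<bar>)"
      unfolding norm_mult using lip[OF y] by (intro mult_left_mono) auto
    ultimately show "norm (mirrored ?k x y * (f y - f x))
        \<le> 5 * M * (16 * \<epsilon> / (\<epsilon> + (y + - x)\<^sup>2) + 16 * \<epsilon> / (\<epsilon> + (y + x)\<^sup>2))"
      by (simp add: mult_ac)
  qed
  also have "\<dots> = 5 * M * (integral {0..R} (\<lambda>y. 16 * \<epsilon> / (\<epsilon> + (y + - x)\<^sup>2)) + integral {0..R} (\<lambda>y. 16 * \<epsilon> / (\<epsilon> + (y + x)\<^sup>2)))"
  proof -
    have "(\<lambda>y. 16 * \<epsilon> / (\<epsilon> + (y + c)\<^sup>2)) integrable_on {0..R}" for c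
      by (rule has_integral_integrable [OF has_integral_Cauchy_kernel]) (use \<epsilon> R in auto)
    note int = this [of "- x"] this [of x]
    show ?thesis
      by (rule integral_unique [OF has_integral_mult_right [OF has_integral_add [OF int [THEN integrable_integral]]]])
  qed
  also have "\<dots> \<le> 5 * M * (64 * sqrt \<epsilon> + 64 * sqrt \<epsilon>)"
    using R M0 by (intro mult_left_mono add_mono integral_Cauchy_kernel_le \<epsilon>) auto
  finally show ?thesis by simp
qed

text \<open>At fixed \<epsilon> the limit R to infinity removes D / R and the cut-off; then
  \<epsilon> to 0 removes the approximation error. The constant M in that error is the one belonging
  to the single time t, so only K survives. The factor 2 is the inverse of the lower bound for the
  mass.\<close>

lemma norm_p_le_if_pairing_le:
  assumes t: "t \<ge> 0" and x: "x \<ge> 0"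
    and pair: "\<And>\<epsilon>. 0 < \<epsilon> \<Longrightarrow> \<epsilon> \<le> 1 \<Longrightarrow> \<exists>D. \<forall>R>0. norm (pairing (Complex \<epsilon> 0) x R t) \<le> K + D / R"
  shows "norm (p x t) \<le> 2 * K"
proof -
  obtain M where "\<forall>y\<ge>0. (1 + y)\<^sup>2 * norm (p y t) \<le> M \<and> (1 + y)\<^sup>2 * norm (p1 y t) \<le> M"
    using decay [OF t] by blast
  moreover have "norm w \<le> (1 + y)\<^sup>2 * norm w" if "y \<ge> 0" for y and w :: complex
    using that mult_right_mono [of 1 "(1 + y)\<^sup>2" "norm w"] by simp
  ultimately have M: "\<And>y. y \<ge> 0 \<Longrightarrow> norm (p y t) \<le> M" "\<And>y. y \<ge> 0 \<Longrightarrow> norm (p1 y t) \<le> M"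
    using order_trans by blast+
  have *: "norm (p x t) * (1 / 2) \<le> K + 640 * M * sqrt \<epsilon>" if \<epsilon>: "0 < \<epsilon>" "\<epsilon> \<le> 1" for \<epsilon>
  proof -
    obtain D where D: "\<And>R. R > 0 \<Longrightarrow> norm (pairing (Complex \<epsilon> 0) x R t) \<le> K + D / R"
      using pair [OF \<epsilon>] by blast
    have ev: "cutoff R x * norm (p x t) * (1 / 2) \<le> K + D / R + 640 * M * sqrt \<epsilon>" if R: "R \<ge> x + 1" for R
    proof -
      let ?I = "integral {0..R} (mirrored (gauss_kernel (Complex \<epsilon> 0)) x)"
      have R1: "R \<ge> 1" "R > 0" "x \<le> R" using R x by auto
      have cb: "0 \<le> cutoff R x" using cutoff_bounds(1)[of x R] R1 x by auto
      have "sqrt \<epsilon> \<le> 1" using \<epsilon> by simp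
      then have "x + sqrt \<epsilon> \<le> R"
        using R by linarith
      then have "1 / 2 \<le> norm ?I"
        by (rule heat_kernel_mass_ge [OF \<epsilon>(1) x])
      then have "cutoff R x * norm (p x t) * (1 / 2) \<le> cutoff R x * norm (p x t) * norm ?I"
        using cb by (intro mult_left_mono mult_nonneg_nonneg) auto
      also have "\<dots> = norm (of_real (cutoff R x) * p x t * ?I)"
        using cb by (simp add: norm_mult)
      also have "\<dots> \<le> norm (pairing (Complex \<epsilon> 0) x R t) + 640 * M * sqrt \<epsilon>"
        using pairing_approximates_value [OF \<epsilon>(1) t x R1(3,1) M]
          norm_triangle_ineq2 [of "of_real (cutoff R x) * p x t * ?I" "pairing (Complex \<epsilon> 0) x R t"]
        by (simp add: norm_minus_commute)
      also have "\<dots> \<le> K + D / R + 640 * M * sqrt \<epsilon>"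
        using D [OF R1(2)] by simp
      finally show ?thesis .
    qed
    have "((\<lambda>R. x\<^sup>2 / R\<^sup>2) \<longlongrightarrow> 0) at_top"
      by (intro tendsto_divide_0 [OF tendsto_const] filterlim_at_top_imp_at_infinity
          filterlim_pow_at_top filterlim_ident) auto
    then have "((\<lambda>R. cutoff R x * norm (p x t) * (1 / 2)) \<longlongrightarrow> (1 - 0)\<^sup>2 * norm (p x t) * (1 / 2)) at_top"
      unfolding cutoff_def by (intro tendsto_intros)
    moreover have "((\<lambda>R. K + D / R + 640 * M * sqrt \<epsilon>) \<longlongrightarrow> K + 0 + 640 * M * sqrt \<epsilon>) at_top"
      by (intro tendsto_intros tendsto_divide_0 [OF tendsto_const] filterlim_at_top_imp_at_infinity filterlim_ident)
    moreover have "eventually (\<lambda>R. cutoff R x * norm (p x t) * (1 / 2) \<le> K + D / R + 640 * M * sqrt \<epsilon>) at_top"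
      using eventually_ge_at_top [of "x + 1"] by eventually_elim (rule ev)
    ultimately show ?thesis
      using tendsto_le [OF trivial_limit_at_top_linorder] by fastforce
  qed
  have "((\<lambda>\<epsilon>. K + 640 * M * sqrt \<epsilon>) \<longlongrightarrow> K + 640 * M * sqrt 0) (at_right 0)"
    by (intro tendsto_intros)
  moreover have "eventually (\<lambda>\<epsilon>. norm (p x t) * (1 / 2) \<le> K + 640 * M * sqrt \<epsilon>) (at_right 0)"
    using eventually_at_right_less [of "0 :: real"] eventually_at_right [of 0 "1 :: real"]
    unfolding eventually_at_right_field using * by (intro exI[of _ 1]) auto
  ultimately have "norm (p x t) * (1 / 2) \<le> K + 640 * M * sqrt 0"
    by (intro tendsto_lowerbound [OF _ _ trivial_limit_at_right_real])
  then show ?thesis by simp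
qed

end

section \<open>Propagation of bounds from one time to another\<close>

lemma has_integral_inverse_sqrt:
  assumes "e > 0" "c \<le> d"
  shows "((\<lambda>s. 1 / sqrt (e + (d - s))) has_integral (2 * sqrt (e + (d - c)) - 2 * sqrt e)) {c..d}"
    and "((\<lambda>s. 1 / sqrt (e + (s - c))) has_integral (2 * sqrt (e + (d - c)) - 2 * sqrt e)) {c..d}"
proof -
  have "((\<lambda>s. 1 / sqrt (e + (d - s))) has_integral (- 2 * sqrt (e + (d - d)) - - 2 * sqrt (e + (d - c)))) {c..d}"
  proof (rule fundamental_theorem_of_calculus [where f = "\<lambda>s. - 2 * sqrt (e + (d - s))", OF assms(2)])
    fix s assume "s \<in> {c..d}"
    then have "e + (d - s) > 0" using assms by auto
    then show "((\<lambda>s. - 2 * sqrt (e + (d - s))) has_vector_derivative 1 / sqrt (e + (d - s))) (at s within {c..d})"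
      unfolding has_real_derivative_iff_has_vector_derivative [symmetric]
      by (auto intro!: derivative_eq_intros simp: field_simps)
  qed
  then show "((\<lambda>s. 1 / sqrt (e + (d - s))) has_integral (2 * sqrt (e + (d - c)) - 2 * sqrt e)) {c..d}"
    by simp
  have "((\<lambda>s. 1 / sqrt (e + (s - c))) has_integral (2 * sqrt (e + (d - c)) - 2 * sqrt (e + (c - c)))) {c..d}"
  proof (rule fundamental_theorem_of_calculus [where f = "\<lambda>s. 2 * sqrt (e + (s - c))", OF assms(2)])
    fix s assume "s \<in> {c..d}"
    then have "e + (s - c) > 0" using assms by auto
    then show "((\<lambda>s. 2 * sqrt (e + (s - c))) has_vector_derivative 1 / sqrt (e + (s - c))) (at s within {c..d})"
      unfolding has_real_derivative_iff_has_vector_derivative [symmetric]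
      by (auto intro!: derivative_eq_intros simp: field_simps)
  qed
  then show "((\<lambda>s. 1 / sqrt (e + (s - c))) has_integral (2 * sqrt (e + (d - c)) - 2 * sqrt e)) {c..d}"
    by simp
qed

lemma norm_mirrored_gauss_kernel_Complex_le:
  assumes "\<epsilon> > 0"
  shows "norm (mirrored (gauss_kernel (Complex \<epsilon> r)) x y) \<le> 3 * (1 / sqrt (\<epsilon> + \<bar>r\<bar>))"
proof -
  have "\<epsilon> + \<bar>r\<bar> \<le> 2 * norm (Complex \<epsilon> r)"
    using abs_Re_le_cmod [of "Complex \<epsilon> r"] abs_Im_le_cmod [of "Complex \<epsilon> r"] assms by simp
  \<comment> \<open>The factor 2 is enlarged to the square 9/4 so that its root is rational; this
    turns 2 |z|^(-1/2) into the constant 3.\<close>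
  then have "9 / 4 * norm (Complex \<epsilon> r) \<ge> \<epsilon> + \<bar>r\<bar>"
    using norm_ge_zero [of "Complex \<epsilon> r"] by linarith
  then have "sqrt (\<epsilon> + \<bar>r\<bar>) \<le> sqrt ((3 / 2)\<^sup>2 * norm (Complex \<epsilon> r))"
    by (intro real_sqrt_le_mono) (simp add: power2_eq_square)
  also have "\<dots> = 3 / 2 * sqrt (norm (Complex \<epsilon> r))"
    by (simp add: real_sqrt_mult)
  finally have s: "sqrt (\<epsilon> + \<bar>r\<bar>) \<le> 3 / 2 * sqrt (norm (Complex \<epsilon> r))" .
  have pos: "sqrt (\<epsilon> + \<bar>r\<bar>) > 0" using assms by simp
  with s have pos': "sqrt (norm (Complex \<epsilon> r)) > 0" by linarith
  have "norm (mirrored (gauss_kernel (Complex \<epsilon> r)) x y) \<le> 2 / sqrt (norm (Complex \<epsilon> r))"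
    using assms by (intro norm_mirrored_gauss_kernel_le) simp
  also have "\<dots> \<le> 3 * (1 / sqrt (\<epsilon> + \<bar>r\<bar>))"
    using s pos pos' by (simp add: field_simps)
  finally show ?thesis .
qed

context neumann_evolution
begin

text \<open>The kernel at the boundary is of size |s0 - s|^(-1/2), an integrable singularity at the
  end point s0, so the bound is uniform in \<epsilon>. Both positions of s0 occur because bounds are
  carried forwards and backwards in time.\<close>

lemma norm_boundary_integral_le:
  assumes \<epsilon>: "0 < \<epsilon>" "\<epsilon> \<le> 1" and c: "0 \<le> c" "c \<le> d" "d \<le> T" and s0: "s0 = c \<or> s0 = d"
    and b: "\<And>s. s \<in> {0..T} \<Longrightarrow> norm (p1 0 s) \<le> b"
  shows "norm (integral {c..d} (\<lambda>s. mirrored (gauss_kernel (Complex \<epsilon> (s0 - s))) x 0 * p1 0 s))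
     \<le> 6 * b * sqrt (1 + T)"
proof -
  have b0: "b \<ge> 0" using order_trans [OF norm_ge_zero b [of 0]] c by auto
  let ?h = "\<lambda>s. 3 * b * (1 / sqrt (\<epsilon> + \<bar>s0 - s\<bar>))"
  have h: "(?h has_integral 3 * b * (2 * sqrt (\<epsilon> + (d - c)) - 2 * sqrt \<epsilon>)) {c..d}"
  proof (rule has_integral_mult_right)
    have "((\<lambda>s. 1 / sqrt (\<epsilon> + \<bar>s0 - s\<bar>)) has_integral I) {c..d}
        \<longleftrightarrow> ((\<lambda>s. if s0 = c then 1 / sqrt (\<epsilon> + (s - c)) else 1 / sqrt (\<epsilon> + (d - s))) has_integral I) {c..d}" for I
      using s0 by (intro has_integral_cong) auto
    then show "((\<lambda>s. 1 / sqrt (\<epsilon> + \<bar>s0 - s\<bar>)) has_integral (2 * sqrt (\<epsilon> + (d - c)) - 2 * sqrt \<epsilon>)) {c..d}"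
      using has_integral_inverse_sqrt [OF \<epsilon>(1) c(2)] by (cases "s0 = c") auto
  qed
  have "continuous_on {c..d} (\<lambda>s. Complex \<epsilon> (s0 - s))"
    unfolding Complex_eq by (intro continuous_intros)
  then have "norm (integral {c..d} (\<lambda>s. mirrored (gauss_kernel (Complex \<epsilon> (s0 - s))) x 0 * p1 0 s))
      \<le> integral {c..d} ?h"
  proof (intro integral_norm_bound_integral integrable_continuous_interval continuous_intros)
    fix s assume s: "s \<in> {c..d}"
    have "norm (mirrored (gauss_kernel (Complex \<epsilon> (s0 - s))) x 0) * norm (p1 0 s)
        \<le> 3 * (1 / sqrt (\<epsilon> + \<bar>s0 - s\<bar>)) * b"
      using s c b [of s] \<epsilon> by (intro mult_mono norm_mirrored_gauss_kernel_Complex_le) auto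
    then show "norm (mirrored (gauss_kernel (Complex \<epsilon> (s0 - s))) x 0 * p1 0 s) \<le> ?h s"
      by (simp add: norm_mult mult_ac)
  qed (use \<epsilon> c in auto)
  also have "\<dots> = 3 * b * (2 * sqrt (\<epsilon> + (d - c)) - 2 * sqrt \<epsilon>)"
    by (rule integral_unique [OF h])
  also have "\<dots> \<le> 3 * b * (2 * sqrt (1 + T))"
  proof (rule mult_left_mono)
    have "sqrt (\<epsilon> + (d - c)) \<le> sqrt (1 + T)" using \<epsilon> c by (intro real_sqrt_le_mono) auto
    moreover have "0 \<le> sqrt \<epsilon>" using \<epsilon> by simp
    ultimately show "2 * sqrt (\<epsilon> + (d - c)) - 2 * sqrt \<epsilon> \<le> 2 * sqrt (1 + T)" by linarith
  qed (use b0 in auto)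
  finally show ?thesis by simp
qed

text \<open>At s' the pairing is bounded by 48 M uniformly in the kernel time; at s0 the kernel is a
  real heat kernel concentrated near x. The assumed bound B only justifies letting R tend to
  infinity, so boundedness on the strip is upgraded to an estimate by the data at s' and the
  boundary data. The evolution is reversible, so s0 may be either end of the interval.\<close>

lemma propagation:
  assumes c: "0 \<le> c" "c \<le> d" "d \<le> T" and s: "s0 = d \<and> s' = c \<or> s0 = c \<and> s' = d"
    and B: "\<And>y s. y \<ge> 0 \<Longrightarrow> s \<in> {c..d} \<Longrightarrow> norm (p y s) \<le> B"
    and b: "\<And>s. s \<in> {0..T} \<Longrightarrow> norm (p1 0 s) \<le> b"
    and M: "\<And>y. y \<ge> 0 \<Longrightarrow> norm (p y s') \<le> M" "\<And>y. y \<ge> 0 \<Longrightarrow> (1 + y)\<^sup>2 * norm (p1 y s') \<le> M"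
    and x: "x \<ge> 0"
  shows "norm (p x s0) \<le> 2 * (48 * M + 6 * b * sqrt (1 + T))"
proof (rule norm_p_le_if_pairing_le [OF _ x])
  fix \<epsilon> :: real assume \<epsilon>: "0 < \<epsilon>" "\<epsilon> \<le> 1"
  let ?P = "\<lambda>s R. pairing (Complex \<epsilon> (s0 - s)) x R s"
  let ?J = "integral {c..d} (\<lambda>s. mirrored (gauss_kernel (Complex \<epsilon> (s0 - s))) x 0 * p1 0 s)"
  obtain D where D: "\<forall>R>0. norm (?P d R - ?P c R + \<i> * ?J) \<le> D / R"
    using pairing_increment [OF \<epsilon>(1) c(1,2) B] by blast
  have "norm ?J \<le> 6 * b * sqrt (1 + T)"
    using s by (intro norm_boundary_integral_le \<epsilon> c b) auto
  moreover have "norm (?P s' R) \<le> 48 * M" if "R > 0" for R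
    using s c \<epsilon> that by (intro norm_pairing_le_uniform M) auto
  moreover have "norm (?P s0 R) \<le> norm (?P d R - ?P c R + \<i> * ?J) + norm (?P s' R) + norm ?J" for R
  proof -
    have "norm A \<le> norm (A - C + \<i> * J) + norm C + norm J" "norm C \<le> norm (A - C + \<i> * J) + norm A + norm J"
      for A C J :: complex
      using norm_triangle_ineq4 [of "A - C + \<i> * J" "\<i> * J - C"] norm_triangle_ineq4 [of "\<i> * J" C]
        norm_triangle_ineq4 [of "A + \<i> * J" "A - C + \<i> * J"] norm_triangle_ineq [of A "\<i> * J"]
      by (auto simp: norm_mult)
    then show ?thesis using s by blast
  qed
  ultimately have "norm (?P s0 R) \<le> (48 * M + 6 * b * sqrt (1 + T)) + D / R" if "R > 0" for R
    using D that by (smt (verit))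
  then show "\<exists>D. \<forall>R>0. norm (pairing (Complex \<epsilon> 0) x R s0) \<le> (48 * M + 6 * b * sqrt (1 + T)) + D / R"
    by auto
qed (use s c in auto)

text \<open>
  The hypotheses bound a solution at each time separately. A time is regular if the bound is uniform
  nearby; the set of irregular times is closed, and on a relatively open piece of it the bounds are
  uniform by Baire's theorem. Propagation from its points extends them to the gaps, so that
  piece must be empty.
\<close>

definition regular_time :: "real \<Rightarrow> bool" where
  "regular_time t \<longleftrightarrow> (\<exists>\<delta>>0. \<exists>B. \<forall>s\<ge>0. \<bar>s - t\<bar> < \<delta> \<longrightarrow> (\<forall>y\<ge>0. norm (p y s) \<le> B))"

section \<open>Local uniformity in time by a category argument\<close>

lemma bounded_if_regular_times:
  assumes "c \<le> d" and reg: "\<And>t. t \<in> {c..d} \<Longrightarrow> regular_time t"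
  shows "\<exists>B. \<forall>s\<in>{c..d}. s \<ge> 0 \<longrightarrow> (\<forall>y\<ge>0. norm (p y s) \<le> B)"
  using assms(1)
proof (induction rule: Bolzano)
  case (trans a b e)
  then obtain B B' where "\<forall>s\<in>{a..b}. s \<ge> 0 \<longrightarrow> (\<forall>y\<ge>0. norm (p y s) \<le> B)"
    "\<forall>s\<in>{b..e}. s \<ge> 0 \<longrightarrow> (\<forall>y\<ge>0. norm (p y s) \<le> B')" by blast
  then have "\<forall>s\<in>{a..e}. s \<ge> 0 \<longrightarrow> (\<forall>y\<ge>0. norm (p y s) \<le> max B B')"
    by (metis atLeastAtMost_iff linear max.coboundedI1 max.coboundedI2)
  then show ?case by blast
next
  case (local t)
  then obtain \<delta> B where \<delta>: "\<delta> > 0" "\<forall>s\<ge>0. \<bar>s - t\<bar> < \<delta> \<longrightarrow> (\<forall>y\<ge>0. norm (p y s) \<le> B)"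
    using reg[of t] unfolding regular_time_def by auto
  have "\<exists>B. \<forall>s\<in>{a..b}. s \<ge> 0 \<longrightarrow> (\<forall>y\<ge>0. norm (p y s) \<le> B)" if "a \<le> t" "t \<le> b" "b - a < \<delta>" for a b
  proof (intro exI ballI impI)
    fix s assume "s \<in> {a..b}" "s \<ge> 0"
    moreover from this that have "\<bar>s - t\<bar> < \<delta>" by auto
    ultimately show "\<forall>y\<ge>0. norm (p y s) \<le> B" using \<delta>(2) by blast
  qed
  then show ?case using \<delta>(1) by blast
qed

text \<open>Since a itself may be irregular, no common bound on the whole segment is available to
  start with. Propagation is therefore used twice, from s towards a to obtain some common bound, and
  then from a to s to obtain the stated one.\<close>

lemma propagation_half_open:
  assumes a: "0 \<le> a" "a \<le> T" and s: "0 \<le> s" "s \<le> T" "a \<noteq> s"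
    and reg: "\<And>t. t \<in> closed_segment a s \<Longrightarrow> t \<noteq> a \<Longrightarrow> regular_time t"
    and b: "\<And>s. s \<in> {0..T} \<Longrightarrow> norm (p1 0 s) \<le> b"
    and M: "\<And>y. y \<ge> 0 \<Longrightarrow> norm (p y a) \<le> M" "\<And>y. y \<ge> 0 \<Longrightarrow> (1 + y)\<^sup>2 * norm (p1 y a) \<le> M"
    and x: "x \<ge> 0"
  shows "norm (p x s) \<le> 2 * (48 * M + 6 * b * sqrt (1 + T))"
proof -
  obtain M' where M': "\<forall>y\<ge>0. (1 + y)\<^sup>2 * norm (p y s) \<le> M' \<and> (1 + y)\<^sup>2 * norm (p1 y s) \<le> M'"
    using decay [OF s(1)] by blast
  have "norm w \<le> (1 + y)\<^sup>2 * norm w" if "y \<ge> 0" for y and w :: complex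
    using that mult_right_mono [of 1 "(1 + y)\<^sup>2" "norm w"] by simp
  then have M's: "\<And>y. y \<ge> 0 \<Longrightarrow> norm (p y s) \<le> M'" "\<And>y. y \<ge> 0 \<Longrightarrow> (1 + y)\<^sup>2 * norm (p1 y s) \<le> M'"
    using M' order_trans by blast+
  define c where "c = min a s"
  define d where "d = max a s"
  have cd: "0 \<le> c" "c \<le> d" "d \<le> T" using a s by (auto simp: c_def d_def)
  have seg: "closed_segment a s = {c..d}"
    by (auto simp: closed_segment_eq_real_ivl c_def d_def)
  \<comment> \<open>First pass: for r different from a the segment from r to s consists of regular
    times, so the data at s control \<open>p\<close> at r, with a constant that does not depend on
    r. The time a is covered by M.\<close>
  have bound: "norm (p y r) \<le> max M (2 * (48 * M' + 6 * b * sqrt (1 + T)))" if y: "y \<ge> 0" and r: "r \<in> {c..d}" for y r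
  proof (cases "r = a")
    case True
    then show ?thesis using M(1) [OF y] by simp
  next
    case False
    have le: "min r s \<le> max r s" by linarith
    have "regular_time t" if "t \<in> {min r s..max r s}" for t
      using that r False reg [of t] s(3) unfolding seg by (auto simp: c_def d_def min_def max_def split: if_splits)
    from bounded_if_regular_times [OF le this]
    obtain B where B: "\<forall>t\<in>{min r s..max r s}. t \<ge> 0 \<longrightarrow> (\<forall>y\<ge>0. norm (p y t) \<le> B)"
      by blast
    have "norm (p y r) \<le> 2 * (48 * M' + 6 * b * sqrt (1 + T))"
      by (rule propagation [where c = "min r s" and d = "max r s" and s' = s and B = B])
         (use B r s cd y b M's in \<open>auto simp: min_def max_def split: if_splits\<close>)
    then show ?thesis by simp
  qed
  \<comment> \<open>Second pass: the bound just found depends on s through M', but it serves only as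
    the strip bound and leaves no trace in the conclusion. The result is therefore uniform in
    s.\<close>
  show ?thesis
    by (rule propagation [where c = c and d = d and s' = a, OF cd _ bound b M x])
       (auto simp: c_def d_def min_def max_def)
qed

lemma regular_time_all:
  assumes "t \<ge> 0"
  shows "regular_time t"
proof (rule ccontr)
  assume irreg: "\<not> regular_time t"
  define Z where "Z = {t. t \<ge> 0 \<and> \<not> regular_time t}"
  have "open {t. regular_time t}"
  proof (rule openI)
    fix t assume "t \<in> {t. regular_time t}"
    then obtain \<delta> B where \<delta>: "\<delta> > 0" "\<forall>s\<ge>0. \<bar>s - t\<bar> < \<delta> \<longrightarrow> (\<forall>y\<ge>0. norm (p y s) \<le> B)"
      unfolding regular_time_def by blast
    have "regular_time r" if r: "r \<in> ball t (\<delta> / 2)" for r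
      unfolding regular_time_def
    proof (rule exI [of _ "\<delta> / 2"], intro exI [of _ B] conjI allI impI)
      fix s y :: real assume "s \<ge> 0" "\<bar>s - r\<bar> < \<delta> / 2" "y \<ge> 0"
      moreover have "\<bar>t - r\<bar> < \<delta> / 2" using r by (simp add: dist_real_def)
      ultimately have "s \<ge> 0" "y \<ge> 0" "\<bar>s - t\<bar> < \<delta>" by linarith+
      then show "norm (p y s) \<le> B" using \<delta>(2) by blast
    qed (use \<delta>(1) in auto)
    then show "\<exists>e>0. ball t e \<subseteq> {t. regular_time t}"
      using \<delta>(1) by (intro exI[of _ "\<delta> / 2"]) auto
  qed
  then have "closed (- {t. regular_time t})" by (simp add: closed_Compl)
  moreover have "Z = {0..} \<inter> - {t. regular_time t}" by (auto simp: Z_def)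
  ultimately have clZ: "closed Z" by (simp add: closed_Int)
  \<comment> \<open>Level sets of the decay constant. They are closed because each inequality is a
    closed condition on t at fixed y, and they cover \<open>Z\<close> because the constant is finite
    at each time.\<close>
  define A where "A n = {t \<in> Z. \<forall>y\<ge>0. (1 + y)\<^sup>2 * norm (p y t) \<le> real n \<and> (1 + y)\<^sup>2 * norm (p1 y t) \<le> real n}" for n
  have clA: "closed (A n)" for n
  proof -
    have "closed {t \<in> Z. (1 + y)\<^sup>2 * norm (p y t) \<le> real n}" "closed {t \<in> Z. (1 + y)\<^sup>2 * norm (p1 y t) \<le> real n}"
      if "y \<ge> 0" for y
      using that by (intro continuous_on_closed_Collect_le clZ continuous_intros; auto simp: Z_def)+
    moreover have "A n = (\<Inter>y\<in>{0..}. {t \<in> Z. (1 + y)\<^sup>2 * norm (p y t) \<le> real n} \<inter> {t \<in> Z. (1 + y)\<^sup>2 * norm (p1 y t) \<le> real n})"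
      by (auto simp: A_def)
    ultimately show ?thesis by (auto intro!: closed_INT closed_Int)
  qed
  have cover: "\<exists>n. r \<in> A n" if r: "r \<in> Z" for r
  proof -
    have "r \<ge> 0" using r by (simp add: Z_def)
    then obtain M where M: "\<forall>y\<ge>0. (1 + y)\<^sup>2 * norm (p y r) \<le> M \<and> (1 + y)\<^sup>2 * norm (p1 y r) \<le> M"
      using decay by blast
    obtain n where "M \<le> real n" using real_arch_simple by blast
    then have "r \<in> A n" using r M order_trans unfolding A_def by fastforce
    then show ?thesis by blast
  qed
  \<comment> \<open>Otherwise the sets \<open>Z - A n\<close> would be relatively open and dense in
    the closed set \<open>Z\<close>, so their intersection would be dense; it is empty because the
    \<open>A n\<close> cover \<open>Z\<close>. The failure for some n provides a ball around a point
    of \<open>Z\<close> in which all irregular times lie in \<open>A n\<close>.\<close>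
  have "\<not> (\<forall>n. Z \<subseteq> closure (Z - A n))"
  proof
    assume dense: "\<forall>n. Z \<subseteq> closure (Z - A n)"
    have "Z \<subseteq> closure (\<Inter> (range (\<lambda>n. Z - A n)))"
    proof (rule Baire [OF clZ])
      fix S assume "S \<in> range (\<lambda>n. Z - A n)"
      then obtain n where S: "S = Z - A n" by blast
      have "openin (top_of_set Z) (Z \<inter> - A n)"
        using clA by (intro openin_open_Int) (simp add: open_Compl)
      with S dense show "openin (top_of_set Z) S \<and> Z \<subseteq> closure S"
        by (simp add: Diff_eq)
    qed auto
    moreover have "\<Inter> (range (\<lambda>n. Z - A n)) = {}" using cover by blast
    ultimately have "Z = {}" by (simp only: closure_empty subset_empty)
    then show False using irreg assms by (auto simp: Z_def)
  qed
  then obtain n t0 where t0: "t0 \<in> Z" "t0 \<notin> closure (Z - A n)" by blast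
  then obtain \<delta> where \<delta>': "\<delta> > 0" "\<forall>y\<in>Z - A n. \<not> dist y t0 < \<delta>"
    unfolding closure_approachable by blast
  then have \<delta>: "\<delta> > 0" "ball t0 \<delta> \<inter> (Z - A n) = {}"
    by (fastforce simp: dist_commute)+
  define T where "T = t0 + \<delta>"
  have T: "T \<ge> 0" using t0(1) \<delta>(1) by (simp add: T_def Z_def)
  have "compact ((\<lambda>s. p1 0 s) ` {0..T})"
    by (intro compact_continuous_image continuous_intros) auto
  then obtain b where b: "\<And>s. s \<in> {0..T} \<Longrightarrow> norm (p1 0 s) \<le> b"
    using compact_imp_bounded bounded_iff by (metis image_eqI)
  have M: "norm (p y r) \<le> real n" "(1 + y)\<^sup>2 * norm (p1 y r) \<le> real n" if "r \<in> A n" "y \<ge> 0" for r y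
  proof -
    have "norm (p y r) \<le> (1 + y)\<^sup>2 * norm (p y r)"
      using that mult_right_mono [of 1 "(1 + y)\<^sup>2" "norm (p y r)"] by simp
    then show "norm (p y r) \<le> real n" "(1 + y)\<^sup>2 * norm (p1 y r) \<le> real n"
      using that unfolding A_def by force+
  qed
  \<comment> \<open>The first entry bounds \<open>p\<close> at the irregular times of the ball, the
    second at the regular ones, by propagation from a point of \<open>A n\<close>.\<close>
  define K where "K = max (real n) (2 * (48 * real n + 6 * b * sqrt (1 + T)))"
  have "norm (p y s) \<le> K" if s: "s \<ge> 0" "\<bar>s - t0\<bar> < \<delta>" and y: "y \<ge> 0" for s y
  proof (cases "s \<in> Z")
    case True
    moreover have "s \<in> ball t0 \<delta>" using s by (simp add: dist_real_def abs_minus_commute)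
    ultimately have "s \<in> A n" using \<delta>(2) by blast
    then show ?thesis using M(1) y by (simp add: K_def max.coboundedI1)
  next
    case False
    \<comment> \<open>The irregular time a nearest to s on the way to t0: all later points of the
      segment from a to s are regular, and a, lying in the ball, belongs to \<open>A n\<close>, so
      its data are bounded by n whatever s is.\<close>
    have "closed (Z \<inter> closed_segment t0 s)" "Z \<inter> closed_segment t0 s \<noteq> {}"
      using t0(1) ends_in_segment(1) by (auto intro!: closed_Int clZ)
    from distance_attains_inf [OF this, of s]
    obtain a where a: "a \<in> Z \<inter> closed_segment t0 s" "\<And>r. r \<in> Z \<inter> closed_segment t0 s \<Longrightarrow> dist s a \<le> dist s r"
      by blast
    have "a \<in> ball t0 \<delta>"
      using a(1) s by (auto simp: dist_real_def closed_segment_eq_real_ivl split: if_splits)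
    then have aA: "a \<in> A n" using a(1) \<delta>(2) by blast
    have a': "0 \<le> a" "a \<noteq> s" using a(1) False by (auto simp: Z_def)
    have "regular_time r" if r: "r \<in> closed_segment a s" "r \<noteq> a" for r
    proof (rule ccontr)
      assume "\<not> regular_time r"
      moreover have "r \<ge> 0" using r a' s by (auto simp: closed_segment_eq_real_ivl split: if_splits)
      ultimately have "r \<in> Z" by (simp add: Z_def)
      moreover have "r \<in> closed_segment t0 s"
        using r a(1) by (auto simp: closed_segment_eq_real_ivl split: if_splits)
      ultimately have "dist s a \<le> dist s r" using a(2) by blast
      then show False
        using r by (auto simp: dist_real_def closed_segment_eq_real_ivl split: if_splits)
    qed
    moreover have "a \<le> T" "s \<le> T"
      using \<open>a \<in> ball t0 \<delta>\<close> s by (auto simp: T_def dist_real_def)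
    ultimately have "norm (p y s) \<le> 2 * (48 * real n + 6 * b * sqrt (1 + T))"
      using a' s y M aA by (intro propagation_half_open [where a = a] b) auto
    then show ?thesis by (simp add: K_def)
  qed
  then have "regular_time t0" unfolding regular_time_def using \<delta>(1) by blast
  then show False using t0(1) by (simp add: Z_def)
qed

lemma bounded_on_strip:
  assumes "T \<ge> 0"
  shows "\<exists>B. \<forall>y\<ge>0. \<forall>s\<in>{0..T}. norm (p y s) \<le> B"
  using bounded_if_regular_times [OF assms] regular_time_all by (metis atLeastAtMost_iff)

end

section \<open>The Neumann-to-Dirichlet relation\<close>

text \<open>
  The value of this Gaussian integral is irrelevant: the same normalisation occurs for the explicit
  solutions that serve for comparison.
\<close>

definition gauss_mass :: real where
  "gauss_mass = (SUP S\<in>{0..}. integral {0..S} (\<lambda>w. 2 * exp (- w\<^sup>2 / 4)))"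

text \<open>The partial integrals increase and are at most 24 by the uniform bound on kernel
  integrals at z = 1, so they converge to their supremum.\<close>

lemma tendsto_gauss_mass:
  "((\<lambda>S. integral {0..S} (\<lambda>w. 2 * exp (- w\<^sup>2 / 4))) \<longlongrightarrow> gauss_mass) at_top"
  and gauss_mass_pos: "gauss_mass > 0"
proof -
  define G where "G S = integral {0..S} (\<lambda>w :: real. 2 * exp (- w\<^sup>2 / 4))" for S
  have int: "(\<lambda>w :: real. 2 * exp (- w\<^sup>2 / 4)) integrable_on {a..b}" for a b
    by (intro integrable_continuous_interval continuous_intros) auto
  have mono: "G S \<le> G S'" if "S \<le> S'" for S S'
    unfolding G_def using that by (intro integral_subset_le int) auto
  have bdd: "G S \<le> 24" if "S \<ge> 0" for S
  proof -
    have "((\<lambda>w. of_real (2 * exp (- w\<^sup>2 / 4))) has_integral complex_of_real (G S)) {0..S}"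
      using has_integral_linear [OF integrable_integral [OF int] bounded_linear_of_real]
      unfolding o_def G_def .
    moreover have "(\<lambda>w. complex_of_real (2 * exp (- w\<^sup>2 / 4))) = (\<lambda>w. 2 * gauss_kernel (Complex 1 0) w)"
      by (simp add: gauss_kernel_of_real)
    ultimately have "of_real (G S) = integral {0..S} (\<lambda>w. 2 * gauss_kernel (Complex 1 0) w)"
      by (simp only: integral_unique)
    also have "\<dots> = 2 * integral {0..S} (gauss_kernel (Complex 1 0))"
      by simp
    finally have "norm (complex_of_real (G S)) = 2 * norm (integral {0..S} (gauss_kernel (Complex 1 0)))"
      by (simp add: norm_mult)
    also have "\<dots> \<le> 2 * 12"
      using that by (intro mult_left_mono norm_integral_gauss_kernel_le) auto
    finally show ?thesis by simp
  qed
  have bdd': "bdd_above (G ` {0..})"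
    using bdd by (intro bdd_aboveI2 [where M = 24]) auto
  have mass: "gauss_mass = (SUP S\<in>{0..}. G S)"
    by (simp add: gauss_mass_def G_def)
  show "((\<lambda>S. integral {0..S} (\<lambda>w. 2 * exp (- w\<^sup>2 / 4))) \<longlongrightarrow> gauss_mass) at_top"
    unfolding G_def [symmetric]
  proof (rule increasing_tendsto)
    show "eventually (\<lambda>S. G S \<le> gauss_mass) at_top"
      using eventually_ge_at_top [of 0]
      by eventually_elim (auto simp: mass intro!: cSUP_upper bdd')
  next
    fix x assume "x < gauss_mass"
    then obtain S where S: "S \<ge> 0" "x < G S"
      unfolding mass using less_cSUP_iff [OF _ bdd'] by auto
    show "eventually (\<lambda>S. x < G S) at_top"
      using eventually_ge_at_top [of S] by eventually_elim (use S mono in \<open>force intro: less_le_trans\<close>)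
  qed
  have "3 / 2 \<le> G 1"
  proof -
    have "integral {0..1} (\<lambda>_ :: real. 3 / 2) \<le> G 1"
      unfolding G_def
    proof (rule integral_le [OF _ int])
      fix w :: real assume "w \<in> {0..1}"
      then have "w\<^sup>2 \<le> 1" by (simp add: power_le_one)
      then show "3 / 2 \<le> 2 * exp (- w\<^sup>2 / 4)"
        using exp_ge_add_one_self [of "- w\<^sup>2 / 4"] by linarith
    qed auto
    then show ?thesis by simp
  qed
  moreover have "G 1 \<le> gauss_mass"
    unfolding mass by (intro cSUP_upper bdd') auto
  ultimately show "gauss_mass > 0" by linarith
qed

text \<open>The substitution y = sqrt \<epsilon> w removes \<epsilon> from the limit. At x = 0 the
  two images coincide, which is the origin of the factor 2 in \<open>gauss_mass\<close>.\<close>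

lemma tendsto_heat_kernel_mass:
  assumes \<epsilon>: "\<epsilon> > 0"
  shows "((\<lambda>R. integral {0..R} (mirrored (gauss_kernel (Complex \<epsilon> 0)) 0)) \<longlongrightarrow> of_real gauss_mass) at_top"
proof -
  let ?h = "\<lambda>w :: real. 2 * exp (- w\<^sup>2 / 4)"
  have *: "integral {0..R} (mirrored (gauss_kernel (Complex \<epsilon> 0)) 0) = of_real (integral {0..R / sqrt \<epsilon>} ?h)"
    for R
  proof -
    have "?h integrable_on {0..R / sqrt \<epsilon>}"
      by (intro integrable_continuous_interval continuous_intros) auto
    then have "(?h has_integral integral {0..R / sqrt \<epsilon>} ?h) (cbox 0 (R / sqrt \<epsilon>))"
      unfolding cbox_interval by (rule integrable_integral)
    from has_integral_affinity' [OF this, of "1 / sqrt \<epsilon>" 0]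
    have "((\<lambda>y. 2 * exp (- (y / sqrt \<epsilon>)\<^sup>2 / 4)) has_integral integral {0..R / sqrt \<epsilon>} ?h * sqrt \<epsilon>) {0..R}"
      using \<epsilon> by (simp add: mult.commute)
    from has_integral_mult_left [OF this, of "1 / sqrt \<epsilon>"]
    have "((\<lambda>y. 2 * exp (- (y / sqrt \<epsilon>)\<^sup>2 / 4) * (1 / sqrt \<epsilon>)) has_integral integral {0..R / sqrt \<epsilon>} ?h) {0..R}"
      using \<epsilon> by simp
    from has_integral_linear [OF this bounded_linear_of_real]
    have "((\<lambda>y. of_real (2 * exp (- (y / sqrt \<epsilon>)\<^sup>2 / 4) * (1 / sqrt \<epsilon>))) has_integral
        complex_of_real (integral {0..R / sqrt \<epsilon>} ?h)) {0..R}"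
      unfolding o_def .
    moreover have "mirrored (gauss_kernel (Complex \<epsilon> 0)) 0
        = (\<lambda>y. complex_of_real (2 * exp (- (y / sqrt \<epsilon>)\<^sup>2 / 4) * (1 / sqrt \<epsilon>)))"
      using \<epsilon> by (simp add: fun_eq_iff mirrored_def gauss_kernel_of_real power_divide)
    ultimately show ?thesis by (simp only: integral_unique)
  qed
  have "eventually (\<lambda>R. Z \<le> R / sqrt \<epsilon>) at_top" for Z
    using eventually_ge_at_top [of "Z * sqrt \<epsilon>"] by eventually_elim (use \<epsilon> in \<open>simp add: field_simps\<close>)
  then have "filterlim (\<lambda>R. R / sqrt \<epsilon>) at_top at_top"
    by (simp add: filterlim_at_top)
  from filterlim_compose [OF tendsto_gauss_mass this] show ?thesis
    unfolding * by (rule tendsto_of_real)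
qed

lemma has_integral_inverse_sqrt_singular:
  assumes "T \<ge> 0"
  shows "((\<lambda>s. 1 / sqrt (T - s)) has_integral 2 * sqrt T) {0..T}"
proof -
  \<comment> \<open>The primitive is continuous on the closed interval but not differentiable at T,
    so only interior derivatives are used; at s = T the integrand is 0 by the convention 1 / 0 =
    0.\<close>
  have "((\<lambda>s. 1 / sqrt (T - s)) has_integral (- 2 * sqrt (T - T) - - 2 * sqrt (T - 0))) {0..T}"
  proof (rule fundamental_theorem_of_calculus_interior [where f = "\<lambda>s. - 2 * sqrt (T - s)", OF assms])
    fix s assume "s \<in> {0<..<T}"
    then show "((\<lambda>s. - 2 * sqrt (T - s)) has_vector_derivative 1 / sqrt (T - s)) (at s)"
      unfolding has_real_derivative_iff_has_vector_derivative [symmetric]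
      by (auto intro!: derivative_eq_intros simp: field_simps)
  qed (intro continuous_intros)
  then show ?thesis by simp
qed

lemma csqrt_imaginary:
  assumes "r > 0"
  shows "csqrt (Complex 0 r) = csqrt \<i> * of_real (sqrt r)"
proof (rule csqrt_unique)
  have "(csqrt \<i> * complex_of_real (sqrt r))\<^sup>2 = \<i> * of_real ((sqrt r)\<^sup>2)"
    by (simp only: power_mult_distrib power2_csqrt of_real_power)
  then show "(csqrt \<i> * of_real (sqrt r))\<^sup>2 = Complex 0 r"
    using assms by (simp add: complex_eq_iff)
  show "0 < Re (csqrt \<i> * of_real (sqrt r)) \<or>
      Re (csqrt \<i> * of_real (sqrt r)) = 0 \<and> 0 \<le> Im (csqrt \<i> * of_real (sqrt r))"
    using assms by simp
qed

context neumann_evolution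
begin

text \<open>Dominated convergence along \<epsilon> = 1 / (n + 1), with a constant multiple of (T -
  s)^(-1/2) as majorant. At x = 0 and y = 0 the kernel is 2 / csqrt z, and on the positive imaginary
  axis csqrt splits off the factor \<open>csqrt \<i>\<close>.\<close>

lemma boundary_integral_limit:
  assumes T: "T > 0"
  shows "(\<lambda>s. p1 0 s / of_real (sqrt (T - s))) integrable_on {0..T}"
    and "(\<lambda>n. integral {0..T} (\<lambda>s. mirrored (gauss_kernel (Complex (inverse (real (Suc n))) (T - s))) 0 0 * p1 0 s))
      \<longlonglongrightarrow> 2 / csqrt \<i> * integral {0..T} (\<lambda>s. p1 0 s / of_real (sqrt (T - s)))"
proof -
  let ?e = "\<lambda>n. inverse (real (Suc n))"
  let ?f = "\<lambda>n s. mirrored (gauss_kernel (Complex (?e n) (T - s))) 0 0 * p1 0 s"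
  let ?g = "\<lambda>s. 2 / csqrt \<i> * (p1 0 s / of_real (sqrt (T - s)))"
  have "compact ((\<lambda>s. p1 0 s) ` {0..T})"
    by (intro compact_continuous_image continuous_intros) auto
  then obtain b where b: "\<And>s. s \<in> {0..T} \<Longrightarrow> norm (p1 0 s) \<le> b"
    using compact_imp_bounded bounded_iff by (metis image_eqI)
  have f: "?f n integrable_on {0..T}" for n
  proof -
    have "continuous_on {0..T} (\<lambda>s. Complex (?e n) (T - s))"
      unfolding Complex_eq by (intro continuous_intros)
    then show ?thesis
      by (intro integrable_continuous_interval continuous_intros) auto
  qed
  have h: "(\<lambda>s. 3 * b * (1 / sqrt (T - s))) integrable_on {0..T}"
    using has_integral_inverse_sqrt_singular [of T] T by (intro integrable_on_mult_right) auto
  have bound: "norm (?f n s) \<le> 3 * b * (1 / sqrt (T - s))" if s: "s \<in> {0<..<T}" for n s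
  proof -
    have "norm (mirrored (gauss_kernel (Complex (?e n) (T - s))) 0 0) \<le> 3 * (1 / sqrt (?e n + \<bar>T - s\<bar>))"
      by (rule norm_mirrored_gauss_kernel_Complex_le) simp
    also have "\<dots> \<le> 3 * (1 / sqrt (T - s))"
      using s by (intro mult_left_mono frac_le real_sqrt_le_mono) auto
    finally have "norm (mirrored (gauss_kernel (Complex (?e n) (T - s))) 0 0) * norm (p1 0 s) \<le> 3 * (1 / sqrt (T - s)) * b"
      using s b [of s] by (intro mult_mono) auto
    then show ?thesis by (simp add: norm_mult mult_ac)
  qed
  have lim: "(\<lambda>n. ?f n s) \<longlonglongrightarrow> ?g s" if s: "s \<in> {0<..<T}" for s
  proof -
    have "isCont csqrt (Complex 0 (T - s))"
      using s by (intro continuous_at_csqrt) (auto simp: complex_nonpos_Reals_iff)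
    moreover have "(\<lambda>n. Complex (?e n) (T - s)) \<longlonglongrightarrow> Complex 0 (T - s)"
      by (intro tendsto_Complex LIMSEQ_inverse_real_of_nat tendsto_const)
    ultimately have "(\<lambda>n. csqrt (Complex (?e n) (T - s))) \<longlonglongrightarrow> csqrt \<i> * of_real (sqrt (T - s))"
      using isCont_tendsto_compose csqrt_imaginary [of "T - s"] s by fastforce
    then have "(\<lambda>n. 2 / csqrt (Complex (?e n) (T - s)) * p1 0 s) \<longlonglongrightarrow> 2 / (csqrt \<i> * of_real (sqrt (T - s))) * p1 0 s"
      by (rule tendsto_mult_right [OF tendsto_divide [OF tendsto_const]])
         (use s in \<open>simp del: csqrt_ii\<close>)
    then show ?thesis
      by (simp add: mirrored_def gauss_kernel_def del: csqrt_ii)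
  qed
  \<comment> \<open>The open interval leaves out s = T, where the majorant is 0 by convention and
    does not dominate the kernels.\<close>
  have dct: "?g integrable_on {0<..<T}"
    "(\<lambda>n. integral {0<..<T} (?f n)) \<longlonglongrightarrow> integral {0<..<T} ?g"
    using dominated_convergence [of ?f "{0<..<T}" "\<lambda>s. 3 * b * (1 / sqrt (T - s))" ?g] f h bound lim
    by (simp_all only: integrable_on_open_interval_real)
  have gi: "?g integrable_on {0..T}"
    using dct(1) by (simp only: integrable_on_open_interval_real)
  from integrable_on_mult_right [OF this, of "csqrt \<i> / 2"]
  show "(\<lambda>s. p1 0 s / of_real (sqrt (T - s))) integrable_on {0..T}"
    by (simp del: csqrt_ii)
  then have "integral {0..T} ?g = 2 / csqrt \<i> * integral {0..T} (\<lambda>s. p1 0 s / of_real (sqrt (T - s)))"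
    by (intro integral_unique has_integral_mult_right integrable_integral)
  then show "(\<lambda>n. integral {0..T} (?f n)) \<longlonglongrightarrow> 2 / csqrt \<i> * integral {0..T} (\<lambda>s. p1 0 s / of_real (sqrt (T - s)))"
    using dct(2) by (simp only: integral_open_interval_real)
qed

text \<open>At time T the pairing with pole x = 0 tends to \<open>gauss_mass\<close> times the
  boundary value; at time 0 the kernel is at most 2 T^(-1/2). As \<open>gauss_mass\<close> equals 2
  sqrt pi, both terms on the left carry a common factor 2. The strip bound B and the constant M' at
  time T vanish in the limits, so the right side contains the initial value alone.\<close>

lemma dirichlet_value_bound:
  assumes T: "T > 0" and M: "\<And>y. y \<ge> 0 \<Longrightarrow> (1 + y)\<^sup>2 * norm (p y 0) \<le> M"
  shows "norm (of_real gauss_mass * p 0 T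
      + 2 * csqrt \<i> * integral {0..T} (\<lambda>s. p1 0 s / of_real (sqrt (T - s)))) \<le> 2 * M / sqrt T"
proof -
  have M0: "M \<ge> 0" using order_trans [OF norm_ge_zero [of "p 0 0"]] M [of 0] by simp
  obtain B where B: "\<And>y s. y \<ge> 0 \<Longrightarrow> s \<in> {0..T} \<Longrightarrow> norm (p y s) \<le> B"
    using bounded_on_strip [of T] T by fastforce
  obtain M' where M'0: "\<forall>y\<ge>0. (1 + y)\<^sup>2 * norm (p y T) \<le> M' \<and> (1 + y)\<^sup>2 * norm (p1 y T) \<le> M'"
    using decay [of T] T by auto
  have "norm w \<le> (1 + y)\<^sup>2 * norm w" if "y \<ge> 0" for y and w :: complex
    using that mult_right_mono [of 1 "(1 + y)\<^sup>2" "norm w"] by simp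
  then have M': "\<And>y. y \<ge> 0 \<Longrightarrow> norm (p y T) \<le> M'" "\<And>y. y \<ge> 0 \<Longrightarrow> norm (p1 y T) \<le> M'"
    using M'0 order_trans by blast+
  let ?J = "\<lambda>\<epsilon>. integral {0..T} (\<lambda>s. mirrored (gauss_kernel (Complex \<epsilon> (T - s))) 0 0 * p1 0 s)"
  have reg: "norm (of_real gauss_mass * p 0 T + \<i> * ?J \<epsilon>) \<le> 2 * M / sqrt T + 640 * M' * sqrt \<epsilon>"
    if \<epsilon>: "\<epsilon> > 0" for \<epsilon>
  proof -
    let ?I = "\<lambda>R. integral {0..R} (mirrored (gauss_kernel (Complex \<epsilon> 0)) 0)"
    obtain D where D: "\<And>R. R > 0 \<Longrightarrow>
        norm (pairing (Complex \<epsilon> (T - T)) 0 R T - pairing (Complex \<epsilon> (T - 0)) 0 R 0 + \<i> * ?J \<epsilon>) \<le> D / R"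
      using pairing_increment [OF \<epsilon> _ _ B, of 0 T] T by fastforce
    have ev: "norm (?I R * p 0 T + \<i> * ?J \<epsilon>) \<le> 2 * M / sqrt T + 640 * M' * sqrt \<epsilon> + D / R" if R: "R \<ge> 1" for R
    proof -
      let ?A = "pairing (Complex \<epsilon> 0) 0 R T" and ?C = "pairing (Complex \<epsilon> T) 0 R 0"
      have 1: "norm (?A - ?C + \<i> * ?J \<epsilon>) \<le> D / R"
        using D [of R] R by simp
      have 2: "norm (?A - p 0 T * ?I R) \<le> 640 * M' * sqrt \<epsilon>"
        using pairing_approximates_value [OF \<epsilon> _ _ _ R M', of 0] T R by (simp add: cutoff_boundary)
      have "T \<le> norm (Complex \<epsilon> T)" using abs_Im_le_cmod [of "Complex \<epsilon> T"] T by simp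
      then have "2 * M / sqrt (norm (Complex \<epsilon> T)) \<le> 2 * M / sqrt T"
        using T M0 by (intro divide_left_mono real_sqrt_le_mono mult_pos_pos) auto
      moreover have "norm ?C \<le> 2 * M / sqrt (norm (Complex \<epsilon> T))"
        using \<epsilon> R by (intro norm_pairing_le M) auto
      ultimately have 3: "norm ?C \<le> 2 * M / sqrt T" by linarith
      have "?I R * p 0 T + \<i> * ?J \<epsilon> = (?A - ?C + \<i> * ?J \<epsilon>) - (?A - p 0 T * ?I R) + ?C"
        by (simp add: algebra_simps)
      then have "norm (?I R * p 0 T + \<i> * ?J \<epsilon>)
          \<le> norm (?A - ?C + \<i> * ?J \<epsilon>) + norm (?A - p 0 T * ?I R) + norm ?C"
        using norm_triangle_ineq norm_triangle_ineq4 by (smt (verit))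
      with 1 2 3 show ?thesis by linarith
    qed
    have "((\<lambda>R. norm (?I R * p 0 T + \<i> * ?J \<epsilon>)) \<longlongrightarrow> norm (of_real gauss_mass * p 0 T + \<i> * ?J \<epsilon>)) at_top"
      by (intro tendsto_intros tendsto_heat_kernel_mass \<epsilon>)
    moreover have "((\<lambda>R. 2 * M / sqrt T + 640 * M' * sqrt \<epsilon> + D / R)
        \<longlongrightarrow> 2 * M / sqrt T + 640 * M' * sqrt \<epsilon> + 0) at_top"
      by (intro tendsto_intros tendsto_divide_0 [OF tendsto_const] filterlim_at_top_imp_at_infinity filterlim_ident)
    moreover have "eventually (\<lambda>R. norm (?I R * p 0 T + \<i> * ?J \<epsilon>) \<le> 2 * M / sqrt T + 640 * M' * sqrt \<epsilon> + D / R) at_top"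
      using eventually_ge_at_top [of 1] by eventually_elim (rule ev)
    ultimately show ?thesis
      using tendsto_le [OF trivial_limit_at_top_linorder] by fastforce
  qed
  have "(\<lambda>n. norm (of_real gauss_mass * p 0 T + \<i> * ?J (inverse (real (Suc n)))))
      \<longlonglongrightarrow> norm (of_real gauss_mass * p 0 T + \<i> * (2 / csqrt \<i> * integral {0..T} (\<lambda>s. p1 0 s / of_real (sqrt (T - s)))))"
    by (intro tendsto_intros boundary_integral_limit T)
  moreover have "(\<lambda>n. 2 * M / sqrt T + 640 * M' * sqrt (inverse (real (Suc n))))
      \<longlonglongrightarrow> 2 * M / sqrt T + 640 * M' * sqrt 0"
    by (intro tendsto_intros LIMSEQ_inverse_real_of_nat)
  ultimately have "norm (of_real gauss_mass * p 0 T + \<i> * (2 / csqrt \<i> * integral {0..T} (\<lambda>s. p1 0 s / of_real (sqrt (T - s)))))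
      \<le> 2 * M / sqrt T + 640 * M' * sqrt 0"
    by (rule LIMSEQ_le) (use reg in auto)
  moreover have eq: "\<i> * (2 / csqrt \<i>) = 2 * csqrt \<i>"
  proof -
    have "\<i> * (2 / csqrt \<i>) = (csqrt \<i> * csqrt \<i>) * (2 / csqrt \<i>)"
      by (metis power2_csqrt power2_eq_square)
    then show ?thesis by (simp del: csqrt_ii)
  qed
  ultimately show ?thesis
    by (simp only: mult.assoc [symmetric] eq real_sqrt_zero mult_zero_right add_0_right)
qed

end

section \<open>Exponential boundary data\<close>

text \<open>The three functions are the first three y-derivatives of E, which solves the equation
  because the square of sqrt \<mu> is \<mu>. The explicit dependence of the weighted bound on \<mu>
  is needed to sum the errors over all frequencies.\<close>

lemma exponential_mode_evolution:
  fixes \<mu> :: real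
  assumes \<mu>: "\<mu> > 0"
  defines "E \<equiv> \<lambda>y t. exp (\<i> * of_real \<mu> * of_real t - of_real (sqrt \<mu>) * of_real y)"
  shows "neumann_evolution (\<lambda>y t. - of_real (sqrt \<mu>) * E y t) (\<lambda>y t. of_real \<mu> * E y t)
      (\<lambda>y t. - of_real (\<mu> * sqrt \<mu>) * E y t)"
    and "y \<ge> 0 \<Longrightarrow> (1 + y)\<^sup>2 * norm (- of_real (sqrt \<mu>) * E y t) \<le> 2 * sqrt \<mu> + 4 / sqrt \<mu>"
proof -
  define l where "l = sqrt \<mu>"
  have l: "l > 0" "l\<^sup>2 = \<mu>" using \<mu> by (simp_all add: l_def)
  have E_def': "E = (\<lambda>y t. exp (\<i> * of_real \<mu> * of_real t - of_real l * of_real y))"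
    by (simp add: E_def l_def)
  have normE: "norm (E y t) = exp (- (l * y))" for y t
    by (simp add: E_def')
  have decay: "(1 + y)\<^sup>2 * norm (E y t) \<le> 2 + 4 / \<mu>" if "y \<ge> 0" for y t
  proof -
    have "(l * y)\<^sup>2 / 2 \<le> exp (l * y)"
    proof -
      have "0 \<le> 1 + l * y" using l that by simp
      then show ?thesis using exp_lower_Taylor_quadratic [of "l * y"] mult_nonneg_nonneg [of l y] l that by linarith
    qed
    then have 1: "y\<^sup>2 * exp (- (l * y)) \<le> 2 / \<mu>"
      using \<mu> l(2) by (simp add: exp_minus power_mult_distrib field_simps)
    have 2: "exp (- (l * y)) \<le> 1" using l that by simp
    have "(1 + y)\<^sup>2 \<le> 2 + 2 * y\<^sup>2"
      using zero_le_power2 [of "1 - y"] by (simp add: power2_sum power2_diff)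
    then have "(1 + y)\<^sup>2 * exp (- (l * y)) \<le> (2 + 2 * y\<^sup>2) * exp (- (l * y))"
      by (rule mult_right_mono) auto
    also have "\<dots> = 2 * exp (- (l * y)) + 2 * (y\<^sup>2 * exp (- (l * y)))"
      by (simp add: algebra_simps)
    also have "\<dots> \<le> 2 * 1 + 2 * (2 / \<mu>)"
      by (intro add_mono mult_left_mono 1 2) auto
    finally show ?thesis unfolding normE by simp
  qed
  have Ey: "((\<lambda>y. E y t) has_vector_derivative (- of_real l * E y t)) (at y within S)" for y t S
  proof -
    have "((\<lambda>w. exp (\<i> * of_real \<mu> * of_real t - of_real l * w)) has_field_derivative (- of_real l * E y t)) (at (of_real y))"
      unfolding E_def' by (auto intro!: derivative_eq_intros)
    then show ?thesis unfolding E_def' by (rule has_vector_derivative_real_field)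
  qed
  have Et: "((\<lambda>t. E y t) has_vector_derivative (\<i> * of_real \<mu> * E y t)) (at t within S)" for y t S
  proof -
    have "((\<lambda>w. exp (\<i> * of_real \<mu> * w - of_real l * of_real y)) has_field_derivative (\<i> * of_real \<mu> * E y t)) (at (of_real t))"
      unfolding E_def' by (auto intro!: derivative_eq_intros)
    then show ?thesis unfolding E_def' by (rule has_vector_derivative_real_field)
  qed
  have mu: "complex_of_real \<mu> = of_real l * of_real l"
    using l(2) by (simp add: power2_eq_square flip: of_real_mult)
  have cont: "continuous_on S (\<lambda>(y, t). c * E y t)" for c S
    unfolding E_def' split_beta by (intro continuous_intros)
  show "neumann_evolution (\<lambda>y t. - of_real (sqrt \<mu>) * E y t) (\<lambda>y t. of_real \<mu> * E y t)
      (\<lambda>y t. - of_real (\<mu> * sqrt \<mu>) * E y t)"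
    unfolding l_def [symmetric]
  proof
    fix y t :: real
    show "((\<lambda>y. - of_real l * E y t) has_vector_derivative of_real \<mu> * E y t) (at y within {0..})"
      by (rule has_vector_derivative_eq_rhs [OF has_vector_derivative_mult_right [OF Ey]]) (simp add: mu)
    show "((\<lambda>y. of_real \<mu> * E y t) has_vector_derivative - of_real (\<mu> * l) * E y t) (at y within {0..})"
      by (rule has_vector_derivative_eq_rhs [OF has_vector_derivative_mult_right [OF Ey]]) simp
    show "((\<lambda>s. - of_real l * E y s) has_vector_derivative \<i> * (- of_real (\<mu> * l) * E y t)) (at t within {0..})"
      by (rule has_vector_derivative_eq_rhs [OF has_vector_derivative_mult_right [OF Et]]) simp
    have "(1 + y)\<^sup>2 * norm (c * E y t) \<le> norm c * (2 + 4 / \<mu>)" if "y \<ge> 0" for y and c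
      using mult_left_mono [OF decay [OF that, of t], of "norm c"] by (simp add: norm_mult mult_ac)
    then have "\<forall>y\<ge>0. (1 + y)\<^sup>2 * norm (- of_real l * E y t) \<le> max (norm (- complex_of_real l) * (2 + 4 / \<mu>)) (norm (complex_of_real \<mu>) * (2 + 4 / \<mu>))
       \<and> (1 + y)\<^sup>2 * norm (of_real \<mu> * E y t) \<le> max (norm (- complex_of_real l) * (2 + 4 / \<mu>)) (norm (complex_of_real \<mu>) * (2 + 4 / \<mu>))"
      by (metis max.coboundedI1 max.coboundedI2)
    then show "\<exists>M. \<forall>y\<ge>0. (1 + y)\<^sup>2 * norm (- of_real l * E y t) \<le> M \<and> (1 + y)\<^sup>2 * norm (of_real \<mu> * E y t) \<le> M"
      by blast
  qed (intro cont)+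
  assume y: "y \<ge> 0"
  have "(1 + y)\<^sup>2 * norm (- of_real l * E y t) = l * ((1 + y)\<^sup>2 * norm (E y t))"
    using l by (simp add: norm_mult)
  also have "\<dots> \<le> l * (2 + 4 / \<mu>)"
    using l by (intro mult_left_mono decay y) auto
  also have "\<dots> = 2 * l + 4 / l"
    using l(1) unfolding l(2) [symmetric] by (simp add: field_simps power2_eq_square)
  finally show "(1 + y)\<^sup>2 * norm (- of_real (sqrt \<mu>) * E y t) \<le> 2 * sqrt \<mu> + 4 / sqrt \<mu>"
    unfolding l_def .
qed

text \<open>The Dirichlet-to-Neumann multiplier of the frequency \<mu>: it is minus the square root
  of \<mu>, continued from positive to negative \<mu> through the lower half plane.\<close>

definition dtn_symbol :: "real \<Rightarrow> complex" where
  "dtn_symbol \<mu> = (if \<mu> > 0 then - of_real (sqrt \<mu>) else \<i> * of_real (sqrt (- \<mu>)))"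

text \<open>
  Comparison with the decaying solutions \<open>exp (i \<mu> t - sqrt \<mu> x)\<close>, \<open>\<mu> > 0\<close>, evaluates the Abel
  integrals of the exponentials; negative frequencies, whose solutions do not decay in \<open>x\<close>,
  follow by complex conjugation.
\<close>

lemma abel_integral_exponential:
  fixes \<mu> T :: real
  assumes "\<mu> \<noteq> 0" and T: "T > 0"
  shows "(\<lambda>s. exp (\<i> * of_real \<mu> * of_real s) / of_real (sqrt (T - s))) integrable_on {0..T}"
    and "norm (of_real gauss_mass * (dtn_symbol \<mu> * exp (\<i> * of_real \<mu> * of_real T))
       + 2 * csqrt \<i> * (of_real \<mu> * integral {0..T} (\<lambda>s. exp (\<i> * of_real \<mu> * of_real s) / of_real (sqrt (T - s)))))
       \<le> 2 * (2 * sqrt \<bar>\<mu>\<bar> + 4 / sqrt \<bar>\<mu>\<bar>) / sqrt T"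
proof -
  have pos: "(\<lambda>s. exp (\<i> * of_real m * of_real s) / of_real (sqrt (T - s))) integrable_on {0..T} \<and>
    norm (of_real gauss_mass * (- of_real (sqrt m) * exp (\<i> * of_real m * of_real T))
       + 2 * csqrt \<i> * (of_real m * integral {0..T} (\<lambda>s. exp (\<i> * of_real m * of_real s) / of_real (sqrt (T - s)))))
       \<le> 2 * (2 * sqrt m + 4 / sqrt m) / sqrt T"
    if m: "m > 0" for m :: real
  proof -
    let ?E = "\<lambda>y t. exp (\<i> * of_real m * of_real t - of_real (sqrt m) * complex_of_real y)"
    interpret neumann_evolution "\<lambda>y t. - of_real (sqrt m) * ?E y t" "\<lambda>y t. of_real m * ?E y t"
      "\<lambda>y t. - of_real (m * sqrt m) * ?E y t"
      by (rule exponential_mode_evolution [OF m])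
    have "(\<lambda>s. of_real m * ?E 0 s / of_real (sqrt (T - s))) integrable_on {0..T}"
      by (rule boundary_integral_limit [OF T])
    from integrable_on_mult_right [OF this, of "1 / of_real m"]
    have int: "(\<lambda>s. exp (\<i> * of_real m * of_real s) / of_real (sqrt (T - s))) integrable_on {0..T}"
      using m by simp
    have "integral {0..T} (\<lambda>s. of_real m * (exp (\<i> * of_real m * of_real s) / of_real (sqrt (T - s))))
        = of_real m * integral {0..T} (\<lambda>s. exp (\<i> * of_real m * of_real s) / of_real (sqrt (T - s)))"
      by (intro integral_unique has_integral_mult_right integrable_integral int)
    with int dirichlet_value_bound [OF T exponential_mode_evolution(2) [OF m]] show ?thesis
      by (simp del: csqrt_ii)
  qed
  let ?e = "\<lambda>m s. exp (\<i> * complex_of_real m * of_real s) / of_real (sqrt (T - s))"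
  have "?e \<mu> integrable_on {0..T} \<and> norm (of_real gauss_mass * (dtn_symbol \<mu> * exp (\<i> * of_real \<mu> * of_real T))
       + 2 * csqrt \<i> * (of_real \<mu> * integral {0..T} (?e \<mu>))) \<le> 2 * (2 * sqrt \<bar>\<mu>\<bar> + 4 / sqrt \<bar>\<mu>\<bar>) / sqrt T"
  proof (cases "\<mu> > 0")
    case True
    then show ?thesis using pos [of \<mu>] by (simp add: dtn_symbol_def del: csqrt_ii)
  next
    case False
    define m where "m = - \<mu>"
    have m: "m > 0" "\<mu> = - m" using False assms by (auto simp: m_def)
    have cnj_e: "(\<lambda>s. cnj (?e m s)) = ?e \<mu>"
      by (simp add: fun_eq_iff m(2) exp_cnj)
    have "(?e m has_integral integral {0..T} (?e m)) {0..T}"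
      using pos [OF m(1)] by (intro integrable_integral) blast
    then have "(?e \<mu> has_integral cnj (integral {0..T} (?e m))) {0..T}"
      using has_integral_linear [OF _ bounded_linear_cnj] unfolding o_def cnj_e [symmetric] by blast
    then have int: "?e \<mu> integrable_on {0..T}" "integral {0..T} (?e \<mu>) = cnj (integral {0..T} (?e m))"
      by (auto simp: integral_unique)
    \<comment> \<open>Conjugating the estimate for m = -\<mu> replaces \<open>csqrt \<i>\<close> by
      its conjugate. Multiplication by -i restores it up to sign, the sign accounts for \<mu> = -m,
      and -sqrt m becomes i sqrt m, the symbol at \<mu>.\<close>
    have ii: "- \<i> * cnj (csqrt \<i>) = - csqrt \<i>"
      by (simp add: complex_eq_iff)
    have "of_real gauss_mass * (dtn_symbol \<mu> * exp (\<i> * of_real \<mu> * of_real T)) + 2 * csqrt \<i> * (of_real \<mu> * integral {0..T} (?e \<mu>))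
      = - \<i> * (of_real gauss_mass * (- of_real (sqrt m) * exp (\<i> * of_real \<mu> * of_real T)))
        + 2 * (- csqrt \<i>) * (of_real m * integral {0..T} (?e \<mu>))"
      using m by (simp add: dtn_symbol_def del: csqrt_ii)
    also have "\<dots> = - \<i> * cnj (of_real gauss_mass * (- of_real (sqrt m) * exp (\<i> * of_real m * of_real T))
        + 2 * csqrt \<i> * (of_real m * integral {0..T} (?e m)))"
      unfolding int(2) ii [symmetric] using m(2) by (simp add: exp_cnj algebra_simps del: csqrt_ii)
    finally have "norm (of_real gauss_mass * (dtn_symbol \<mu> * exp (\<i> * of_real \<mu> * of_real T)) + 2 * csqrt \<i> * (of_real \<mu> * integral {0..T} (?e \<mu>)))
       = norm (of_real gauss_mass * (- of_real (sqrt m) * exp (\<i> * of_real m * of_real T))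
        + 2 * csqrt \<i> * (of_real m * integral {0..T} (?e m)))"
      by (simp only: norm_mult norm_minus_cancel norm_ii mult_1 complex_mod_cnj)
    with pos [OF m(1)] int(1) m show ?thesis by (simp del: csqrt_ii)
  qed
  then show "(\<lambda>s. exp (\<i> * of_real \<mu> * of_real s) / of_real (sqrt (T - s))) integrable_on {0..T}"
    and "norm (of_real gauss_mass * (dtn_symbol \<mu> * exp (\<i> * of_real \<mu> * of_real T))
       + 2 * csqrt \<i> * (of_real \<mu> * integral {0..T} (\<lambda>s. exp (\<i> * of_real \<mu> * of_real s) / of_real (sqrt (T - s)))))
       \<le> 2 * (2 * sqrt \<bar>\<mu>\<bar> + 4 / sqrt \<bar>\<mu>\<bar>) / sqrt T"
    by blast+
qed

text \<open>For s \<le> T / 2 the singular factor is at most sqrt 2 / sqrt T, for larger s the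
  weight is at most (1 + T / 2)^(-2). Adding the two majorants avoids splitting the integral. The
  second contributes at most T^(-1/2) because 2 T \<le> (1 + T / 2)^2.\<close>

lemma abel_integral_inverse_square_le:
  assumes T: "T > 0"
  shows "(\<lambda>s. sqrt 2 / sqrt T * (1 / (1 + s)\<^sup>2) + 1 / (1 + T / 2)\<^sup>2 * (1 / sqrt (T - s))) integrable_on {0..T}" (is "?h integrable_on _")
    and "integral {0..T} (\<lambda>s. sqrt 2 / sqrt T * (1 / (1 + s)\<^sup>2) + 1 / (1 + T / 2)\<^sup>2 * (1 / sqrt (T - s))) \<le> 3 / sqrt T"
    and "s \<in> {0..T} \<Longrightarrow> 1 / (1 + s)\<^sup>2 * (1 / sqrt (T - s))
       \<le> sqrt 2 / sqrt T * (1 / (1 + s)\<^sup>2) + 1 / (1 + T / 2)\<^sup>2 * (1 / sqrt (T - s))"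
proof -
  have hi: "(?h has_integral (sqrt 2 / sqrt T * (1 - 1 / (1 + T)) + 1 / (1 + T / 2)\<^sup>2 * (2 * sqrt T))) {0..T}"
    using T by (intro has_integral_add has_integral_mult_right has_integral_inverse_square has_integral_inverse_sqrt_singular) auto
  then show "?h integrable_on {0..T}" by blast
  have "sqrt 2 / sqrt T * (1 - 1 / (1 + T)) \<le> 2 / sqrt T * 1"
    using T sqrt2_less_2 by (intro mult_mono divide_right_mono) auto
  moreover have "1 / (1 + T / 2)\<^sup>2 * (2 * sqrt T) \<le> 1 / sqrt T"
  proof -
    have "2 * T \<le> (1 + T / 2)\<^sup>2"
      using zero_le_power2 [of "1 - T / 2"] by (simp add: power2_sum power2_diff)
    then have "2 * (sqrt T * sqrt T) \<le> (1 + T / 2)\<^sup>2" using T by simp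
    moreover have "(1 + T / 2)\<^sup>2 > 0" using T by (simp add: add_pos_pos)
    moreover have "1 / A * (2 * r) \<le> 1 / r" if "2 * (r * r) \<le> A" "A > 0" "r > 0" for A r :: real
      using that by (simp add: field_simps)
    ultimately show ?thesis using T by simp
  qed
  ultimately show "integral {0..T} ?h \<le> 3 / sqrt T"
    unfolding integral_unique [OF hi] by (simp add: add_divide_distrib [symmetric] algebra_simps)
  assume s: "s \<in> {0..T}"
  show "1 / (1 + s)\<^sup>2 * (1 / sqrt (T - s)) \<le> ?h s"
  proof (cases "s \<le> T / 2")
    case True
    have "sqrt T \<le> sqrt (2 * (T - s))" using True by (intro real_sqrt_le_mono) auto
    then have "sqrt T \<le> sqrt 2 * sqrt (T - s)" by (simp only: real_sqrt_mult)
    then have "1 / sqrt (T - s) \<le> sqrt 2 / sqrt T"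
      using True T by (simp add: field_simps)
    then have "1 / (1 + s)\<^sup>2 * (1 / sqrt (T - s)) \<le> 1 / (1 + s)\<^sup>2 * (sqrt 2 / sqrt T)"
      by (rule mult_left_mono) auto
    moreover have "0 \<le> 1 / (1 + T / 2)\<^sup>2 * (1 / sqrt (T - s))" using s by simp
    ultimately show ?thesis by (simp only: mult.commute)
  next
    case False
    then have "1 / (1 + s)\<^sup>2 \<le> 1 / (1 + T / 2)\<^sup>2"
      using T by (intro divide_left_mono power_mono mult_pos_pos zero_less_power) auto
    then have "1 / (1 + s)\<^sup>2 * (1 / sqrt (T - s)) \<le> 1 / (1 + T / 2)\<^sup>2 * (1 / sqrt (T - s))"
      using s by (intro mult_right_mono) auto
    moreover have "0 \<le> sqrt 2 / sqrt T * (1 / (1 + s)\<^sup>2)" using T by simp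
    ultimately show ?thesis by linarith
  qed
qed

section \<open>Fourier series of smooth periodic functions\<close>

definition harmonic :: "real \<Rightarrow> int \<Rightarrow> real \<Rightarrow> complex" where
  "harmonic \<omega> n t = exp (\<i> * of_real (of_int n * \<omega>) * of_real t)"

lemma harmonic_0 [simp]: "harmonic \<omega> 0 t = 1"
  by (simp add: harmonic_def)

lemma norm_harmonic [simp]: "norm (harmonic \<omega> n t) = 1"
  by (simp add: harmonic_def)

lemma harmonic_mult: "harmonic \<omega> m t * harmonic \<omega> n t = harmonic \<omega> (m + n) t"
  by (simp add: harmonic_def algebra_simps flip: exp_add)

lemma harmonic_has_vector_derivative:
  "(harmonic \<omega> n has_vector_derivative \<i> * of_real (of_int n * \<omega>) * harmonic \<omega> n t) (at t within S)"
proof -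
  have "((\<lambda>w. exp (\<i> * of_real (of_int n * \<omega>) * w)) has_field_derivative
      \<i> * of_real (of_int n * \<omega>) * harmonic \<omega> n t) (at (of_real t))"
    by (auto intro!: derivative_eq_intros simp: harmonic_def)
  then show ?thesis
    unfolding harmonic_def [abs_def] by (rule has_vector_derivative_real_field)
qed

lemma continuous_on_harmonic [continuous_intros]: "continuous_on S (harmonic \<omega> n)"
  by (rule continuous_on_vector_derivative) (rule harmonic_has_vector_derivative)

lemma harmonic_period:
  assumes "\<omega> > 0"
  shows "harmonic \<omega> n (t + 2 * pi / \<omega>) = harmonic \<omega> n t"
proof -
  have "harmonic \<omega> n (t + 2 * pi / \<omega>) = harmonic \<omega> n t * exp ((2 * of_int n * of_real pi) * \<i>)"
    using assms by (simp add: harmonic_def algebra_simps flip: exp_add)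
  moreover have "exp (complex_of_real (2 * of_int n * pi) * \<i>) = 1"
    by (rule exp_integer_2pi) simp
  then have "exp ((2 * of_int n * of_real pi) * \<i>) = (1 :: complex)"
    by simp
  ultimately show ?thesis by simp
qed

lemma has_integral_harmonic:
  assumes \<omega>: "\<omega> > 0"
  shows "(harmonic \<omega> n has_integral (if n = 0 then of_real (2 * pi / \<omega>) else 0)) {0..2 * pi / \<omega>}"
proof (cases "n = 0")
  case True
  then show ?thesis
    using \<omega> has_integral_const_real [of "1 :: complex" 0 "2 * pi / \<omega>"]
    by (simp add: harmonic_def [abs_def] scaleR_conv_of_real)
next
  case False
  let ?c = "\<i> * complex_of_real (of_int n * \<omega>)"
  have c: "?c \<noteq> 0" using False \<omega> by simp
  have "((\<lambda>t. harmonic \<omega> n t) has_integral (harmonic \<omega> n (2 * pi / \<omega>) / ?c - harmonic \<omega> n 0 / ?c)) {0..2 * pi / \<omega>}"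
  proof (rule fundamental_theorem_of_calculus [where f = "\<lambda>t. harmonic \<omega> n t / ?c"])
    fix t
    show "((\<lambda>t. harmonic \<omega> n t / ?c) has_vector_derivative harmonic \<omega> n t) (at t within {0..2 * pi / \<omega>})"
      by (rule has_vector_derivative_eq_rhs [OF has_vector_derivative_divide [OF harmonic_has_vector_derivative]])
         (use c in simp)
  qed (use \<omega> in auto)
  then show ?thesis
    using False harmonic_period [OF \<omega>, of n 0] by simp
qed

section \<open>Termwise integration and differentiation of absolutely convergent series\<close>

lemma norm_has_sum_diff_sum_le:
  fixes f :: "'i \<Rightarrow> complex"
  assumes "(f has_sum s) UNIV" "(w has_sum W) UNIV" "\<And>n. norm (f n) \<le> w n" "finite X"
  shows "norm (s - sum f X) \<le> W - sum w X"
proof -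
  have "(f has_sum (s - sum f X)) (UNIV - X)" "(w has_sum (W - sum w X)) (UNIV - X)"
    using assms by (auto intro!: has_sum_Diff has_sum_finite)
  then show ?thesis
    by (rule norm_infsum_le) (rule assms)
qed

lemma eventually_has_sum_tail_less:
  fixes w :: "'i \<Rightarrow> real"
  assumes "(w has_sum W) UNIV" "e > 0"
  shows "eventually (\<lambda>X. finite X \<and> W - sum w X < e) (finite_subsets_at_top UNIV)"
proof -
  have "eventually (\<lambda>X. dist (sum w X) W < e) (finite_subsets_at_top UNIV)"
    using assms unfolding has_sum_def tendsto_iff by blast
  moreover have "eventually finite (finite_subsets_at_top (UNIV :: 'i set))"
    by (rule eventually_finite_subsets_at_top_weakI) simp
  ultimately show ?thesis
    by eventually_elim (auto simp: dist_real_def)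
qed

text \<open>Absolute summability makes the finite partial sums converge uniformly over a period, so
  integrals pass to the limit; by orthogonality the integral is constant as soon as the finite index
  set contains m.\<close>

lemma fourier_coefficient:
  fixes a :: "int \<Rightarrow> complex"
  assumes \<omega>: "\<omega> > 0" and g: "\<And>t. ((\<lambda>n. a n * harmonic \<omega> n t) has_sum g t) UNIV"
    and a: "((\<lambda>n. norm (a n)) has_sum W) UNIV"
  shows "((\<lambda>t. g t * harmonic \<omega> (- m) t) has_integral of_real (2 * pi / \<omega>) * a m) {0..2 * pi / \<omega>}"
proof -
  let ?S = "\<lambda>X t. (\<Sum>n\<in>X. a n * harmonic \<omega> n t) * harmonic \<omega> (- m) t"
  let ?F = "finite_subsets_at_top (UNIV :: int set)"
  let ?T = "2 * pi / \<omega>"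
  have "uniform_limit {0..?T} ?S (\<lambda>t. g t * harmonic \<omega> (- m) t) ?F"
    unfolding uniform_limit_iff
  proof (intro allI impI)
    fix e :: real assume "e > 0"
    from eventually_has_sum_tail_less [OF a this]
    show "eventually (\<lambda>X. \<forall>t\<in>{0..?T}. dist (?S X t) (g t * harmonic \<omega> (- m) t) < e) ?F"
    proof eventually_elim
      case (elim X)
      show ?case
      proof
        fix t
        have "dist (?S X t) (g t * harmonic \<omega> (- m) t) = norm (g t - (\<Sum>n\<in>X. a n * harmonic \<omega> n t))"
          by (simp add: dist_norm norm_minus_commute norm_mult flip: left_diff_distrib)
        also have "\<dots> \<le> W - (\<Sum>n\<in>X. norm (a n))"
          using elim by (intro norm_has_sum_diff_sum_le [OF g a]) (auto simp: norm_mult)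
        finally show "dist (?S X t) (g t * harmonic \<omega> (- m) t) < e" using elim by linarith
      qed
    qed
  qed
  moreover have "continuous_on {0..?T} (?S X)" for X
    by (intro continuous_intros)
  ultimately obtain I J where IJ: "\<And>X. (?S X has_integral I X) {0..?T}"
    "((\<lambda>t. g t * harmonic \<omega> (- m) t) has_integral J) {0..?T}" "(I \<longlongrightarrow> J) ?F"
    by (rule uniform_limit_integral) (auto simp: finite_subsets_at_top_neq_bot)
  have "I X = of_real ?T * a m" if "finite X" "m \<in> X" for X
  proof -
    have "((\<lambda>t. \<Sum>n\<in>X. a n * harmonic \<omega> (n - m) t) has_integral
        (\<Sum>n\<in>X. a n * (if n - m = 0 then of_real ?T else 0))) {0..?T}"
      by (intro has_integral_sum has_integral_mult_right has_integral_harmonic \<omega> that)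
    moreover have "(\<lambda>t. \<Sum>n\<in>X. a n * harmonic \<omega> (n - m) t) = ?S X"
      by (simp add: fun_eq_iff sum_distrib_right mult.assoc harmonic_mult)
    moreover have "(\<Sum>n\<in>X. a n * (if n - m = 0 then of_real ?T else 0)) = (\<Sum>n\<in>X. if n = m then a m * of_real ?T else 0)"
      by (rule sum.cong) auto
    ultimately show ?thesis
      using has_integral_unique [OF IJ(1) [of X]] that by (simp add: mult.commute)
  qed
  then have "eventually (\<lambda>X. I X = of_real ?T * a m) ?F"
    unfolding eventually_finite_subsets_at_top by (intro exI [of _ "{m}"]) auto
  then have "(I \<longlongrightarrow> of_real ?T * a m) ?F"
    by (rule tendsto_eventually)
  then have "J = of_real ?T * a m"
    using tendsto_unique [OF _ IJ(3)] finite_subsets_at_top_neq_bot by blast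
  with IJ(2) show ?thesis by simp
qed

lemma integral_deriv_mult_harmonic:
  assumes \<omega>: "\<omega> > 0" and G: "\<And>t. (G has_vector_derivative G' t) (at t)"
    and per: "\<And>t. G (t + 2 * pi / \<omega>) = G t"
    and I: "((\<lambda>t. G t * harmonic \<omega> (- m) t) has_integral I) {0..2 * pi / \<omega>}"
  shows "((\<lambda>t. G' t * harmonic \<omega> (- m) t) has_integral \<i> * of_real (of_int m * \<omega>) * I) {0..2 * pi / \<omega>}"
proof -
  let ?T = "2 * pi / \<omega>" and ?h = "harmonic \<omega> (- m)"
  let ?c = "\<i> * complex_of_real (of_int m * \<omega>)"
  have "((\<lambda>t. G' t * ?h t - ?c * (G t * ?h t)) has_integral (G ?T * ?h ?T - G 0 * ?h 0)) {0..?T}"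
  proof (rule fundamental_theorem_of_calculus [where f = "\<lambda>t. G t * ?h t"])
    fix t
    show "((\<lambda>t. G t * ?h t) has_vector_derivative G' t * ?h t - ?c * (G t * ?h t)) (at t within {0..?T})"
      by (rule has_vector_derivative_eq_rhs [OF has_vector_derivative_mult
            [OF has_vector_derivative_at_within [OF G] harmonic_has_vector_derivative]])
         simp
  qed (use \<omega> in auto)
  moreover have "G ?T * ?h ?T - G 0 * ?h 0 = 0"
    using per [of 0] harmonic_period [OF \<omega>, of "- m" 0] by simp
  ultimately have "((\<lambda>t. (G' t * ?h t - ?c * (G t * ?h t)) + ?c * (G t * ?h t)) has_integral (0 + ?c * I)) {0..?T}"
    by (intro has_integral_add has_integral_mult_right I) simp
  then show ?thesis by simp
qed

lemma smooth_periodic_derivatives: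
  assumes "smooth_within UNIV g" and per: "\<And>t. g (t + T) = g t"
  shows "((deriv_within UNIV ^^ k) g has_vector_derivative (deriv_within UNIV ^^ Suc k) g t) (at t)"
    and "(deriv_within UNIV ^^ k) g (t + T) = (deriv_within UNIV ^^ k) g t"
proof -
  have D: "((deriv_within UNIV ^^ k) g has_vector_derivative (deriv_within UNIV ^^ Suc k) g t) (at t)" for k t
    using assms(1) unfolding smooth_within_def
    by (simp add: deriv_within_def vector_derivative_works)
  then show "((deriv_within UNIV ^^ k) g has_vector_derivative (deriv_within UNIV ^^ Suc k) g t) (at t)" .
  show "(deriv_within UNIV ^^ k) g (t + T) = (deriv_within UNIV ^^ k) g t"
  proof (induction k arbitrary: t)
    case 0
    then show ?case by (simp add: per)
  next
    case (Suc k)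
    have "((\<lambda>s. s + T) has_vector_derivative 1) (at t)"
      by (rule has_vector_derivative_eq_rhs, rule derivative_intros | simp)+
    from vector_diff_chain_at [OF this D]
    have "((\<lambda>s. (deriv_within UNIV ^^ k) g (s + T)) has_vector_derivative (deriv_within UNIV ^^ Suc k) g (t + T)) (at t)"
      by (simp add: o_def)
    from vector_derivative_unique_at [OF D this [unfolded Suc.IH]] show ?case
      by (rule sym)
  qed
qed

lemma summable_on_inverse_square_int: "(\<lambda>n :: int. inverse ((of_int n)\<^sup>2) :: real) summable_on UNIV"
proof -
  have "(\<lambda>n :: nat. inverse ((real n)\<^sup>2)) summable_on UNIV"
    using inverse_power_summable [of 2, where 'a = real] by (intro summable_nonneg_imp_summable_on) auto
  then have "(\<lambda>n :: int. inverse ((of_int n)\<^sup>2) :: real) summable_on range int"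
    "(\<lambda>n :: int. inverse ((of_int n)\<^sup>2) :: real) summable_on range (\<lambda>n. - int n)"
    by (subst summable_on_reindex; simp add: inj_on_def o_def)+
  then have "(\<lambda>n :: int. inverse ((of_int n)\<^sup>2) :: real) summable_on (range int \<union> range (\<lambda>n. - int n))"
    by (rule summable_on_union)
  moreover have "range int \<union> range (\<lambda>n. - int n) = UNIV"
    by (metis (no_types, lifting) UNIV_eq_I UnCI int_cases2 rangeI)
  ultimately show ?thesis by simp
qed

text \<open>Three integrations by parts over a period bound |n|^3 |a_n|, so |n| |a_n| is dominated
  by a multiple of n^(-2). The weight |n| serves both the derivative of the series and the errors of
  the single modes.\<close>

lemma fourier_coefficients_summable:
  fixes a :: "int \<Rightarrow> complex"
  assumes \<omega>: "\<omega> > 0" and smooth: "smooth_within UNIV g" and per: "\<And>t. g (t + 2 * pi / \<omega>) = g t"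
    and g: "\<And>t. ((\<lambda>n. a n * harmonic \<omega> n t) has_sum g t) UNIV"
  shows "(\<lambda>n. real_of_int \<bar>n\<bar> * norm (a n)) summable_on UNIV"
proof -
  let ?T = "2 * pi / \<omega>"
  let ?D = "\<lambda>k. (deriv_within UNIV ^^ k) g"
  \<comment> \<open>At t = 0 all harmonics equal 1, and unconditional summability of complex numbers
    is absolute. This is what permits identifying the a_n as Fourier coefficients.\<close>
  have "a summable_on UNIV"
    using g [of 0] by (auto simp: harmonic_def summable_on_def)
  then have "(\<lambda>n. norm (a n)) summable_on UNIV"
    by (simp add: summable_on_iff_abs_summable_on_complex)
  then obtain W where W: "((\<lambda>n. norm (a n)) has_sum W) UNIV"
    by (auto simp: summable_on_def)
  note deriv = smooth_periodic_derivatives [OF smooth per]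
  have coeff: "((\<lambda>t. ?D k t * harmonic \<omega> (- m) t) has_integral
      (\<i> * of_real (of_int m * \<omega>)) ^ k * (of_real ?T * a m)) {0..?T}" for k m
  proof (induction k)
    case 0
    then show ?case using fourier_coefficient [OF \<omega> g W, of m] by simp
  next
    case (Suc k)
    from integral_deriv_mult_harmonic [OF \<omega> deriv Suc.IH] show ?case by (simp add: mult.assoc)
  qed
  have "continuous_on {0..?T} (?D 3)"
    using has_vector_derivative_at_within [OF deriv(1)] by (rule continuous_on_vector_derivative)
  then have "bounded (?D 3 ` {0..?T})"
    by (intro compact_imp_bounded compact_continuous_image) auto
  then obtain C where C: "\<And>t. t \<in> {0..?T} \<Longrightarrow> norm (?D 3 t) \<le> C"
    unfolding bounded_iff by blast
  have C0: "C \<ge> 0" using order_trans [OF norm_ge_zero C [of 0]] \<omega> by simp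
  have bound: "real_of_int \<bar>n\<bar> * norm (a n) \<le> C / \<omega> ^ 3 * inverse ((of_int n)\<^sup>2)" for n
  proof (cases "n = 0")
    case False
    have "norm ((\<i> * of_real (of_int n * \<omega>)) ^ 3 * (of_real ?T * a n)) \<le> C * Henstock_Kurzweil_Integration.content {0..?T}"
      by (rule has_integral_bound_real [OF C0 finite.emptyI coeff]) (use C in \<open>simp add: norm_mult\<close>)
    moreover have "\<bar>?T\<bar> = ?T" "\<bar>\<omega>\<bar> = \<omega>" using \<omega> by auto
    then have "norm ((\<i> * of_real (of_int n * \<omega>)) ^ 3 * (of_real ?T * a n)) = (\<bar>real_of_int n\<bar> * \<omega>) ^ 3 * norm (a n) * ?T"
      by (simp only: norm_mult norm_power norm_ii norm_of_real abs_mult mult_1 mult_ac)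
    moreover have "Henstock_Kurzweil_Integration.content {0..?T} = ?T" using \<omega> by simp
    ultimately have "(\<bar>real_of_int n\<bar> * \<omega>) ^ 3 * norm (a n) * ?T \<le> C * ?T"
      by simp
    then have "(\<bar>real_of_int n\<bar> * \<omega>) ^ 3 * norm (a n) \<le> C"
      using \<omega> by (subst (asm) mult_le_cancel_right) auto
    then have *: "\<bar>real_of_int n\<bar> ^ 3 * norm (a n) \<le> C / \<omega> ^ 3"
      using \<omega> by (simp add: power_mult_distrib field_simps)
    have "real_of_int \<bar>n\<bar> * norm (a n) = \<bar>real_of_int n\<bar> ^ 3 * norm (a n) * inverse ((of_int n)\<^sup>2)"
      using False by (simp add: power3_eq_cube power2_eq_square field_simps)
    also have "\<dots> \<le> C / \<omega> ^ 3 * inverse ((of_int n)\<^sup>2)"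
      by (intro mult_right_mono *) simp
    finally show ?thesis .
  qed simp
  have "(\<lambda>n :: int. C / \<omega> ^ 3 * inverse ((of_int n)\<^sup>2)) summable_on UNIV"
    by (intro summable_on_cmult_right summable_on_inverse_square_int)
  then show ?thesis
    by (rule summable_on_comparison_test) (use bound in auto)
qed

lemma fourier_series_has_vector_derivative:
  fixes a :: "int \<Rightarrow> complex"
  assumes \<omega>: "\<omega> > 0" and g: "\<And>t. ((\<lambda>n. a n * harmonic \<omega> n t) has_sum g t) UNIV"
    and a: "(\<lambda>n. real_of_int \<bar>n\<bar> * norm (a n)) summable_on UNIV"
  defines "g' \<equiv> \<lambda>t. \<Sum>\<^sub>\<infinity>n. \<i> * of_real (of_int n * \<omega>) * a n * harmonic \<omega> n t"
  shows "(g has_vector_derivative g' t) (at t)"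
    and "((\<lambda>n. \<i> * of_real (of_int n * \<omega>) * a n * harmonic \<omega> n t) has_sum g' t) UNIV"
proof -
  let ?d = "\<lambda>n t. \<i> * complex_of_real (of_int n * \<omega>) * a n * harmonic \<omega> n t"
  let ?w = "\<lambda>n. \<omega> * (real_of_int \<bar>n\<bar> * norm (a n))"
  have nd: "norm (?d n t) = ?w n" for n t
    using \<omega> by (simp add: norm_mult abs_mult)
  have w: "?w summable_on UNIV"
    by (intro summable_on_cmult_right a)
  then obtain W where W: "(?w has_sum W) UNIV" by (auto simp: summable_on_def)
  have hs: "((\<lambda>n. ?d n t) has_sum g' t) UNIV" for t
    unfolding g'_def
  proof (rule has_sum_infsum)
    show "(\<lambda>n. ?d n t) summable_on UNIV"
      unfolding summable_on_iff_abs_summable_on_complex nd by (rule w)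
  qed
  show "((\<lambda>n. ?d n t) has_sum g' t) UNIV" by (rule hs)
  \<comment> \<open>Symmetric partial sums form a sequence cofinal in the finite subsets of the
    integers, which brings the net of partial sums within reach of the theorem on derivatives of
    sequences.\<close>
  define X where "X N = {- int N..int N}" for N
  have X: "filterlim X (finite_subsets_at_top UNIV) sequentially"
    unfolding filterlim_finite_subsets_at_top
  proof (intro allI impI)
    fix Y :: "int set" assume "finite Y \<and> Y \<subseteq> UNIV"
    then have "finite ((\<lambda>n. nat \<bar>n\<bar>) ` Y)" by blast
    then obtain N0 where "\<forall>k\<in>(\<lambda>n. nat \<bar>n\<bar>) ` Y. k \<le> N0"
      using finite_nat_set_iff_bounded_le by blast
    then have Y: "Y \<subseteq> X N" if "N \<ge> N0" for N
      using that by (fastforce simp: X_def)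
    have fin: "finite (X N)" for N by (simp add: X_def)
    show "eventually (\<lambda>N. finite (X N) \<and> Y \<subseteq> X N \<and> X N \<subseteq> UNIV) sequentially"
      using eventually_ge_at_top [of N0] by eventually_elim (use Y fin in blast)
  qed
  have "\<exists>G. \<forall>t\<in>UNIV. (\<lambda>N. \<Sum>n\<in>X N. a n * harmonic \<omega> n t) \<longlonglongrightarrow> G t
      \<and> (G has_derivative (\<lambda>h. h *\<^sub>R g' t)) (at t within UNIV)"
  proof (rule has_derivative_sequence [where f' = "\<lambda>N t h. h *\<^sub>R (\<Sum>n\<in>X N. ?d n t)"])
    fix N and t :: real
    have "((\<lambda>t. \<Sum>n\<in>X N. a n * harmonic \<omega> n t) has_vector_derivative (\<Sum>n\<in>X N. ?d n t)) (at t within UNIV)"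
      by (rule has_vector_derivative_eq_rhs, rule has_vector_derivative_sum,
          rule has_vector_derivative_mult_right, rule harmonic_has_vector_derivative)
         (simp add: mult_ac)
    then show "((\<lambda>t. \<Sum>n\<in>X N. a n * harmonic \<omega> n t) has_derivative (\<lambda>h. h *\<^sub>R (\<Sum>n\<in>X N. ?d n t))) (at t within UNIV)"
      by (simp add: has_vector_derivative_def)
  next
    fix e :: real assume "e > 0"
    from filterlim_iff [THEN iffD1, OF X, rule_format, OF eventually_has_sum_tail_less [OF W this]]
    show "eventually (\<lambda>N. \<forall>t\<in>UNIV. \<forall>h. norm (h *\<^sub>R (\<Sum>n\<in>X N. ?d n t) - h *\<^sub>R g' t) \<le> e * norm h) sequentially"
    proof eventually_elim
      case (elim N)
      show ?case
      proof (intro ballI allI)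
        fix t h :: real
        have "norm (g' t - (\<Sum>n\<in>X N. ?d n t)) \<le> W - sum ?w (X N)"
          using elim by (intro norm_has_sum_diff_sum_le [OF hs W]) (simp_all only: nd order_refl)
        then have "norm (g' t - (\<Sum>n\<in>X N. ?d n t)) \<le> e" using elim by linarith
        then have "\<bar>h\<bar> * norm ((\<Sum>n\<in>X N. ?d n t) - g' t) \<le> \<bar>h\<bar> * e"
          by (intro mult_left_mono) (auto simp: norm_minus_commute)
        then show "norm (h *\<^sub>R (\<Sum>n\<in>X N. ?d n t) - h *\<^sub>R g' t) \<le> e * norm h"
          by (simp add: mult.commute flip: scaleR_diff_right)
      qed
    qed
  next
    show "(\<lambda>N. \<Sum>n\<in>X N. a n * harmonic \<omega> n 0) \<longlonglongrightarrow> g 0"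
      using filterlim_compose [OF g [unfolded has_sum_def] X] .
  qed auto
  then obtain G where G: "\<And>t. (\<lambda>N. \<Sum>n\<in>X N. a n * harmonic \<omega> n t) \<longlonglongrightarrow> G t"
    "\<And>t. (G has_derivative (\<lambda>h. h *\<^sub>R g' t)) (at t)" by auto
  have "G = g"
    using LIMSEQ_unique [OF G(1) filterlim_compose [OF g [unfolded has_sum_def] X]] by blast
  with G(2) show "(g has_vector_derivative g' t) (at t)"
    by (simp add: has_vector_derivative_def)
qed

section \<open>Solutions in the quarter plane\<close>

lemma vector_derivative_unique_half_line:
  fixes x :: real
  assumes "x \<ge> 0" "(f has_vector_derivative f') (at x within {0..})" "(f has_vector_derivative f'') (at x within {0..})"
  shows "f' = f''"
  using vector_derivative_unique_within_closed_interval [of 0 "x + 1" x f f' f'']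
    has_vector_derivative_within_subset [OF assms(2), of "cbox 0 (x + 1)"]
    has_vector_derivative_within_subset [OF assms(3), of "cbox 0 (x + 1)"] assms(1)
  by auto

lemma smooth_quarter_plane_partials:
  assumes "smooth_quarter_plane u"
  shows "continuous_on ({0..} \<times> {0..}) (\<lambda>(x, t). u x t)"
    and "smooth_quarter_plane (partial_x u)" and "smooth_quarter_plane (partial_t u)"
    and "\<And>x t. x \<ge> 0 \<Longrightarrow> t \<ge> 0 \<Longrightarrow> ((\<lambda>y. u y t) has_vector_derivative partial_x u x t) (at x within {0..})"
    and "\<And>x t. x \<ge> 0 \<Longrightarrow> t \<ge> 0 \<Longrightarrow> ((\<lambda>s. u x s) has_vector_derivative partial_t u x t) (at t within {0..})"
proof -
  have Ck: "Ck_quarter_plane (Suc k) u" for k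
    using assms unfolding smooth_quarter_plane_def by blast
  show "continuous_on ({0..} \<times> {0..}) (\<lambda>(x, t). u x t)"
    "smooth_quarter_plane (partial_x u)" "smooth_quarter_plane (partial_t u)"
    using Ck by (auto simp: smooth_quarter_plane_def)
  show "((\<lambda>y. u y t) has_vector_derivative partial_x u x t) (at x within {0..})"
    "((\<lambda>s. u x s) has_vector_derivative partial_t u x t) (at t within {0..})"
    if "x \<ge> 0" "t \<ge> 0" for x t
    using Ck [of 0] that by (auto simp: partial_x_def partial_t_def deriv_within_def vector_derivative_works)
qed

text \<open>Write u(y, s) as u(0, s) plus the integral of u_x over [0, y], differentiate under the
  integral sign in s, and then apply the fundamental theorem of calculus in y. The argument includes
  the boundary points, where the derivatives are one-sided.\<close>

lemma mixed_partials:
  assumes u: "smooth_quarter_plane u" and x: "x \<ge> 0" and t: "t \<ge> 0"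
  shows "((\<lambda>y. partial_t u y t) has_vector_derivative partial_t (partial_x u) x t) (at x within {0..})"
proof -
  note U = smooth_quarter_plane_partials [OF u]
  note V = smooth_quarter_plane_partials [OF U(2)]
  let ?v = "partial_x u" and ?w = "partial_t (partial_x u)"
  have cv: "continuous_on {0..y} (\<lambda>z. ?v z s)" if "s \<ge> 0" for y s
    using that by (intro continuous_on_quarter_plane_compose [OF V(1)] continuous_intros) auto
  have cw: "continuous_on {0..y} (\<lambda>z. ?w z t)" for y
    using t by (intro continuous_on_quarter_plane_compose [OF smooth_quarter_plane_partials(1) [OF V(3)]] continuous_intros) auto
  have eq: "partial_t u y t = partial_t u 0 t + integral {0..y} (\<lambda>z. ?w z t)" if y: "y \<ge> 0" for y
  proof (rule vector_derivative_unique_half_line [OF t U(5) [OF y t]])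
    have "((\<lambda>s. integral (cbox 0 y) (\<lambda>z. ?v z s)) has_vector_derivative integral (cbox 0 y) (\<lambda>z. ?w z t)) (at t within {0..})"
    proof (rule leibniz_rule_vector_derivative)
      show "continuous_on ({0..} \<times> cbox 0 y) (\<lambda>(s, z). ?w z s)"
        unfolding split_beta
        by (intro continuous_on_quarter_plane_compose [OF smooth_quarter_plane_partials(1) [OF V(3)]] continuous_intros) auto
    qed (use V(5) cv t in \<open>auto intro!: integrable_continuous_interval\<close>)
    from has_vector_derivative_add [OF U(5) [OF order_refl t] this]
    have "((\<lambda>s. u 0 s + integral {0..y} (\<lambda>z. ?v z s)) has_vector_derivative
        partial_t u 0 t + integral {0..y} (\<lambda>z. ?w z t)) (at t within {0..})"
      by simp
    then show "((\<lambda>s. u y s) has_vector_derivative partial_t u 0 t + integral {0..y} (\<lambda>z. ?w z t)) (at t within {0..})"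
    proof (rule has_vector_derivative_transform [rotated -1])
      fix s :: real assume s: "s \<in> {0..}"
      have "((\<lambda>z. ?v z s) has_integral (u y s - u 0 s)) {0..y}"
        using s y has_vector_derivative_within_subset [OF U(4) [of _ s], of _ "{0..y}"]
        by (intro fundamental_theorem_of_calculus [where f = "\<lambda>z. u z s"]) auto
      then show "u y s = u 0 s + integral {0..y} (\<lambda>z. ?v z s)"
        by (simp add: integral_unique)
    qed (use t in auto)
  qed
  have "((\<lambda>y. integral {0..y} (\<lambda>z. ?w z t)) has_vector_derivative ?w x t) (at x within {0..x + 1})"
    using x by (intro integral_has_vector_derivative cw) auto
  moreover have "at x within {0..x + 1} = at x within {0..}"
    by (rule at_within_nhd [of x "{..<x + 1}"]) auto
  ultimately have "((\<lambda>y. integral {0..y} (\<lambda>z. ?w z t)) has_vector_derivative ?w x t) (at x within {0..})"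
    by simp
  from has_vector_derivative_add [OF has_vector_derivative_const this, of "partial_t u 0 t"]
  have "((\<lambda>y. partial_t u 0 t + integral {0..y} (\<lambda>z. ?w z t)) has_vector_derivative ?w x t) (at x within {0..})"
    by simp
  then show ?thesis
  proof (rule has_vector_derivative_transform [rotated -1])
    fix y :: real assume "y \<in> {0..}"
    then show "partial_t u y t = partial_t u 0 t + integral {0..y} (\<lambda>z. ?w z t)"
      by (intro eq) simp
  qed (use x in simp)
qed

lemma schwartz_half_line_decay:
  assumes "v \<in> schwartz_half_line"
  shows "\<exists>C. \<forall>x\<ge>0. (1 + x)\<^sup>2 * norm ((deriv_within {0..} ^^ m) v x) \<le> C"
proof -
  let ?d = "(deriv_within {0..} ^^ m) v"
  have "bounded ((\<lambda>x. of_real (x ^ n) * ?d x) ` {0..})" for n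
    using assms unfolding schwartz_half_line_def by blast
  then have "\<exists>C. \<forall>x\<ge>0. x ^ n * norm (?d x) \<le> C" for n
    unfolding bounded_iff by (fastforce simp: norm_mult norm_power)
  from this [of 0] this [of 2] obtain C0 C2 where C: "\<And>x. x \<ge> 0 \<Longrightarrow> norm (?d x) \<le> C0"
    "\<And>x. x \<ge> 0 \<Longrightarrow> x\<^sup>2 * norm (?d x) \<le> C2" by auto
  have "(1 + x)\<^sup>2 * norm (?d x) \<le> 2 * C0 + 2 * C2" if "x \<ge> 0" for x
  proof -
    have "(1 + x)\<^sup>2 \<le> 2 + 2 * x\<^sup>2"
      using zero_le_power2 [of "1 - x"] by (simp add: power2_sum power2_diff)
    then have "(1 + x)\<^sup>2 * norm (?d x) \<le> (2 + 2 * x\<^sup>2) * norm (?d x)"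
      by (rule mult_right_mono) auto
    also have "\<dots> = 2 * norm (?d x) + 2 * (x\<^sup>2 * norm (?d x))" by (simp add: algebra_simps)
    also have "\<dots> \<le> 2 * C0 + 2 * C2" using C [OF that] by linarith
    finally show ?thesis .
  qed
  then show ?thesis by blast
qed

text \<open>The equation is given in the open quarter plane and extends by continuity of the
  derivatives along a diagonal sequence. The trace at x = 0 is where it links the Neumann datum of
  u_x to the Dirichlet datum of u.\<close>

lemma schroedinger_equation_closed:
  assumes u: "schroedinger_quarter_plane_solution u" and x: "x \<ge> 0" and t: "t \<ge> 0"
  shows "partial_t u x t = \<i> * partial_x (partial_x u) x t"
proof -
  have s: "smooth_quarter_plane u" using u by (simp add: schroedinger_quarter_plane_solution_def)
  note U = smooth_quarter_plane_partials [OF s]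
  define F where "F = (\<lambda>(x, t). \<i> * partial_t u x t + partial_x (partial_x u) x t)"
  have "continuous_on ({0..} \<times> {0..}) (\<lambda>z. \<i> * (case z of (x, t) \<Rightarrow> partial_t u x t) + (case z of (x, t) \<Rightarrow> partial_x (partial_x u) x t))"
    by (intro continuous_intros smooth_quarter_plane_partials(1) U(3) smooth_quarter_plane_partials(2) [OF U(2)])
  then have "continuous_on ({0..} \<times> {0..}) F"
    by (simp add: F_def split_beta)
  moreover have "(\<lambda>n. (x + inverse (real (Suc n)), t + inverse (real (Suc n)))) \<longlonglongrightarrow> (x + 0, t + 0)"
    by (intro tendsto_intros LIMSEQ_inverse_real_of_nat)
  ultimately have "(F \<circ> (\<lambda>n. (x + inverse (real (Suc n)), t + inverse (real (Suc n))))) \<longlonglongrightarrow> F (x, t)"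
    using x t unfolding continuous_on_sequentially by (auto simp: add_nonneg_nonneg)
  moreover have "F \<circ> (\<lambda>n. (x + inverse (real (Suc n)), t + inverse (real (Suc n)))) = (\<lambda>_. 0)"
    using u x t by (auto simp: F_def schroedinger_quarter_plane_solution_def fun_eq_iff add_nonneg_pos)
  ultimately have "F (x, t) = 0"
    using LIMSEQ_unique tendsto_const by metis
  then have "\<i> * (\<i> * partial_t u x t + partial_x (partial_x u) x t) = 0"
    by (simp add: F_def)
  then show ?thesis
    by (simp add: distrib_left flip: mult.assoc)
qed

text \<open>The evolution equation for u_x is the x-derivative of u_t = i u_xx, with the mixed
  partials exchanged; the decay of u_x and u_xx is part of the Schwartz condition at each
  time.\<close>

lemma solution_neumann_evolution:
  assumes u: "schroedinger_quarter_plane_solution u"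
  shows "neumann_evolution (partial_x u) (partial_x (partial_x u)) (partial_x (partial_x (partial_x u)))"
proof -
  have s: "smooth_quarter_plane u" using u by (simp add: schroedinger_quarter_plane_solution_def)
  note U = smooth_quarter_plane_partials [OF s]
  note U1 = smooth_quarter_plane_partials [OF U(2)]
  note U2 = smooth_quarter_plane_partials [OF U1(2)]
  show ?thesis
  proof
    fix y t :: real assume yt: "y \<ge> 0" "t \<ge> 0"
    show "((\<lambda>y. partial_x u y t) has_vector_derivative partial_x (partial_x u) y t) (at y within {0..})"
      by (rule U1(4) [OF yt])
    show "((\<lambda>y. partial_x (partial_x u) y t) has_vector_derivative partial_x (partial_x (partial_x u)) y t) (at y within {0..})"
      by (rule U2(4) [OF yt])
    have "((\<lambda>y. partial_t u y t) has_vector_derivative \<i> * partial_x (partial_x (partial_x u)) y t) (at y within {0..})"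
      by (rule has_vector_derivative_transform [OF _ _ has_vector_derivative_mult_right [OF U2(4) [OF yt]]])
         (use yt schroedinger_equation_closed [OF u] in auto)
    then have "partial_t (partial_x u) y t = \<i> * partial_x (partial_x (partial_x u)) y t"
      using vector_derivative_unique_half_line [OF yt(1) mixed_partials [OF s yt]] by blast
    then show "((\<lambda>s. partial_x u y s) has_vector_derivative \<i> * partial_x (partial_x (partial_x u)) y t) (at t within {0..})"
      using U1(5) [OF yt] by simp
  next
    fix t :: real assume "t \<ge> 0"
    then have sch: "(\<lambda>x. u x t) \<in> schwartz_half_line"
      using u by (simp add: schroedinger_quarter_plane_solution_def)
    obtain C1 C2 where C: "\<And>x. x \<ge> 0 \<Longrightarrow> (1 + x)\<^sup>2 * norm (partial_x u x t) \<le> C1"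
      "\<And>x. x \<ge> 0 \<Longrightarrow> (1 + x)\<^sup>2 * norm (partial_x (partial_x u) x t) \<le> C2"
      using schwartz_half_line_decay [OF sch, of 1] schwartz_half_line_decay [OF sch, of 2]
      by (auto simp: partial_x_def [abs_def] numeral_2_eq_2)
    then have "\<forall>y\<ge>0. (1 + y)\<^sup>2 * norm (partial_x u y t) \<le> max C1 C2 \<and> (1 + y)\<^sup>2 * norm (partial_x (partial_x u) y t) \<le> max C1 C2"
      by (simp add: max.coboundedI1 max.coboundedI2)
    then show "\<exists>M. \<forall>y\<ge>0. (1 + y)\<^sup>2 * norm (partial_x u y t) \<le> M \<and> (1 + y)\<^sup>2 * norm (partial_x (partial_x u) y t) \<le> M"
      by blast
  qed (rule U1(1) U2(1) smooth_quarter_plane_partials(1) [OF U2(2)])+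
qed

theorem proposition2p6:
  fixes u :: "real \<Rightarrow> real \<Rightarrow> complex"
    and g0 :: "real \<Rightarrow> complex"
    and a :: "int \<Rightarrow> complex"
    and \<omega> :: real
  assumes "schroedinger_quarter_plane_solution u"
    and "\<omega> > 0"
    and "smooth_within UNIV g0"
    and "\<And>t. g0 (t + 2 * pi / \<omega>) = g0 t"
    and "\<And>t. t > 0 \<Longrightarrow>
           ((\<lambda>n. a n * exp (\<i> * of_int n * of_real \<omega> * of_real t)) has_sum g0 t) UNIV"
    and "a 0 = 0"
    and "(\<lambda>t. u 0 t - g0 t) \<in> schwartz_half_line"
  shows "(\<forall>t. (\<lambda>n. neumann_coeff \<omega> a n * exp (\<i> * of_int n * of_real \<omega> * of_real t))
                summable_on UNIV) \<and>
         (\<lambda>t. partial_x u 0 t - neumann_periodic \<omega> a t)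
           \<in> O[at_top](\<lambda>t. of_real (t powr (- 1 / 2)))"
proof -
  note u = assms(1) and \<omega> = assms(2) and smooth = assms(3) and per = assms(4) and a0 = assms(6)
  have harm: "exp (\<i> * of_int n * of_real \<omega> * of_real t) = harmonic \<omega> n t" for n t
    by (simp add: harmonic_def mult.assoc)
  \<comment> \<open>The expansion is assumed for positive times; shifting by sufficiently many
    periods carries it to every real t.\<close>
  have g: "((\<lambda>n. a n * harmonic \<omega> n t) has_sum g0 t) UNIV" for t
  proof -
    let ?T = "2 * pi / \<omega>"
    have shift: "g0 (t + real k * ?T) = g0 t \<and> harmonic \<omega> n (t + real k * ?T) = harmonic \<omega> n t" for k n
    proof (induction k)
      case (Suc k)
      have "t + real (Suc k) * ?T = (t + real k * ?T) + ?T"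
        unfolding of_nat_Suc distrib_right by simp
      then show ?case using Suc.IH per harmonic_period [OF \<omega>] by metis
    qed simp
    obtain k where "- t < real k * ?T"
      using reals_Archimedean3 [of ?T] \<omega> by auto
    then have "t + real k * ?T > 0" by linarith
    from assms(5) [OF this] show ?thesis
      unfolding harm using shift by simp
  qed
  have sum_w: "(\<lambda>n. real_of_int \<bar>n\<bar> * norm (a n)) summable_on UNIV"
    by (rule fourier_coefficients_summable [OF \<omega> smooth per g])
  then obtain W where W: "((\<lambda>n. real_of_int \<bar>n\<bar> * norm (a n)) has_sum W) UNIV"
    by (auto simp: summable_on_def)
  define g' where "g' t = (\<Sum>\<^sub>\<infinity>n. \<i> * of_real (of_int n * \<omega>) * a n * harmonic \<omega> n t)" for t
  note g' = fourier_series_has_vector_derivative [OF \<omega> g sum_w, folded g'_def]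
  have abs_ge: "1 \<le> \<bar>real_of_int n\<bar>" if "n \<noteq> 0" for n :: int
    using that by linarith
  \<comment> \<open>As |n| \<ge> 1 for nonzero n, both terms of the error of a mode, sqrt |\<mu>|
    and its inverse, are bounded by multiples of |n|, so one weighted sum W controls all of
    them.\<close>
  have sqrt_le: "sqrt \<bar>of_int n * \<omega>\<bar> \<le> sqrt \<omega> * real_of_int \<bar>n\<bar>" "1 / sqrt \<bar>of_int n * \<omega>\<bar> \<le> 1 / sqrt \<omega> * real_of_int \<bar>n\<bar>"
    if "n \<noteq> 0" for n :: int
  proof -
    have eq: "sqrt \<bar>of_int n * \<omega>\<bar> = sqrt \<omega> * sqrt \<bar>real_of_int n\<bar>"
      using \<omega> by (simp add: abs_mult real_sqrt_mult mult.commute)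
    have "sqrt \<bar>real_of_int n\<bar> \<le> sqrt (\<bar>real_of_int n\<bar>\<^sup>2)"
      using mult_left_mono [OF abs_ge [OF that], of "\<bar>real_of_int n\<bar>"]
      by (intro real_sqrt_le_mono) (simp add: power2_eq_square)
    then have le: "sqrt \<bar>real_of_int n\<bar> \<le> \<bar>real_of_int n\<bar>" by simp
    then show "sqrt \<bar>of_int n * \<omega>\<bar> \<le> sqrt \<omega> * real_of_int \<bar>n\<bar>"
      unfolding eq using \<omega> by (simp add: mult_left_mono)
    have "1 \<le> sqrt \<bar>real_of_int n\<bar>" using abs_ge [OF that] by simp
    then have "1 / (sqrt \<omega> * sqrt \<bar>real_of_int n\<bar>) \<le> 1 / (sqrt \<omega> * 1)"
      using \<omega> by (intro divide_left_mono mult_left_mono mult_pos_pos) auto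
    also have "\<dots> \<le> 1 / sqrt \<omega> * \<bar>real_of_int n\<bar>"
      using \<omega> mult_left_mono [OF abs_ge [OF that], of "1 / sqrt \<omega>"] by simp
    finally show "1 / sqrt \<bar>of_int n * \<omega>\<bar> \<le> 1 / sqrt \<omega> * real_of_int \<bar>n\<bar>"
      unfolding eq by simp
  qed
  have coeff: "neumann_coeff \<omega> a n = dtn_symbol (of_int n * \<omega>) * a n" for n
    using \<omega> a0 by (cases "n = 0") (auto simp: neumann_coeff_def dtn_symbol_def zero_less_mult_iff)
  have norm_symbol: "norm (dtn_symbol \<mu>) = sqrt \<bar>\<mu>\<bar>" for \<mu>
    by (auto simp: dtn_symbol_def norm_mult)
  have sum_c: "(\<lambda>n. neumann_coeff \<omega> a n * harmonic \<omega> n t) summable_on UNIV" for t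
  proof -
    have le: "norm (neumann_coeff \<omega> a n * harmonic \<omega> n t) \<le> sqrt \<omega> * (real_of_int \<bar>n\<bar> * norm (a n))" for n
    proof (cases "n = 0")
      case False
      from mult_right_mono [OF sqrt_le(1) [OF this], of "norm (a n)"] show ?thesis
        by (simp add: coeff norm_mult norm_symbol mult.assoc)
    qed (simp add: neumann_coeff_def)
    have "(\<lambda>n. sqrt \<omega> * (real_of_int \<bar>n\<bar> * norm (a n))) summable_on UNIV"
      by (intro summable_on_cmult_right sum_w)
    from Infinite_Sum.abs_summable_on_comparison_test' [OF this le] show ?thesis
      by (simp only: summable_on_iff_abs_summable_on_complex)
  qed
  interpret neumann_evolution "partial_x u" "partial_x (partial_x u)" "partial_x (partial_x (partial_x u))"
    by (rule solution_neumann_evolution [OF u])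
  have s: "smooth_quarter_plane u" using u by (simp add: schroedinger_quarter_plane_solution_def)
  define h' where "h' = deriv_within {0..} (\<lambda>t. u 0 t - g0 t)"
  obtain Ch where Ch: "\<And>t. t \<ge> 0 \<Longrightarrow> (1 + t)\<^sup>2 * norm (h' t) \<le> Ch"
    using schwartz_half_line_decay [OF assms(7), of 1] by (auto simp: h'_def)
  have Ch0: "Ch \<ge> 0" using order_trans [OF norm_ge_zero [of "h' 0"]] Ch [of 0] by simp
  \<comment> \<open>The equation at x = 0 gives u_xx = -i u_t, and u_t splits into the derivative of
    the periodic part and that of the Schwartz part.\<close>
  have trace: "partial_x (partial_x u) 0 t = - \<i> * (g' t + h' t)" if t: "t \<ge> 0" for t
  proof -
    have "((\<lambda>t. u 0 t - g0 t) has_vector_derivative partial_t u 0 t - g' t) (at t within {0..})"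
      by (intro has_vector_derivative_diff smooth_quarter_plane_partials(5) [OF s]
          has_vector_derivative_at_within [OF g'(1)] t order_refl)
    moreover from this have "((\<lambda>t. u 0 t - g0 t) has_vector_derivative h' t) (at t within {0..})"
      unfolding h'_def deriv_within_def by (metis differentiableI_vector vector_derivative_works)
    ultimately have "partial_t u 0 t - g' t = h' t"
      by (rule vector_derivative_unique_half_line [OF t])
    then have "\<i> * partial_x (partial_x u) 0 t = g' t + h' t"
      using schroedinger_equation_closed [OF u order_refl t] by (simp add: algebra_simps)
    then have "- \<i> * (\<i> * partial_x (partial_x u) 0 t) = - \<i> * (g' t + h' t)" by simp
    then show ?thesis by (simp flip: mult.assoc)
  qed
  obtain M where M: "\<And>y. y \<ge> 0 \<Longrightarrow> (1 + y)\<^sup>2 * norm (partial_x u y 0) \<le> M"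
    using decay [OF order_refl] by blast
  define L where "L = 2 * (2 * sqrt \<omega> + 4 / sqrt \<omega>)"
  have L0: "L \<ge> 0" using \<omega> by (simp add: L_def)
  \<comment> \<open>The three contributions are the initial value of u_x, the errors of the modes,
    and the Schwartz part of the boundary value; 6 = 2 * 3, with 3 from the weighted Abel integral
    and 2 from the factor \<open>2 * csqrt \<i>\<close>.\<close>
  define K where "K = (2 * M + L * W + 6 * Ch) / gauss_mass"
  have main: "norm (partial_x u 0 T - neumann_periodic \<omega> a T) \<le> K * (1 / sqrt T)" if T: "T > 0" for T
  proof -
    let ?r = "\<lambda>s. complex_of_real (sqrt (T - s))"
    let ?b = "partial_x (partial_x u) 0"
    let ?N = "\<lambda>X. \<Sum>n\<in>X. neumann_coeff \<omega> a n * harmonic \<omega> n T"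
    \<comment> \<open>Working with a finite set X of frequencies avoids exchanging the singular Abel
      integral with the infinite series. The omitted frequencies cost the tail of the weighted sum
      times 4 \<omega> sqrt T, one factor 2 sqrt T being the integral of (T - s)^(-1/2).\<close>
    have fin: "gauss_mass * norm (partial_x u 0 T - ?N X)
        \<le> (2 * M + L * W + 6 * Ch) / sqrt T + 4 * sqrt T * \<omega> * (W - (\<Sum>n\<in>X. real_of_int \<bar>n\<bar> * norm (a n)))"
      if X: "finite X" for X
    proof -
      let ?b' = "\<lambda>s. \<Sum>n\<in>X. of_real (of_int n * \<omega>) * a n * harmonic \<omega> n s"
      define tail where "tail = \<omega> * (W - (\<Sum>n\<in>X. real_of_int \<bar>n\<bar> * norm (a n)))"
      define I where "I n = integral {0..T} (\<lambda>s. harmonic \<omega> n s / ?r s)" for n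
      have int_harm: "(\<lambda>s. harmonic \<omega> n s / ?r s) integrable_on {0..T}" if "n \<noteq> 0" for n
        unfolding harmonic_def using abel_integral_exponential(1) [of "of_int n * \<omega>" T] that \<omega> T by simp
      have mode: "norm (of_real gauss_mass * (neumann_coeff \<omega> a n * harmonic \<omega> n T)
          + 2 * csqrt \<i> * (of_real (of_int n * \<omega>) * a n * I n)) \<le> L / sqrt T * (real_of_int \<bar>n\<bar> * norm (a n))" for n
      proof (cases "n = 0")
        case False
        let ?\<mu> = "of_int n * \<omega>"
        have "norm (of_real gauss_mass * (neumann_coeff \<omega> a n * harmonic \<omega> n T)
            + 2 * csqrt \<i> * (of_real ?\<mu> * a n * I n))
          = norm (a n * (of_real gauss_mass * (dtn_symbol ?\<mu> * harmonic \<omega> n T) + 2 * csqrt \<i> * (of_real ?\<mu> * I n)))"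
          unfolding coeff by (simp add: algebra_simps del: csqrt_ii)
        also have "\<dots> \<le> norm (a n) * (2 * (2 * sqrt \<bar>?\<mu>\<bar> + 4 / sqrt \<bar>?\<mu>\<bar>) / sqrt T)"
          unfolding norm_mult [of "a n"] I_def harmonic_def using False \<omega> T
          by (intro mult_left_mono abel_integral_exponential) auto
        also have "\<dots> \<le> norm (a n) * (2 * (2 * (sqrt \<omega> * real_of_int \<bar>n\<bar>) + 4 * (1 / sqrt \<omega> * real_of_int \<bar>n\<bar>)) / sqrt T)"
          using sqrt_le [OF False] T by (intro mult_left_mono divide_right_mono add_mono) auto
        also have "\<dots> = L / sqrt T * (real_of_int \<bar>n\<bar> * norm (a n))"
          by (simp add: L_def algebra_simps add_divide_distrib)
        finally show ?thesis .
      qed (simp add: a0 neumann_coeff_def)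
      have int_term: "(\<lambda>s. of_real (of_int n * \<omega>) * a n * (harmonic \<omega> n s / ?r s)) integrable_on {0..T}" for n
      proof (cases "n = 0")
        case False
        then show ?thesis by (intro integrable_on_mult_right int_harm)
      qed (simp add: integrable_0)
      have b'_eq: "(\<lambda>s. ?b' s / ?r s) = (\<lambda>s. \<Sum>n\<in>X. of_real (of_int n * \<omega>) * a n * (harmonic \<omega> n s / ?r s))"
        by (simp add: fun_eq_iff sum_divide_distrib)
      have int_b': "(\<lambda>s. ?b' s / ?r s) integrable_on {0..T}"
        unfolding b'_eq by (intro integrable_sum X int_term)
      have "integral {0..T} (\<lambda>s. ?b' s / ?r s) = (\<Sum>n\<in>X. of_real (of_int n * \<omega>) * a n * I n)"
        unfolding b'_eq I_def by (subst integral_sum [OF X int_term]) (simp only: integral_mult_right)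
      then have "norm (of_real gauss_mass * ?N X + 2 * csqrt \<i> * integral {0..T} (\<lambda>s. ?b' s / ?r s))
          = norm (\<Sum>n\<in>X. of_real gauss_mass * (neumann_coeff \<omega> a n * harmonic \<omega> n T)
              + 2 * csqrt \<i> * (of_real (of_int n * \<omega>) * a n * I n))"
        by (simp only: sum.distrib sum_distrib_left)
      also have "\<dots> \<le> (\<Sum>n\<in>X. L / sqrt T * (real_of_int \<bar>n\<bar> * norm (a n)))"
        by (intro sum_norm_le mode)
      also have "\<dots> \<le> L / sqrt T * W"
        unfolding sum_distrib_left [symmetric] using L0 T
        by (intro mult_left_mono finite_sum_le_has_sum [OF W] X) auto
      finally have 1: "norm (of_real gauss_mass * ?N X + 2 * csqrt \<i> * integral {0..T} (\<lambda>s. ?b' s / ?r s)) \<le> L * W / sqrt T"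
        by simp
      have 2: "norm (of_real gauss_mass * partial_x u 0 T + 2 * csqrt \<i> * integral {0..T} (\<lambda>s. ?b s / ?r s)) \<le> 2 * M / sqrt T"
        by (rule dirichlet_value_bound [OF T M])
      have int_b: "(\<lambda>s. ?b s / ?r s) integrable_on {0..T}"
        by (rule boundary_integral_limit [OF T])
      let ?h = "\<lambda>s. sqrt 2 / sqrt T * (1 / (1 + s)\<^sup>2) + 1 / (1 + T / 2)\<^sup>2 * (1 / sqrt (T - s))"
      note sing = has_integral_inverse_sqrt_singular [of T]
      \<comment> \<open>Up to the factor -i the difference consists of the derivative of the
        Schwartz part and the remainder of the series for \<open>g'\<close>, the latter bounded
        uniformly in s.\<close>
      have diff: "norm (?b s - ?b' s) \<le> Ch * (1 / (1 + s)\<^sup>2) + tail" if s: "s \<in> {0..T}" for s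
      proof -
        have "norm (g' s - (\<Sum>n\<in>X. \<i> * of_real (of_int n * \<omega>) * a n * harmonic \<omega> n s))
            \<le> \<omega> * W - (\<Sum>n\<in>X. \<omega> * (real_of_int \<bar>n\<bar> * norm (a n)))"
          using \<omega> by (intro norm_has_sum_diff_sum_le [OF g'(2) has_sum_cmult_right [OF W]] X) (simp add: norm_mult abs_mult)
        also have "\<dots> = tail"
          by (simp add: tail_def right_diff_distrib sum_distrib_left)
        finally have t: "norm (g' s - (\<Sum>n\<in>X. \<i> * of_real (of_int n * \<omega>) * a n * harmonic \<omega> n s)) \<le> tail" .
        have "?b' s = - \<i> * (\<Sum>n\<in>X. \<i> * of_real (of_int n * \<omega>) * a n * harmonic \<omega> n s)"
          by (simp add: sum_distrib_left flip: mult.assoc)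
        then have "?b s - ?b' s = - \<i> * (h' s + (g' s - (\<Sum>n\<in>X. \<i> * of_real (of_int n * \<omega>) * a n * harmonic \<omega> n s)))"
          using trace [of s] s by (simp add: algebra_simps)
        then have "norm (?b s - ?b' s) = norm (h' s + (g' s - (\<Sum>n\<in>X. \<i> * of_real (of_int n * \<omega>) * a n * harmonic \<omega> n s)))"
          by (simp only: norm_mult norm_minus_cancel norm_ii mult_1)
        also have "\<dots> \<le> norm (h' s) + tail"
          using t norm_triangle_ineq order_trans add_left_mono by blast
        also have "norm (h' s) \<le> Ch * (1 / (1 + s)\<^sup>2)"
          using Ch [of s] s by (simp add: field_simps)
        finally show ?thesis by simp
      qed
      have "norm (integral {0..T} (\<lambda>s. ?b s / ?r s - ?b' s / ?r s))
          \<le> integral {0..T} (\<lambda>s. Ch * ?h s + tail * (1 / sqrt (T - s)))"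
      proof (rule integral_norm_bound_integral)
        show "(\<lambda>s. ?b s / ?r s - ?b' s / ?r s) integrable_on {0..T}"
          by (intro integrable_diff int_b int_b')
        show "(\<lambda>s. Ch * ?h s + tail * (1 / sqrt (T - s))) integrable_on {0..T}"
          using sing T by (intro integrable_add integrable_on_mult_right abel_integral_inverse_square_le) auto
      next
        fix s assume s: "s \<in> {0..T}"
        have "norm (?b s / ?r s - ?b' s / ?r s) = norm (?b s - ?b' s) * (1 / sqrt (T - s))"
          using s by (simp add: norm_divide flip: diff_divide_distrib)
        also have "\<dots> \<le> (Ch * (1 / (1 + s)\<^sup>2) + tail) * (1 / sqrt (T - s))"
          using s by (intro mult_right_mono diff) auto
        also have "\<dots> = Ch * (1 / (1 + s)\<^sup>2 * (1 / sqrt (T - s))) + tail * (1 / sqrt (T - s))"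
          by (simp add: algebra_simps)
        also have "\<dots> \<le> Ch * ?h s + tail * (1 / sqrt (T - s))"
          by (intro add_right_mono mult_left_mono abel_integral_inverse_square_le T s Ch0)
        finally show "norm (?b s / ?r s - ?b' s / ?r s) \<le> Ch * ?h s + tail * (1 / sqrt (T - s))" .
      qed
      also have "\<dots> = Ch * integral {0..T} ?h + tail * (2 * sqrt T)"
        using T by (intro integral_unique has_integral_add has_integral_mult_right integrable_integral
            abel_integral_inverse_square_le sing) auto
      also have "\<dots> \<le> Ch * (3 / sqrt T) + tail * (2 * sqrt T)"
        by (intro add_right_mono mult_left_mono abel_integral_inverse_square_le T Ch0)
      finally have 3: "norm (integral {0..T} (\<lambda>s. ?b s / ?r s) - integral {0..T} (\<lambda>s. ?b' s / ?r s))
          \<le> Ch * (3 / sqrt T) + tail * (2 * sqrt T)"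
        by (simp only: integral_diff [OF int_b int_b'])
      define J J' where "J = integral {0..T} (\<lambda>s. ?b s / ?r s)" and "J' = integral {0..T} (\<lambda>s. ?b' s / ?r s)"
      have "gauss_mass * norm (partial_x u 0 T - ?N X) = norm (of_real gauss_mass * (partial_x u 0 T - ?N X))"
        using gauss_mass_pos by (simp add: norm_mult)
      \<comment> \<open>The solution and the finite sum of modes satisfy the same boundary relation
        up to O(T^(-1/2)), so their difference is governed by the difference of their Abel
        integrals.\<close>
      also have "of_real gauss_mass * (partial_x u 0 T - ?N X)
          = (of_real gauss_mass * partial_x u 0 T + 2 * csqrt \<i> * J) - (of_real gauss_mass * ?N X + 2 * csqrt \<i> * J')
            - 2 * csqrt \<i> * (J - J')"
        by (simp add: algebra_simps del: csqrt_ii)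
      also have "norm \<dots> \<le> 2 * M / sqrt T + L * W / sqrt T + 2 * (Ch * (3 / sqrt T) + tail * (2 * sqrt T))"
      proof (intro order_trans [OF norm_triangle_ineq4] add_mono)
        show "norm (2 * csqrt \<i> * (J - J')) \<le> 2 * (Ch * (3 / sqrt T) + tail * (2 * sqrt T))"
          using 3 by (simp add: norm_mult J_def J'_def del: csqrt_ii)
      qed (use 1 2 in \<open>simp_all only: J_def J'_def\<close>)
      also have "\<dots> = (2 * M + L * W + 6 * Ch) / sqrt T + 4 * sqrt T * tail"
        by (simp add: add_divide_distrib algebra_simps)
      finally show ?thesis by (simp add: tail_def mult_ac)
    qed
    let ?F = "finite_subsets_at_top (UNIV :: int set)"
    \<comment> \<open>X exhausts the integers while T stays fixed, so the tail vanishes despite its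
      factor sqrt T, and a bound uniform in T remains.\<close>
    have "(?N \<longlongrightarrow> neumann_periodic \<omega> a T) ?F"
      using has_sum_infsum [OF sum_c [of T]] unfolding has_sum_def neumann_periodic_def harm .
    then have "((\<lambda>X. gauss_mass * norm (partial_x u 0 T - ?N X)) \<longlongrightarrow> gauss_mass * norm (partial_x u 0 T - neumann_periodic \<omega> a T)) ?F"
      by (intro tendsto_intros)
    moreover have "((\<lambda>X. (2 * M + L * W + 6 * Ch) / sqrt T + 4 * sqrt T * \<omega> * (W - (\<Sum>n\<in>X. real_of_int \<bar>n\<bar> * norm (a n))))
        \<longlongrightarrow> (2 * M + L * W + 6 * Ch) / sqrt T + 4 * sqrt T * \<omega> * (W - W)) ?F"
      using W unfolding has_sum_def by (intro tendsto_intros)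
    moreover have "eventually (\<lambda>X. gauss_mass * norm (partial_x u 0 T - ?N X)
        \<le> (2 * M + L * W + 6 * Ch) / sqrt T + 4 * sqrt T * \<omega> * (W - (\<Sum>n\<in>X. real_of_int \<bar>n\<bar> * norm (a n)))) ?F"
      by (rule eventually_finite_subsets_at_top_weakI) (rule fin)
    ultimately have "gauss_mass * norm (partial_x u 0 T - neumann_periodic \<omega> a T)
        \<le> (2 * M + L * W + 6 * Ch) / sqrt T + 4 * sqrt T * \<omega> * (W - W)"
      by (intro tendsto_le [OF finite_subsets_at_top_neq_bot])
    then have "norm (partial_x u 0 T - neumann_periodic \<omega> a T) \<le> (2 * M + L * W + 6 * Ch) / sqrt T / gauss_mass"
      by (subst pos_le_divide_eq [OF gauss_mass_pos], subst mult.commute) simp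
    then show ?thesis
      by (simp add: K_def mult.commute)
  qed
  have "(\<lambda>t. partial_x u 0 t - neumann_periodic \<omega> a t) \<in> O[at_top](\<lambda>t. of_real (t powr (- 1 / 2)))"
  proof (rule bigoI)
    show "eventually (\<lambda>t. norm (partial_x u 0 t - neumann_periodic \<omega> a t) \<le> K * norm (complex_of_real (t powr (- 1 / 2)))) at_top"
      using eventually_gt_at_top [of 0]
    proof eventually_elim
      case (elim t)
      then have "t powr (- 1 / 2) = 1 / sqrt t"
        by (simp add: powr_minus_divide powr_half_sqrt)
      with main [OF elim] elim show ?case by (simp add: norm_divide)
    qed
  qed
  then show ?thesis using sum_c unfolding harm by blast
qed

end
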